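(* Let $n$ be a positive integer, let $k$ be a subfield of $\mathbb K$, and let $F$ be an additive function defined over $k$ with domain $D_F\subseteq U_n$. Then there exists an $\left(F\to\mathcal A_k(U_n),\ \mathrm{Mir}_n,\ k\right)$-tree, i.e. a tree over $k$ with input AF $F$, all of whose output AFs are AFs defined over $k$ with domain $U_n$, all of whose labels have domain contained in $\mathrm{Mir}_n$, and all of whose conjugation steps are by elements of $\mathrm{Mir}_n(k)$.
   Context: $\mathbb K$ is an algebraically closed field of characteristic $0$; all algebraic groups are over $\mathbb K$, and $k\subseteq\mathbb K$ is a subfield. $U_n$ is the group of upper unitriangular $n\times n$ matrices. An additive function (AF) is a homomorphism of algebraic groups $F:D_F\to(\mathbb K,+)$ whose domain $D_F$ is a unipotent algebraic subgroup of $GL_n$; $\mathcal A(N)$ denotes the AFs with domain $N$, and a subscript $k$ (as in $\mathcal A_k(N)$, $\mathcal A_{k,n}$) restricts to AFs defined over $k$ (domain a $k$-subgroup, $F$ a $k$-morphism). For $\gamma\in GL_n$, $\gamma F$ is the AF with domain $\gamma D_F\gamma^{-1}$ and $\gamma F(u)=F(\gamma^{-1}u\gamma)$. $\mathrm{Mir}_n:=j(SL_{n-1})U_{P_n}$, where $j(g)=\mathrm{diag}(1,g)$ and $U_{P_n}$ is the group of matrices that differ from the identity only in off-diagonal entries of the first row. Steps over $k$ with input AF $F$ (defined over $k$): (e) an e-step: choose a unipotent $k$-subgroup $N$ with $N\supsetneq D_F\supseteq[N,N]$; the outputs are all $Z\in\mathcal A_k(N)$ with $Z|_{D_F}=F$,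 each appearing once; (eu) an eu-step: one output $Z\in\mathcal A_{k,n}$ such that, with $C=D_F\cap D_Z\neq D_F$, one has $C\supseteq[D_F,D_F]\cup[D_Z,D_Z]\cup[D_F,D_Z]$, $F|_C=Z|_C$, and the conjugation action of $C(k)\backslash D_F(k)$ on $\{Q\in\mathcal A_k(D_Z):Q|_C=F|_C\}$ is free and transitive; (co) a co-step: one output $\gamma F$ with $\gamma\in GL_n(k)$. A tree over $k$ is a finite rooted tree with edges directed away from the root, vertices labelled by AFs, such that every non-leaf vertex together with its children and their labels forms a step over $k$; the root label is the input AF, the leaf labels are the output AFs. For a set $S$ of AFs and an algebraic subgroup $H\subseteq GL_n$, an $(F\to S,H,k)$-tree is a tree over $k$ with input $F$, all output AFs in $S$, all label domains contained in $H$, and all co-steps given by elements of $H(k)$.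
   Formalization: A "finite" rooted tree is taken to mean one of bounded depth, with infinitely many children allowed, since an e-step with any output has infinitely many; with finitely many vertices the claim fails for n=2 and F on the trivial group. *)

theory Defs
  imports
    "Jordan_Normal_Form.Determinant"
    "HOL-Algebra.Generated_Groups"
    "HOL-Algebra.Algebraic_Closure_Type"
begin

text \<open>
  Throughout, \<open>'a\<close> is the algebraically closed field of characteristic 0, and an algebraic group
  is identified with its group of \<open>'a\<close>-points. A subfield is a set \<open>k\<close> with
  \<open>subfield k ring_of_type_algebra\<close>.
\<close>

definition GL :: "nat \<Rightarrow> 'a::field mat monoid" where
  "GL n = units_of (ring_mat TYPE('a) n ())"

text \<open>For a set \<open>D\<close> of invertible matrices, the set \<open>D(k)\<close> of its \<open>k\<close>-points.\<close>

definition rat_points :: "nat \<Rightarrow> 'a set \<Rightarrow> 'a::field mat set \<Rightarrow> 'a mat set" where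
  "rat_points n k D = {g \<in> D \<inter> carrier (GL n). \<forall>i<n. \<forall>j<n. g $$ (i, j) \<in> k}"


subsection \<open>Closed subsets of \<open>GL\<^sub>n\<close> and fields of definition\<close>

text \<open>
  The coordinate ring \<open>k[GL\<^sub>n] = k[x\<^sub>i\<^sub>j, 1/det]\<close>, as functions of the matrix. Only the values on
  \<open>GL\<^sub>n\<close> matter; as the field is infinite, they determine the element of the coordinate ring.
\<close>

inductive_set regular_fun :: "nat \<Rightarrow> 'a set \<Rightarrow> ('a::field mat \<Rightarrow> 'a) set"
  for n :: nat and k :: "'a set" where
  const: "c \<in> k \<Longrightarrow> (\<lambda>g. c) \<in> regular_fun n k"
| coord: "i < n \<Longrightarrow> j < n \<Longrightarrow> (\<lambda>g. g $$ (i, j)) \<in> regular_fun n k"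
| inv_det: "(\<lambda>g. inverse (det g)) \<in> regular_fun n k"
| add: "f \<in> regular_fun n k \<Longrightarrow> h \<in> regular_fun n k \<Longrightarrow> (\<lambda>g. f g + h g) \<in> regular_fun n k"
| mult: "f \<in> regular_fun n k \<Longrightarrow> h \<in> regular_fun n k \<Longrightarrow> (\<lambda>g. f g * h g) \<in> regular_fun n k"

definition zariski_closed :: "nat \<Rightarrow> 'a::field mat set \<Rightarrow> bool" where
  "zariski_closed n V \<longleftrightarrow>
     (\<exists>S \<subseteq> regular_fun n UNIV. V = {g \<in> carrier (GL n). \<forall>f\<in>S. f g = 0})"

definition vanishing_ideal :: "nat \<Rightarrow> 'a set \<Rightarrow> 'a::field mat set \<Rightarrow> ('a mat \<Rightarrow> 'a) set" where
  "vanishing_ideal n k V = {f \<in> regular_fun n k. \<forall>g\<in>V. f g = 0}"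

text \<open>
  A closed set is defined over \<open>k\<close> if its full vanishing ideal is generated by its elements with
  coefficients in \<open>k\<close>.
\<close>

definition defined_over :: "nat \<Rightarrow> 'a set \<Rightarrow> 'a::field mat set \<Rightarrow> bool" where
  "defined_over n k V \<longleftrightarrow> zariski_closed n V \<and>
     (\<forall>f \<in> vanishing_ideal n UNIV V.
        \<exists>(m::nat) a h. (\<forall>i<m. a i \<in> regular_fun n UNIV \<and> h i \<in> vanishing_ideal n k V) \<and>
          (\<forall>g \<in> carrier (GL n). f g = (\<Sum>i<m. a i g * h i g)))"

definition unipotent_mat :: "nat \<Rightarrow> 'a::field mat \<Rightarrow> bool" where
  "unipotent_mat n g \<longleftrightarrow> g \<in> carrier_mat n n \<and> (\<exists>m. (g - 1\<^sub>m n) ^\<^sub>m m = 0\<^sub>m n n)"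

definition unipotent_alg_subgroup :: "nat \<Rightarrow> 'a::field mat set \<Rightarrow> bool" where
  "unipotent_alg_subgroup n D \<longleftrightarrow>
     subgroup D (GL n) \<and> zariski_closed n D \<and> (\<forall>g\<in>D. unipotent_mat n g)"

definition unipotent_k_subgroup :: "nat \<Rightarrow> 'a set \<Rightarrow> 'a::field mat set \<Rightarrow> bool" where
  "unipotent_k_subgroup n k D \<longleftrightarrow> unipotent_alg_subgroup n D \<and> defined_over n k D"


subsection \<open>Additive functions\<close>

text \<open>
  An additive function is a pair of its domain and a function that is \<open>undefined\<close> off the domain,
  so that equality of pairs is equality of additive functions.
\<close>

type_synonym 'a af = "'a mat set \<times> ('a mat \<Rightarrow> 'a)"

abbreviation dom_af :: "'a af \<Rightarrow> 'a mat set" where "dom_af \<equiv> fst"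
abbreviation fun_af :: "'a af \<Rightarrow> 'a mat \<Rightarrow> 'a" where "fun_af \<equiv> snd"

definition additive_function :: "nat \<Rightarrow> 'a::field af \<Rightarrow> bool" where
  "additive_function n F \<longleftrightarrow>
     unipotent_alg_subgroup n (dom_af F) \<and>
     fun_af F \<in> extensional (dom_af F) \<and>
     (\<forall>u \<in> dom_af F. \<forall>v \<in> dom_af F. fun_af F (u * v) = fun_af F u + fun_af F v) \<and>
     (\<exists>f \<in> regular_fun n UNIV. \<forall>u \<in> dom_af F. fun_af F u = f u)"

definition AFs_over :: "nat \<Rightarrow> 'a set \<Rightarrow> 'a::field af set" where
  "AFs_over n k =
     {F. additive_function n F \<and> defined_over n k (dom_af F) \<and>
         (\<exists>f \<in> regular_fun n k. \<forall>u \<in> dom_af F. fun_af F u = f u)}"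

definition AFs_on :: "nat \<Rightarrow> 'a set \<Rightarrow> 'a::field mat set \<Rightarrow> 'a af set" where
  "AFs_on n k N = {F \<in> AFs_over n k. dom_af F = N}"

definition conj_af :: "nat \<Rightarrow> 'a::field mat \<Rightarrow> 'a af \<Rightarrow> 'a af" where
  "conj_af n \<gamma> F =
     (let D = (\<lambda>u. \<gamma> * u * inv\<^bsub>GL n\<^esub> \<gamma>) ` dom_af F
      in (D, restrict (\<lambda>u. fun_af F (inv\<^bsub>GL n\<^esub> \<gamma> * u * \<gamma>)) D))"

definition comm_subgroup :: "nat \<Rightarrow> 'a::field mat set \<Rightarrow> 'a mat set \<Rightarrow> 'a mat set" where
  "comm_subgroup n A B =
     generate (GL n) {a * b * inv\<^bsub>GL n\<^esub> a * inv\<^bsub>GL n\<^esub> b | a b. a \<in> A \<and> b \<in> B}"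


subsection \<open>Steps\<close>

definition e_outputs :: "nat \<Rightarrow> 'a set \<Rightarrow> 'a::field af \<Rightarrow> 'a mat set \<Rightarrow> 'a af set" where
  "e_outputs n k F N =
     {Z \<in> AFs_on n k N. restrict (fun_af Z) (dom_af F) = restrict (fun_af F) (dom_af F)}"

definition e_step_subgroup :: "nat \<Rightarrow> 'a set \<Rightarrow> 'a::field af \<Rightarrow> 'a mat set \<Rightarrow> bool" where
  "e_step_subgroup n k F N \<longleftrightarrow>
     unipotent_k_subgroup n k N \<and> dom_af F \<subset> N \<and> comm_subgroup n N N \<subseteq> dom_af F"

text \<open>
  In an eu-step, \<open>D\<^sub>F\<close> normalizes \<open>D\<^sub>Z\<close> and \<open>C\<close>, hence \<open>D\<^sub>F(k)\<close> acts on the set \<open>E\<close> below. The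
  group \<open>C(k)\D\<^sub>F(k)\<close> acts freely iff every stabilizer in \<open>D\<^sub>F(k)\<close> is \<open>C(k)\<close>.
\<close>

definition eu_step :: "nat \<Rightarrow> 'a set \<Rightarrow> 'a::field af \<Rightarrow> 'a af \<Rightarrow> bool" where
  "eu_step n k F Z \<longleftrightarrow>
     Z \<in> AFs_over n k \<and>
     (let DF = dom_af F; DZ = dom_af Z; C = DF \<inter> DZ;
          E = {Q \<in> AFs_on n k DZ. restrict (fun_af Q) C = restrict (fun_af F) C}
      in C \<noteq> DF \<and>
         comm_subgroup n DF DF \<union> comm_subgroup n DZ DZ \<union> comm_subgroup n DF DZ \<subseteq> C \<and>
         restrict (fun_af F) C = restrict (fun_af Z) C \<and>
         (\<forall>Q\<in>E. {d \<in> rat_points n k DF. conj_af n d Q = Q} = rat_points n k C) \<and>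
         (\<forall>Q\<in>E. \<forall>Q'\<in>E. \<exists>d \<in> rat_points n k DF. conj_af n d Q = Q'))"

text \<open>
  The vertices in \<open>B\<close>, labelled by \<open>l\<close>, are the outputs of a step over \<open>k\<close> with input \<open>F\<close>; if it
  is a co-step, then it is given by an element of \<open>\<Gamma>\<close>.
\<close>

definition forms_step ::
    "nat \<Rightarrow> 'a set \<Rightarrow> 'a mat set \<Rightarrow> 'a::field af \<Rightarrow> 'v set \<Rightarrow> ('v \<Rightarrow> 'a af) \<Rightarrow> bool" where
  "forms_step n k \<Gamma> F B l \<longleftrightarrow>
     (\<exists>N. e_step_subgroup n k F N \<and> bij_betw l B (e_outputs n k F N)) \<or>
     (\<exists>b. B = {b} \<and> eu_step n k F (l b)) \<or>
     (\<exists>b. B = {b} \<and> (\<exists>\<gamma>\<in>\<Gamma>. l b = conj_af n \<gamma> F))"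


subsection \<open>Trees\<close>

record ('v, 'l) ltree =
  tverts :: "'v set"
  tedges :: "('v \<times> 'v) set"
  troot :: 'v
  tlabel :: "'v \<Rightarrow> 'l"

abbreviation children :: "('v, 'l) ltree \<Rightarrow> 'v \<Rightarrow> 'v set" where
  "children T v \<equiv> tedges T `` {v}"

definition leaves :: "('v, 'l) ltree \<Rightarrow> 'v set" where
  "leaves T = {v \<in> tverts T. children T v = {}}"

text \<open>
  The last condition is the finiteness of the tree. It bounds the length of the paths; the number
  of children is not bounded, because a vertex at which an e-step starts has one child for every
  extension of its label, and these are infinitely many unless there are none.
\<close>

definition finite_rooted_tree :: "('v, 'l) ltree \<Rightarrow> bool" where
  "finite_rooted_tree T \<longleftrightarrow>
     troot T \<in> tverts T \<and>
     tedges T \<subseteq> tverts T \<times> tverts T \<and>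
     (\<forall>u. (u, troot T) \<notin> tedges T) \<and>
     (\<forall>v \<in> tverts T - {troot T}. \<exists>!u. (u, v) \<in> tedges T) \<and>
     (\<forall>v \<in> tverts T. (troot T, v) \<in> (tedges T)\<^sup>*) \<and>
     (\<exists>d::nat. \<forall>v \<in> tverts T. \<exists>m\<le>d. (troot T, v) \<in> tedges T ^^ m)"

text \<open>
  A tree over \<open>k\<close> all of whose co-steps are given by elements of \<open>\<Gamma>\<close>; it is a tree over \<open>k\<close> in
  general if \<open>\<Gamma>\<close> is \<open>GL\<^sub>n(k)\<close>.
\<close>

definition tree_over ::
    "nat \<Rightarrow> 'a set \<Rightarrow> 'a mat set \<Rightarrow> ('v, 'a::field af) ltree \<Rightarrow> bool" where
  "tree_over n k \<Gamma> T \<longleftrightarrow>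
     finite_rooted_tree T \<and>
     tlabel T ` tverts T \<subseteq> AFs_over n k \<and>
     (\<forall>v \<in> tverts T - leaves T. forms_step n k \<Gamma> (tlabel T v) (children T v) (tlabel T))"

text \<open>\<open>T\<close> is an \<open>(F \<rightarrow> S, H, k)\<close>-tree.\<close>

definition is_tree_to ::
    "nat \<Rightarrow> 'a::field af \<Rightarrow> 'a af set \<Rightarrow> 'a mat set \<Rightarrow> 'a set \<Rightarrow> ('v, 'a af) ltree \<Rightarrow> bool" where
  "is_tree_to n F S H k T \<longleftrightarrow>
     tree_over n k (rat_points n k H) T \<and>
     tlabel T (troot T) = F \<and>
     tlabel T ` leaves T \<subseteq> S \<and>
     (\<forall>v \<in> tverts T. dom_af (tlabel T v) \<subseteq> H)"


subsection \<open>The groups \<open>U\<^sub>n\<close> and \<open>Mir\<^sub>n\<close>\<close>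

definition unitriangular :: "nat \<Rightarrow> 'a::field mat set" where
  "unitriangular n = {u \<in> carrier_mat n n. upper_triangular u \<and> (\<forall>i<n. u $$ (i, i) = 1)}"

definition SL :: "nat \<Rightarrow> 'a::field mat set" where
  "SL m = {g \<in> carrier_mat m m. det g = 1}"

definition j_embed :: "nat \<Rightarrow> 'a::field mat \<Rightarrow> 'a mat" where
  "j_embed m g = four_block_mat (1\<^sub>m 1) (0\<^sub>m 1 m) (0\<^sub>m m 1) g"

definition U_P :: "nat \<Rightarrow> 'a::field mat set" where
  "U_P n = {u \<in> carrier_mat n n.
     \<forall>i<n. \<forall>j<n. \<not> (i = 0 \<and> j \<noteq> 0) \<longrightarrow> u $$ (i, j) = 1\<^sub>m n $$ (i, j)}"

definition Mir :: "nat \<Rightarrow> 'a::field mat set" where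
  "Mir n = j_embed (n - 1) ` SL (n - 1) <#>\<^bsub>GL n\<^esub> U_P n"

end

theory Submission
  imports Defs
begin

text \<open>
  Induction on \<open>n\<close>. Let \<open>V\<close> be the group \<open>U\<^sub>P\<close> of first rows, and let \<open>V\<^sub>i\<close> be the subgroup of rows
  that vanish before the column \<open>i\<close>; it is normalized by \<open>U\<^sub>n\<close>, and \<open>[U\<^sub>n, V\<^sub>i] \<subseteq> V\<^sub>i\<^sub>+\<^sub>1\<close>. If the domain \<open>D\<close> of \<open>F\<close>
  contains \<open>V\<^sub>i\<^sub>+\<^sub>1\<close> but not \<open>w = 1 + E\<^sub>1\<^sub>i\<close>, then \<open>\<phi>(d) = F([d, w])\<close> is an additive function on \<open>D\<close>. If
  \<open>\<phi> = 0\<close>, then \<open>F\<close> extends to \<open>D w\<^sup>K\<close> and an e-step applies; otherwise the extensions of \<open>F\<close> from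
  \<open>ker \<phi>\<close> to \<open>(ker \<phi>) w\<^sup>K\<close> are permuted simply transitively by \<open>D(k) / (ker \<phi>)(k) \<cong> k\<close>, and an
  eu-step applies. In this way \<open>V \<subseteq> D\<close> is reached, so \<open>D = j(D\<^sub>1) V\<close>, and \<open>F\<close> on \<open>V\<close> is a vector \<open>x\<close> over \<open>k\<close>
  that is fixed by \<open>D\<^sub>1\<close>. A co-step moves \<open>x\<close> to a multiple of \<open>e\<^sub>1\<close> while keeping \<open>D\<^sub>1\<close> upper unitriangular.
  Then \<open>F\<close> is the sum of the inflation of an additive function on \<open>D\<^sub>1\<close> and a multiple of the matrix entry
  \<open>(1, 2)\<close>, which is a character of \<open>U\<^sub>n\<close> invariant under \<open>j(Mir\<^sub>n\<^sub>-\<^sub>1)\<close>; therefore the tree in dimension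
  \<open>n - 1\<close> lifts to dimension \<open>n\<close>.

  In characteristic 0, a closed subgroup of \<open>U\<^sub>n\<close> contains \<open>u\<^sup>t\<close> with \<open>u\<close>, and it is defined over \<open>k\<close> iff its
  \<open>k\<close>-points are dense. This is how all the groups above are seen to be closed and defined over \<open>k\<close>.
\<close>

text \<open>The first row is filled from the last column backwards because \<open>[d, w]\<close> has
  to lie in \<open>V_(i+1)\<close>, hence in the domain, before \<open>F([d, w])\<close> has a
  meaning. \<open>phi\<close> is additive since \<open>F\<close> is invariant under conjugation by
  \<open>D\<close>; it measures how far \<open>F\<close> is from being invariant under
  \<open>w\<close>, so on its kernel the obstruction to extending is gone. The same invariance shows
  that \<open>D_1\<close> fixes \<open>x\<close>, which is why the co-step can use a flag beginning
  with \<open>x\<close>. Elements of \<open>Mir\<close> fix the first basis vector, and this is what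
  makes the entry \<open>(1, 2)\<close> survive the lifted co-steps: the induction has to be about
  \<open>Mir\<close> rather than all of \<open>GL\<close>. An e-step without outputs would leave a
  leaf with the wrong domain, so every step has to come with an output. The field of definition is
  given through generators of the full vanishing ideal, which is hard to control for kernels and
  products of groups. Density of the \<open>k\<close>-points is passed on by any parametrization or
  retraction over \<open>k\<close>; functionals and normal forms of cosets prove that the two
  notions agree.\<close>

abbreviation is_subfield :: "'a::field set \<Rightarrow> bool" where
  "is_subfield k \<equiv> subfield k ring_of_type_algebra"

section \<open>Subfields as subsets of the field type\<close>

lemma subfield_closed:
  assumes k: "is_subfield k"
  shows subfield_zero: "0 \<in> k" and subfield_one: "1 \<in> k"
    and subfield_add: "\<And>a b. a \<in> k \<Longrightarrow> b \<in> k \<Longrightarrow> a + b \<in> k"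
    and subfield_mult: "\<And>a b. a \<in> k \<Longrightarrow> b \<in> k \<Longrightarrow> a * b \<in> k"
    and subfield_uminus: "\<And>a. a \<in> k \<Longrightarrow> - a \<in> k"
    and subfield_inverse: "\<And>a. a \<in> k \<Longrightarrow> inverse a \<in> k"
proof -
  interpret R: Ring.field "ring_of_type_algebra :: 'a ring" by (rule field_from_type_algebra)
  have sr: "subring k ring_of_type_algebra" using subfieldE(1)[OF k] .
  note E = subringE[OF sr]
  show z: "0 \<in> k" using E(2) by (simp add: ring_of_type_algebra_def)
  show "1 \<in> k" using E(3) by (simp add: ring_of_type_algebra_def)
  show "a + b \<in> k" if "a \<in> k" "b \<in> k" for a b
    using E(7)[OF that] by (simp add: ring_of_type_algebra_def)
  show "a * b \<in> k" if "a \<in> k" "b \<in> k" for a b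
    using E(6)[OF that] by (simp add: ring_of_type_algebra_def)
  show "- a \<in> k" if "a \<in> k" for a
  proof -
    have "\<ominus>\<^bsub>ring_of_type_algebra\<^esub> a = - a"
      by (rule R.minus_equality) (auto simp: ring_of_type_algebra_def)
    with E(5)[OF that] show ?thesis by simp
  qed
  show "inverse a \<in> k" if a: "a \<in> k" for a
  proof (cases "a = 0")
    case True
    then show ?thesis using z by simp
  next
    case False
    have *: "a \<in> k - {\<zero>\<^bsub>ring_of_type_algebra\<^esub>}"
      using a False by (simp add: ring_of_type_algebra_def)
    note i = R.subfield_m_inv[OF k *]
    have "a * inv\<^bsub>ring_of_type_algebra\<^esub> a = 1"
      using i(2) by (simp add: ring_of_type_algebra_def)
    then have "inv\<^bsub>ring_of_type_algebra\<^esub> a = inverse a"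
      by (metis inverse_unique)
    with i(1) show ?thesis by simp
  qed
qed

lemma subfield_UNIV: "is_subfield (UNIV :: 'a::field set)"
proof -
  interpret R: Ring.field "ring_of_type_algebra :: 'a ring" by (rule field_from_type_algebra)
  have "carrier (ring_of_type_algebra :: 'a ring) = UNIV"
    by (simp add: ring_of_type_algebra_def)
  then show ?thesis using R.carrier_is_subfield by simp
qed

context
  fixes k :: "'a::field set"
  assumes k: "is_subfield k"
begin

lemma subfield_diff: "a \<in> k \<Longrightarrow> b \<in> k \<Longrightarrow> a - b \<in> k"
  using subfield_add[OF k, of a "- b"] subfield_uminus[OF k] by simp

lemma subfield_divide: "a \<in> k \<Longrightarrow> b \<in> k \<Longrightarrow> a / b \<in> k"
  using subfield_mult[OF k, of a "inverse b"] subfield_inverse[OF k] by (simp add: field_simps)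

lemma subfield_sum: "(\<And>i. i \<in> A \<Longrightarrow> f i \<in> k) \<Longrightarrow> sum f A \<in> k"
  by (induction A rule: infinite_finite_induct) (auto intro: subfield_zero[OF k] subfield_add[OF k])

lemma subfield_prod: "(\<And>i. i \<in> A \<Longrightarrow> f i \<in> k) \<Longrightarrow> prod f A \<in> k"
  by (induction A rule: infinite_finite_induct) (auto intro: subfield_one[OF k] subfield_mult[OF k])

lemma subfield_of_nat: "of_nat m \<in> k"
  by (induction m) (auto intro: subfield_zero[OF k] subfield_one[OF k] subfield_add[OF k])

lemma subfield_of_int: "of_int m \<in> k"
  by (cases m) (auto simp del: of_nat_Suc intro!: subfield_of_nat subfield_uminus[OF k])

lemma subfield_signof: "signof p \<in> k"
  using subfield_of_int[of 1] subfield_of_int[of "-1"] by (cases "evenperm p") (auto simp: sign_def)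

lemma subfield_det:
  assumes "g \<in> carrier_mat n n" "\<And>i j. i < n \<Longrightarrow> j < n \<Longrightarrow> g $$ (i, j) \<in> k"
  shows "det g \<in> k"
  unfolding det_def'[OF assms(1)]
  by (intro subfield_sum subfield_mult[OF k] subfield_signof subfield_prod assms(2))
     (auto simp: permutes_in_image)

end

lemma infinite_range_of_nat: "infinite (range (of_nat :: nat \<Rightarrow> 'a::field_char_0))"
  using finite_imageD[of "of_nat :: nat \<Rightarrow> 'a" UNIV] inj_on_def[of "of_nat :: nat \<Rightarrow> 'a" UNIV]
    infinite_UNIV_nat by auto

lemma subfield_infinite:
  assumes k: "is_subfield (k :: 'a::field_char_0 set)"
  shows "infinite k"
proof -
  have "range (of_nat :: nat \<Rightarrow> 'a) \<subseteq> k" using subfield_of_nat[OF k] by auto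
  then show ?thesis using infinite_range_of_nat finite_subset by blast
qed

subsection \<open>Unitriangular matrices\<close>

lemma GL_mult [simp]: "x \<otimes>\<^bsub>GL n\<^esub> y = x * y"
  by (simp add: GL_def units_of_def ring_mat_def)

lemma GL_one [simp]: "\<one>\<^bsub>GL n\<^esub> = 1\<^sub>m n"
  by (simp add: GL_def units_of_def ring_mat_def)

lemma carrier_GL: "g \<in> carrier (GL n) \<longleftrightarrow> g \<in> carrier_mat n n \<and> det (g :: 'a::field mat) \<noteq> 0"
  unfolding GL_def units_of_carrier
  using unit_imp_det_non_zero[of g n "()"] det_non_zero_imp_unit[of g n]
  by (auto simp: Units_def ring_mat_simps)

lemma group_GL: "group (GL n :: 'a::field mat monoid)"
proof -
  interpret R: ring "ring_mat TYPE('a) n ()" by (rule ring_mat)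
  show ?thesis unfolding GL_def by (rule R.units_group)
qed

abbreviation ginv :: "nat \<Rightarrow> 'a::field mat \<Rightarrow> 'a mat" where
  "ginv n g \<equiv> inv\<^bsub>GL n\<^esub> g"

lemma GL_carrier_mat: "g \<in> carrier (GL n) \<Longrightarrow> g \<in> carrier_mat n n"
  by (simp add: carrier_GL)

lemma GL_inv_closed: "g \<in> carrier (GL n) \<Longrightarrow> ginv n g \<in> carrier (GL n)"
  using group.inv_closed[OF group_GL] .

lemma GL_mult_closed: "g \<in> carrier (GL n) \<Longrightarrow> h \<in> carrier (GL n) \<Longrightarrow> g * h \<in> carrier (GL n)"
  using monoid.m_closed[OF group.is_monoid[OF group_GL], of g n h] by simp

lemma GL_l_inv: "g \<in> carrier (GL n) \<Longrightarrow> ginv n g * g = 1\<^sub>m n"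
  using group.l_inv[OF group_GL, of g n] by simp

lemma GL_r_inv: "g \<in> carrier (GL n) \<Longrightarrow> g * ginv n g = 1\<^sub>m n"
  using group.r_inv[OF group_GL, of g n] by simp

lemma GL_inv_eqI:
  assumes "g * h = 1\<^sub>m n" "g \<in> carrier_mat n n" "h \<in> carrier_mat n n"
  shows "g \<in> carrier (GL n)" "h \<in> carrier (GL n)" "ginv n g = h"
proof -
  have "det g * det h = 1" using det_mult[OF assms(2,3)] assms(1) by simp
  then show g: "g \<in> carrier (GL n)" and h: "h \<in> carrier (GL n)"
    using assms by (auto simp: carrier_GL)
  show "ginv n g = h"
    using group.inv_equality[OF group_GL _ g h] mat_mult_left_right_inverse[OF assms(2,3,1)]
    by simp
qed

lemma entry_mult:
  assumes "g \<in> carrier_mat n n" "h \<in> carrier_mat n n" "i < n" "j < n"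
  shows "(g * h) $$ (i, j) = (\<Sum>l<n. g $$ (i, l) * h $$ (l, j))"
  using assms by (auto simp: times_mat_def scalar_prod_def lessThan_atLeast0 intro!: sum.cong)

lemma unitriangular_iff:
  "u \<in> unitriangular n \<longleftrightarrow> u \<in> carrier_mat n n \<and>
     (\<forall>i<n. u $$ (i, i) = 1) \<and> (\<forall>i<n. \<forall>j<i. u $$ (i, j) = 0)"
  by (auto simp: unitriangular_def upper_triangular_def)

lemma unitriangularI:
  assumes "u \<in> carrier_mat n n" "\<And>i. i < n \<Longrightarrow> u $$ (i, i) = 1"
    "\<And>i j. j < i \<Longrightarrow> i < n \<Longrightarrow> u $$ (i, j) = 0"
  shows "u \<in> unitriangular n"
  using assms by (auto simp: unitriangular_iff)

lemma unitriangularD: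
  assumes "u \<in> unitriangular n"
  shows "u \<in> carrier_mat n n" "i < n \<Longrightarrow> u $$ (i, i) = 1"
    "j < i \<Longrightarrow> i < n \<Longrightarrow> u $$ (i, j) = 0" "dim_row u = n" "dim_col u = n"
  using assms by (auto simp: unitriangular_iff)

lemma unitriangular_det: "u \<in> unitriangular n \<Longrightarrow> det u = 1"
proof -
  assume u: "u \<in> unitriangular n"
  have "det u = prod_list (diag_mat u)"
    using u by (intro det_upper_triangular[of _ n]) (auto simp: unitriangular_def)
  also have "diag_mat u = map (\<lambda>i. 1) [0..<n]"
    using unitriangularD[OF u] by (auto simp: diag_mat_def)
  finally show ?thesis by (simp add: map_replicate_const)
qed

lemma unitriangular_GL: "u \<in> unitriangular n \<Longrightarrow> u \<in> carrier (GL n)"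
  by (simp add: carrier_GL unitriangular_det unitriangularD)

lemma unitriangular_one: "1\<^sub>m n \<in> unitriangular n"
  by (rule unitriangularI) auto

lemma unitriangular_mult:
  assumes u: "u \<in> unitriangular n" and v: "v \<in> unitriangular n"
  shows "u * v \<in> unitriangular n"
proof (rule unitriangularI)
  note U = unitriangularD[OF u] and V = unitriangularD[OF v]
  show "u * v \<in> carrier_mat n n" using U V by auto
  show "(u * v) $$ (i, i) = 1" if i: "i < n" for i
  proof -
    have "(u * v) $$ (i, i) = (\<Sum>l<n. if l = i then 1 else 0)"
      unfolding entry_mult[OF U(1) V(1) i i]
    proof (rule sum.cong)
      fix l assume "l \<in> {..<n}"
      then show "u $$ (i, l) * v $$ (l, i) = (if l = i then 1 else 0)"
        using U(2,3) V(2,3) i by (cases l i rule: linorder_cases) auto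
    qed auto
    then show ?thesis using i by simp
  qed
  show "(u * v) $$ (i, j) = 0" if ij: "j < i" "i < n" for i j
  proof -
    have j: "j < n" using ij by simp
    show ?thesis unfolding entry_mult[OF U(1) V(1) ij(2) j]
    proof (intro sum.neutral ballI)
      fix l assume "l \<in> {..<n}"
      then show "u $$ (i, l) * v $$ (l, j) = 0"
        using U(3)[of l i] V(3)[of j l] ij by (cases "l < i") auto
    qed
  qed
qed

lemma unitriangular_inv:
  assumes u: "u \<in> unitriangular n"
  shows "ginv n u \<in> unitriangular n"
proof -
  note U = unitriangularD[OF u]
  define v where "v = ginv n u"
  have uG: "u \<in> carrier (GL n)" by (rule unitriangular_GL[OF u])
  have v: "v \<in> carrier_mat n n" unfolding v_def by (rule GL_carrier_mat[OF GL_inv_closed[OF uG]])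
  have uv: "u * v = 1\<^sub>m n" unfolding v_def by (rule GL_r_inv[OF uG])
  \<comment> \<open>Induction from the bottom row upwards: in row \<open>i\<close> of
    \<open>u * v = 1\<close> only the rows of \<open>v\<close> from \<open>i\<close> on occur, and
    those below are already known.\<close>
  have main: "v $$ (i, j) = (if i = j then 1 else 0)" if "i < n" "j \<le> i" for i j
    using that
  proof (induction "n - i" arbitrary: i rule: less_induct)
    case less
    have j: "j < n" using less.prems by simp
    have "(u * v) $$ (i, j) = (\<Sum>l<n. if l = i then v $$ (i, j) else 0)"
      unfolding entry_mult[OF U(1) v less.prems(1) j]
    proof (rule sum.cong)
      fix l assume "l \<in> {..<n}"
      then have l: "l < n" by simp
      have "v $$ (l, j) = 0" if "i < l"
        using less.hyps[of l] that l less.prems by simp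
      then show "u $$ (i, l) * v $$ (l, j) = (if l = i then v $$ (i, j) else 0)"
        using U(2)[OF l] U(3)[of l i] less.prems(1) by (cases l i rule: linorder_cases) auto
    qed auto
    then have "(u * v) $$ (i, j) = v $$ (i, j)" using less.prems by simp
    then show ?case using uv less.prems(1) j by simp
  qed
  have "v \<in> unitriangular n"
    by (rule unitriangularI[OF v]) (use main in auto)
  then show ?thesis by (simp add: v_def)
qed

lemma subgroupD_GL:
  assumes "subgroup D (GL n)"
  shows "1\<^sub>m n \<in> D" "g \<in> D \<Longrightarrow> h \<in> D \<Longrightarrow> g * h \<in> D" "g \<in> D \<Longrightarrow> ginv n g \<in> D"
    "g \<in> D \<Longrightarrow> g \<in> carrier (GL n)"
  using subgroup.one_closed[OF assms] subgroup.m_closed[OF assms, of g h]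
    subgroup.m_inv_closed[OF assms, of g] subgroup.mem_carrier[OF assms, of g] by auto

lemma subgroupI_GL:
  assumes "D \<subseteq> carrier (GL n)" "1\<^sub>m n \<in> D" "\<And>g h. g \<in> D \<Longrightarrow> h \<in> D \<Longrightarrow> g * h \<in> D"
    "\<And>g. g \<in> D \<Longrightarrow> ginv n g \<in> D"
  shows "subgroup D (GL n)"
  by (rule group.subgroupI[OF group_GL]) (use assms in auto)

lemma unitriangular_pow_mat:
  assumes "u \<in> unitriangular n"
  shows "u ^\<^sub>m a \<in> unitriangular n"
proof (induction a)
  case 0
  have "dim_row u = n" by (rule unitriangularD(4)[OF assms])
  then show ?case using unitriangular_one by simp
next
  case (Suc a)
  then show ?case using unitriangular_mult[OF _ assms] by simp
qed

text \<open>Each further factor moves the support up by one more diagonal.\<close>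

lemma strict_upper_pow_mat:
  assumes u: "u \<in> unitriangular n"
  shows "i < n \<Longrightarrow> j < n \<Longrightarrow> j < i + a \<Longrightarrow> ((u - 1\<^sub>m n) ^\<^sub>m a) $$ (i, j) = 0"
proof (induction a arbitrary: j)
  case 0
  then show ?case using unitriangularD[OF u] by auto
next
  case (Suc a)
  note U = unitriangularD[OF u]
  have c: "u - 1\<^sub>m n \<in> carrier_mat n n" using U by auto
  have "((u - 1\<^sub>m n) ^\<^sub>m Suc a) $$ (i, j) =
     (\<Sum>l<n. ((u - 1\<^sub>m n) ^\<^sub>m a) $$ (i, l) * (u - 1\<^sub>m n) $$ (l, j))"
    using entry_mult[OF pow_carrier_mat[OF c] c Suc.prems(1,2)] by simp
  also have "\<dots> = 0"
  proof (intro sum.neutral ballI)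
    fix l assume "l \<in> {..<n}"
    then have l: "l < n" by simp
    show "((u - 1\<^sub>m n) ^\<^sub>m a) $$ (i, l) * (u - 1\<^sub>m n) $$ (l, j) = 0"
    proof (cases "l < i + a")
      case True
      then show ?thesis using Suc.IH[OF Suc.prems(1) l] by simp
    next
      case False
      then have "j \<le> l" using Suc.prems by simp
      then have "(u - 1\<^sub>m n) $$ (l, j) = 0" using U l Suc.prems by (cases "j = l") auto
      then show ?thesis by simp
    qed
  qed
  finally show ?case .
qed

lemma strict_upper_nilpotent:
  assumes u: "u \<in> unitriangular n" and "a \<ge> n"
  shows "(u - 1\<^sub>m n) ^\<^sub>m a = 0\<^sub>m n n"
proof -
  have "u - 1\<^sub>m n \<in> carrier_mat n n" using unitriangularD[OF u] by auto
  from pow_carrier_mat[OF this, of a] show ?thesis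
    using strict_upper_pow_mat[OF u] assms(2) by (intro eq_matI) auto
qed

lemma unitriangular_unipotent: "u \<in> unitriangular n \<Longrightarrow> unipotent_mat n u"
  using strict_upper_nilpotent[of u n n] unitriangularD(1)[of u n]
  unfolding unipotent_mat_def by blast

subsection \<open>Regular functions and regular maps on \<open>U\<^sub>n\<close>\<close>

lemma regular_fun_mono: "f \<in> regular_fun n k \<Longrightarrow> k \<subseteq> k' \<Longrightarrow> f \<in> regular_fun n k'"
  by (induction rule: regular_fun.induct) (auto intro: regular_fun.intros)

lemma regular_fun_UNIV: "f \<in> regular_fun n k \<Longrightarrow> f \<in> regular_fun n UNIV"
  by (erule regular_fun_mono) simp

lemma regular_fun_rational:
  assumes k: "is_subfield k"
    and "f \<in> regular_fun n k" "g \<in> carrier_mat n n" "\<And>i j. i < n \<Longrightarrow> j < n \<Longrightarrow> g $$ (i, j) \<in> k"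
  shows "f g \<in> k"
  using assms(2) by (induction rule: regular_fun.induct)
    (auto intro: assms subfield_add[OF k] subfield_mult[OF k] subfield_inverse[OF k] subfield_det[OF k])

text \<open>Values off \<open>U_n\<close> are left free, so that an identity valid only on
  \<open>U_n\<close>, such as \<open>det = 1\<close> or a polynomial formula for the inverse, is
  enough for membership.\<close>

definition ureg :: "nat \<Rightarrow> 'a set \<Rightarrow> ('a::field mat \<Rightarrow> 'a) set" where
  "ureg n k = {f. \<exists>h\<in>regular_fun n k. \<forall>u\<in>unitriangular n. f u = h u}"

lemma uregI: "h \<in> regular_fun n k \<Longrightarrow> (\<And>u. u \<in> unitriangular n \<Longrightarrow> f u = h u) \<Longrightarrow> f \<in> ureg n k"
  by (auto simp: ureg_def)

lemma uregE:
  assumes "f \<in> ureg n k"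
  obtains h where "h \<in> regular_fun n k" "\<And>u. u \<in> unitriangular n \<Longrightarrow> f u = h u"
  using assms by (auto simp: ureg_def)

lemma ureg_UNIV: "f \<in> ureg n k \<Longrightarrow> f \<in> ureg n UNIV"
  by (elim uregE) (auto intro: uregI regular_fun_UNIV)

lemma regular_fun_ureg: "f \<in> regular_fun n k \<Longrightarrow> f \<in> ureg n k"
  by (rule uregI) auto

lemma ureg_cong: "f \<in> ureg n k \<Longrightarrow> (\<And>u. u \<in> unitriangular n \<Longrightarrow> f' u = f u) \<Longrightarrow> f' \<in> ureg n k"
  by (auto simp: ureg_def)

lemma ureg_const: "c \<in> k \<Longrightarrow> (\<lambda>g. c) \<in> ureg n k"
  by (intro regular_fun_ureg regular_fun.intros)

lemma ureg_coord: "i < n \<Longrightarrow> j < n \<Longrightarrow> (\<lambda>g. g $$ (i, j)) \<in> ureg n k"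
  by (intro regular_fun_ureg regular_fun.intros)

lemma ureg_add: "f \<in> ureg n k \<Longrightarrow> h \<in> ureg n k \<Longrightarrow> (\<lambda>g. f g + h g) \<in> ureg n k"
  by (elim uregE, rule uregI, erule (1) regular_fun.add) simp

lemma ureg_mult: "f \<in> ureg n k \<Longrightarrow> h \<in> ureg n k \<Longrightarrow> (\<lambda>g. f g * h g) \<in> ureg n k"
  by (elim uregE, rule uregI, erule (1) regular_fun.mult) simp

lemma ureg_rational:
  assumes "is_subfield k" "f \<in> ureg n k" "u \<in> unitriangular n"
    "\<And>i j. i < n \<Longrightarrow> j < n \<Longrightarrow> u $$ (i, j) \<in> k"
  shows "f u \<in> k"
  using assms(2) by (rule uregE) (use assms regular_fun_rational unitriangularD(1) in metis)

context
  fixes k :: "'a::field set"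
  assumes k: "is_subfield k"
begin

lemma ureg_sum: "(\<And>i. i \<in> A \<Longrightarrow> f i \<in> ureg n k) \<Longrightarrow> (\<lambda>g. \<Sum>i\<in>A. f i g) \<in> ureg n k"
  by (induction A rule: infinite_finite_induct)
     (auto intro: ureg_add ureg_const subfield_zero[OF k])

lemma ureg_prod: "(\<And>i. i \<in> A \<Longrightarrow> f i \<in> ureg n k) \<Longrightarrow> (\<lambda>g. \<Prod>i\<in>A. f i g) \<in> ureg n k"
  by (induction A rule: infinite_finite_induct)
     (auto intro: ureg_mult ureg_const subfield_one[OF k])

lemma ureg_uminus: "f \<in> ureg n k \<Longrightarrow> (\<lambda>g. - f g) \<in> ureg n k"
  using ureg_mult[OF ureg_const[of "-1" k n], of f] subfield_uminus[OF k] subfield_one[OF k] by simp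

lemma ureg_diff: "f \<in> ureg n k \<Longrightarrow> h \<in> ureg n k \<Longrightarrow> (\<lambda>g. f g - h g) \<in> ureg n k"
  using ureg_add[OF _ ureg_uminus, of f n h] by simp

lemma ureg_cmult: "c \<in> k \<Longrightarrow> f \<in> ureg n k \<Longrightarrow> (\<lambda>g. c * f g) \<in> ureg n k"
  by (rule ureg_mult[OF ureg_const])

end

definition regular_map :: "nat \<Rightarrow> 'a set \<Rightarrow> nat \<Rightarrow> ('a::field mat \<Rightarrow> 'a mat) \<Rightarrow> bool" where
  "regular_map n k m \<phi> \<longleftrightarrow> (\<forall>u\<in>unitriangular n. \<phi> u \<in> unitriangular m) \<and>
     (\<forall>i<m. \<forall>j<m. (\<lambda>u. \<phi> u $$ (i, j)) \<in> ureg n k)"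

lemma regular_mapD:
  assumes "regular_map n k m \<phi>"
  shows "u \<in> unitriangular n \<Longrightarrow> \<phi> u \<in> unitriangular m"
    "i < m \<Longrightarrow> j < m \<Longrightarrow> (\<lambda>u. \<phi> u $$ (i, j)) \<in> ureg n k"
  using assms by (auto simp: regular_map_def)

lemma regular_map_UNIV: "regular_map n k m \<phi> \<Longrightarrow> regular_map n UNIV m \<phi>"
  unfolding regular_map_def using ureg_UNIV by blast

lemma ureg_comp:
  assumes f: "f \<in> ureg m k" and \<phi>: "regular_map n k m \<phi>" and one: "1 \<in> k"
  shows "(\<lambda>u. f (\<phi> u)) \<in> ureg n k"
proof -
  obtain h where h: "h \<in> regular_fun m k" "\<And>u. u \<in> unitriangular m \<Longrightarrow> f u = h u"
    using f by (rule uregE) blast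
  from h(1) have "(\<lambda>u. h (\<phi> u)) \<in> ureg n k"
  proof (induction rule: regular_fun.induct)
    \<comment> \<open>The determinant is 1 on \<open>U_m\<close>, so this generator pulls back to a
      constant; hence the assumption \<open>1 \<in> k\<close>.\<close>
    case inv_det
    show ?case
      by (rule ureg_cong[OF ureg_const[OF one]])
         (use unitriangular_det[OF regular_mapD(1)[OF \<phi>]] in simp)
  qed (auto intro: ureg_const ureg_add ureg_mult regular_mapD[OF \<phi>])
  then show ?thesis by (rule ureg_cong) (simp add: h(2) regular_mapD(1)[OF \<phi>])
qed

lemma regular_map_id: "regular_map n k n (\<lambda>u. u)"
  by (auto simp: regular_map_def intro: ureg_coord)

lemma regular_map_const:
  assumes "v \<in> unitriangular m" "\<And>i j. i < m \<Longrightarrow> j < m \<Longrightarrow> v $$ (i, j) \<in> k"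
  shows "regular_map n k m (\<lambda>u. v)"
  using assms by (auto simp: regular_map_def intro: ureg_const)

lemma regular_map_mult:
  assumes k: "is_subfield k" and \<phi>: "regular_map n k m \<phi>" and \<psi>: "regular_map n k m \<psi>"
  shows "regular_map n k m (\<lambda>u. \<phi> u * \<psi> u)"
  unfolding regular_map_def
proof (intro conjI ballI allI impI)
  show "\<phi> u * \<psi> u \<in> unitriangular m" if "u \<in> unitriangular n" for u
    using that by (intro unitriangular_mult regular_mapD(1)[OF \<phi>] regular_mapD(1)[OF \<psi>])
  fix i j assume ij: "i < m" "j < m"
  show "(\<lambda>u. (\<phi> u * \<psi> u) $$ (i, j)) \<in> ureg n k"
  proof (rule ureg_cong)
    show "(\<lambda>u. \<Sum>l<m. \<phi> u $$ (i, l) * \<psi> u $$ (l, j)) \<in> ureg n k"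
      using ij by (intro ureg_sum[OF k] ureg_mult regular_mapD(2)[OF \<phi>] regular_mapD(2)[OF \<psi>]) auto
    show "(\<phi> u * \<psi> u) $$ (i, j) = (\<Sum>l<m. \<phi> u $$ (i, l) * \<psi> u $$ (l, j))"
      if "u \<in> unitriangular n" for u
      using that ij by (intro entry_mult unitriangularD(1) regular_mapD(1)[OF \<phi>] regular_mapD(1)[OF \<psi>])
  qed
qed

lemma regular_map_rational:
  assumes "is_subfield k" "regular_map n k m \<phi>" "u \<in> rat_points n k (unitriangular n)"
  shows "\<phi> u \<in> rat_points m k (unitriangular m)"
  using assms(3) unitriangular_GL
  by (auto simp: rat_points_def intro: regular_mapD(1)[OF assms(2)]
      ureg_rational[OF assms(1) regular_mapD(2)[OF assms(2)]])

lemma rat_points_unitriangular: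
  "D \<subseteq> unitriangular n \<Longrightarrow> u \<in> rat_points n k D \<longleftrightarrow> u \<in> D \<and> u \<in> rat_points n k (unitriangular n)"
  by (auto simp: rat_points_def)

lemma ureg_rational_point:
  assumes "is_subfield k" "f \<in> ureg n k" "u \<in> rat_points n k (unitriangular n)"
  shows "f u \<in> k"
  by (rule ureg_rational[OF assms(1,2)]) (use assms(3) in \<open>auto simp: rat_points_def\<close>)

subsection \<open>Polynomial curves and one-parameter subgroups\<close>

definition polyfun :: "('a::field \<Rightarrow> 'a) \<Rightarrow> bool" where
  "polyfun f \<longleftrightarrow> (\<exists>p. \<forall>t. f t = poly p t)"

lemma polyfun_const: "polyfun (\<lambda>t. c)"
  unfolding polyfun_def by (rule exI[of _ "[:c:]"]) simp

lemma polyfun_id: "polyfun (\<lambda>t. t)"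
  unfolding polyfun_def by (rule exI[of _ "[:0, 1:]"]) simp

lemma polyfun_add: "polyfun f \<Longrightarrow> polyfun g \<Longrightarrow> polyfun (\<lambda>t. f t + g t)"
  unfolding polyfun_def by (metis poly_add)

lemma polyfun_mult: "polyfun f \<Longrightarrow> polyfun g \<Longrightarrow> polyfun (\<lambda>t. f t * g t)"
  unfolding polyfun_def by (metis poly_mult)

lemma polyfun_diff: "polyfun f \<Longrightarrow> polyfun g \<Longrightarrow> polyfun (\<lambda>t. f t - g t)"
  unfolding polyfun_def by (metis poly_diff)

lemma polyfun_sum: "(\<And>i. i \<in> A \<Longrightarrow> polyfun (f i)) \<Longrightarrow> polyfun (\<lambda>t. \<Sum>i\<in>A. f i t)"
  by (induction A rule: infinite_finite_induct) (auto intro: polyfun_const polyfun_add)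

lemma polyfun_prod: "(\<And>i. i \<in> A \<Longrightarrow> polyfun (f i)) \<Longrightarrow> polyfun (\<lambda>t. \<Prod>i\<in>A. f i t)"
  by (induction A rule: infinite_finite_induct) (auto intro: polyfun_const polyfun_mult)

lemma polyfun_comp: "polyfun f \<Longrightarrow> polyfun g \<Longrightarrow> polyfun (\<lambda>t. f (g t))"
  unfolding polyfun_def by (metis poly_pcompose)

lemma polyfun_gbinomial: "polyfun (\<lambda>t :: 'a::field_char_0. t gchoose a)"
proof -
  have "polyfun (\<lambda>t. (\<Prod>i<a. t - of_nat i) * (1 / fact a) :: 'a)"
    by (intro polyfun_mult polyfun_prod polyfun_diff polyfun_id polyfun_const)
  then show ?thesis by (simp add: gbinomial_prod_rev atLeast0LessThan)
qed

lemma polyfun_eq_zero: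
  assumes "polyfun f" "infinite A" "\<And>t. t \<in> A \<Longrightarrow> f t = 0"
  shows "f t = 0"
proof -
  obtain p where p: "\<And>t. f t = poly p t" using assms(1) by (auto simp: polyfun_def)
  have "A \<subseteq> {t. poly p t = 0}" using assms(3) p by auto
  then have "p = 0" using assms(2) poly_roots_finite[of p] finite_subset by blast
  then show ?thesis using p by simp
qed

text \<open>In characteristic 0 the natural numbers are infinitely many points. Identities between
  powers \<open>u^t\<close> are proved this way throughout: induction for natural exponents, then
  all \<open>t\<close> at once.\<close>

lemma polyfun_eq_nat:
  fixes f :: "'a::field_char_0 \<Rightarrow> 'a"
  assumes "polyfun f" "polyfun g" "\<And>a. f (of_nat a) = g (of_nat a)"
  shows "f t = g t"
  using polyfun_eq_zero[OF polyfun_diff[OF assms(1,2)] infinite_range_of_nat, of t] assms(3) by auto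

definition curve :: "nat \<Rightarrow> ('a::field \<Rightarrow> 'a mat) \<Rightarrow> bool" where
  "curve n c \<longleftrightarrow> (\<forall>t. c t \<in> unitriangular n) \<and> (\<forall>i<n. \<forall>j<n. polyfun (\<lambda>t. c t $$ (i, j)))"

lemma curveD:
  assumes "curve n c"
  shows "c t \<in> unitriangular n" "i < n \<Longrightarrow> j < n \<Longrightarrow> polyfun (\<lambda>t. c t $$ (i, j))"
  using assms by (auto simp: curve_def)

lemma curve_ureg:
  assumes c: "curve n c" and f: "f \<in> ureg n k"
  shows "polyfun (\<lambda>t. f (c t))"
proof -
  obtain h where h: "h \<in> regular_fun n k" "\<And>u. u \<in> unitriangular n \<Longrightarrow> f u = h u"
    using f by (rule uregE) blast
  from h(1) have "polyfun (\<lambda>t. h (c t))"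
  proof (induction rule: regular_fun.induct)
    case inv_det
    show ?case by (simp add: unitriangular_det[OF curveD(1)[OF c]] polyfun_const)
  qed (auto intro: polyfun_const polyfun_add polyfun_mult curveD(2)[OF c])
  then show ?thesis by (simp add: h(2) curveD(1)[OF c])
qed

lemma curve_regular_map: "regular_map n k m \<phi> \<Longrightarrow> curve n c \<Longrightarrow> curve m (\<lambda>t. \<phi> (c t))"
  unfolding curve_def[of m] using curveD(1) regular_mapD(1) curve_ureg regular_mapD(2) by blast

lemma curve_const: "u \<in> unitriangular n \<Longrightarrow> curve n (\<lambda>t. u)"
  by (auto simp: curve_def polyfun_const)

lemma curve_mult:
  assumes c: "curve n c" and d: "curve n d"
  shows "curve n (\<lambda>t. c t * d t)"
  unfolding curve_def
proof (intro conjI allI impI)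
  show "c t * d t \<in> unitriangular n" for t
    by (intro unitriangular_mult curveD(1)[OF c] curveD(1)[OF d])
  fix i j assume ij: "i < n" "j < n"
  have "polyfun (\<lambda>t. \<Sum>l<n. c t $$ (i, l) * d t $$ (l, j))"
    using ij by (intro polyfun_sum polyfun_mult curveD(2)[OF c] curveD(2)[OF d]) auto
  then show "polyfun (\<lambda>t. (c t * d t) $$ (i, j))"
    using entry_mult[OF unitriangularD(1)[OF curveD(1)[OF c]] unitriangularD(1)[OF curveD(1)[OF d]] ij]
    by simp
qed

lemma curve_comp: "curve n c \<Longrightarrow> polyfun f \<Longrightarrow> curve n (\<lambda>t. c (f t))"
  unfolding curve_def using polyfun_comp[of "\<lambda>t. c t $$ _" f] by auto

lemma curve_eq_nat:
  fixes c :: "'a::field_char_0 \<Rightarrow> 'a mat"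
  assumes c: "curve n c" and d: "curve n d" and eq: "\<And>a. c (of_nat a) = d (of_nat a)"
  shows "c t = d t"
proof (rule eq_matI)
  fix i j assume "i < dim_row (d t)" "j < dim_col (d t)"
  then have ij: "i < n" "j < n" using unitriangularD[OF curveD(1)[OF d]] by auto
  show "c t $$ (i, j) = d t $$ (i, j)"
    by (rule polyfun_eq_nat[OF curveD(2)[OF c ij] curveD(2)[OF d ij]]) (simp add: eq)
qed (simp_all add: unitriangularD[OF curveD(1)[OF c]] unitriangularD[OF curveD(1)[OF d]])

text \<open>Each equation of \<open>D\<close> becomes a polynomial in \<open>t\<close> that vanishes
  at all natural numbers.\<close>

lemma curve_in_closed:
  fixes c :: "'a::field_char_0 \<Rightarrow> 'a mat"
  assumes c: "curve n c" and D: "zariski_closed n D" and nat: "\<And>a. c (of_nat a) \<in> D"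
  shows "c t \<in> D"
proof -
  obtain S where S: "S \<subseteq> regular_fun n UNIV" "D = {g \<in> carrier (GL n). \<forall>f\<in>S. f g = 0}"
    using D by (auto simp: zariski_closed_def)
  have "f (c t) = 0" if "f \<in> S" for f
  proof (rule polyfun_eq_nat[OF curve_ureg[OF c] polyfun_const])
    show "f \<in> ureg n UNIV" using that S by (intro regular_fun_ureg) auto
  qed (use that S nat in auto)
  then show ?thesis using S unitriangular_GL[OF curveD(1)[OF c]] by auto
qed

text \<open>The one-parameter subgroup \<open>t \<mapsto> u\<^sup>t\<close>, by the binomial series.\<close>

definition upow :: "nat \<Rightarrow> 'a::field_char_0 mat \<Rightarrow> 'a \<Rightarrow> 'a mat" where
  "upow n u t = mat n n (\<lambda>(i, j). \<Sum>a<n. (t gchoose a) * ((u - 1\<^sub>m n) ^\<^sub>m a) $$ (i, j))"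

text \<open>The binomial theorem for \<open>u = 1 + N\<close>, where the sum may stop before
  \<open>n\<close> because \<open>N\<close> is nilpotent.\<close>

lemma upow_of_nat:
  assumes u: "u \<in> unitriangular n"
  shows "upow n u (of_nat a) = u ^\<^sub>m a"
proof -
  define N where "N = u - 1\<^sub>m n"
  have uc: "u \<in> carrier_mat n n" by (rule unitriangularD(1)[OF u])
  have N: "N \<in> carrier_mat n n" unfolding N_def by (rule minus_carrier_mat[OF one_carrier_mat])
  have main: "(u ^\<^sub>m a) $$ (i, j) = (\<Sum>m<n. of_nat (a choose m) * (N ^\<^sub>m m) $$ (i, j))"
    if "i < n" "j < n" for i j
    using that(2)
  proof (induction a arbitrary: j)
    case 0
    have "(\<Sum>m<n. of_nat (0 choose m) * (N ^\<^sub>m m) $$ (i, j)) =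
        (\<Sum>m<n. if m = 0 then (N ^\<^sub>m 0) $$ (i, j) else 0)"
      by (intro sum.cong) (auto simp: binomial_eq_0)
    then show ?case using that 0 N uc by simp
  next
    case (Suc a)
    have pu: "u ^\<^sub>m a \<in> carrier_mat n n" by (rule pow_carrier_mat[OF uc])
    have "(u ^\<^sub>m Suc a) $$ (i, j) = (\<Sum>l<n. (u ^\<^sub>m a) $$ (i, l) * u $$ (l, j))"
      using entry_mult[OF pu uc that(1) Suc.prems] by simp
    also have "\<dots> = (\<Sum>l<n. (u ^\<^sub>m a) $$ (i, l) * N $$ (l, j)) + (\<Sum>l<n. (u ^\<^sub>m a) $$ (i, l) * (1\<^sub>m n) $$ (l, j))"
      unfolding sum.distrib[symmetric] using Suc.prems uc
      by (intro sum.cong refl) (auto simp: N_def algebra_simps)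
    also have "(\<Sum>l<n. (u ^\<^sub>m a) $$ (i, l) * (1\<^sub>m n) $$ (l, j)) = (u ^\<^sub>m a) $$ (i, j)"
      unfolding entry_mult[OF pu one_carrier_mat that(1) Suc.prems, symmetric]
        right_mult_one_mat[OF pu] ..
    also have "(\<Sum>l<n. (u ^\<^sub>m a) $$ (i, l) * N $$ (l, j)) =
        (\<Sum>l<n. \<Sum>m<n. of_nat (a choose m) * ((N ^\<^sub>m m) $$ (i, l) * N $$ (l, j)))"
      by (intro sum.cong refl) (simp add: Suc.IH sum_distrib_right mult.assoc)
    also have "\<dots> = (\<Sum>m<n. of_nat (a choose m) * (\<Sum>l<n. (N ^\<^sub>m m) $$ (i, l) * N $$ (l, j)))"
      by (subst sum.swap) (simp add: sum_distrib_left)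
    also have "\<dots> = (\<Sum>m<n. of_nat (a choose m) * (N ^\<^sub>m Suc m) $$ (i, j))"
      using entry_mult[OF pow_carrier_mat[OF N] N that(1) Suc.prems] by simp
    also have "(u ^\<^sub>m a) $$ (i, j) = (\<Sum>m<n. of_nat (a choose m) * (N ^\<^sub>m m) $$ (i, j))"
      by (rule Suc.IH[OF Suc.prems])
    finally have 1: "(u ^\<^sub>m Suc a) $$ (i, j) = (\<Sum>m<n. of_nat (a choose m) * (N ^\<^sub>m Suc m) $$ (i, j))
       + (\<Sum>m<n. of_nat (a choose m) * (N ^\<^sub>m m) $$ (i, j))" .
    obtain n' where n': "n = Suc n'" using \<open>i < n\<close> by (cases n) auto
    \<comment> \<open>Pascal's rule shifts the summation index by one; the term pushed past the
      bound is a multiple of \<open>N^n = 0\<close>.\<close>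
    have z: "(N ^\<^sub>m Suc n') $$ (i, j) = 0"
      using strict_upper_nilpotent[OF u, of n] n' that(1) Suc.prems by (simp add: N_def)
    show ?case unfolding 1
      unfolding n' sum.lessThan_Suc_shift[of "\<lambda>m. of_nat (Suc a choose m) * _ m"]
        sum.lessThan_Suc_shift[of "\<lambda>m. of_nat (a choose m) * (N ^\<^sub>m m) $$ (i, j)"]
        sum.lessThan_Suc[of "\<lambda>m. of_nat (a choose m) * (N ^\<^sub>m Suc m) $$ (i, j)"] z
      by (simp add: sum.distrib algebra_simps)
  qed
  show ?thesis
    using main uc by (intro eq_matI) (auto simp: upow_def N_def binomial_gbinomial split: if_splits)
qed

lemma upow_entry:
  "i < n \<Longrightarrow> j < n \<Longrightarrow>
     upow n u t $$ (i, j) = (\<Sum>a<n. (t gchoose a) * ((u - 1\<^sub>m n) ^\<^sub>m a) $$ (i, j))"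
  by (simp add: upow_def)

lemma polyfun_upow_entry: "i < n \<Longrightarrow> j < n \<Longrightarrow> polyfun (\<lambda>t. upow n u t $$ (i, j))"
  by (simp add: upow_entry polyfun_sum polyfun_mult polyfun_gbinomial polyfun_const)

lemma upow_unitriangular:
  assumes u: "u \<in> unitriangular n"
  shows "upow n u t \<in> unitriangular n"
proof (rule unitriangularI)
  note P = unitriangularD[OF unitriangular_pow_mat[OF u]]
  show "upow n u t \<in> carrier_mat n n" by (simp add: upow_def)
  show "upow n u t $$ (i, i) = 1" if "i < n" for i
    by (rule polyfun_eq_nat[OF polyfun_upow_entry polyfun_const])
       (use that P in \<open>auto simp: upow_of_nat[OF u]\<close>)
  show "upow n u t $$ (i, j) = 0" if "j < i" "i < n" for i j
    by (rule polyfun_eq_nat[OF polyfun_upow_entry polyfun_const])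
       (use that P in \<open>auto simp: upow_of_nat[OF u]\<close>)
qed

lemma curve_upow: "u \<in> unitriangular n \<Longrightarrow> curve n (upow n u)"
  unfolding curve_def using upow_unitriangular polyfun_upow_entry by blast

lemma upow_one: "u \<in> unitriangular n \<Longrightarrow> upow n u 1 = u"
  using upow_of_nat[of u n 1] unitriangularD[of u n] by auto

lemma upow_zero: "u \<in> unitriangular n \<Longrightarrow> upow n u 0 = 1\<^sub>m n"
  using upow_of_nat[of u n 0] unitriangularD(4)[of u n] by simp

lemma pow_mat_add:
  assumes "u \<in> carrier_mat n n"
  shows "u ^\<^sub>m (a + b) = u ^\<^sub>m a * u ^\<^sub>m b"
proof (induction b)
  case 0
  show ?case using assms pow_carrier_mat[OF assms, of a] by simp
next
  case (Suc b)
  then show ?case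
    using assoc_mult_mat[OF pow_carrier_mat[OF assms] pow_carrier_mat[OF assms] assms] by simp
qed

lemma upow_add:
  assumes u: "u \<in> unitriangular n"
  shows "upow n u (s + t) = upow n u s * upow n u t"
proof -
  \<comment> \<open>Interpolation works in one variable at a time: first \<open>t\<close> becomes
    arbitrary while \<open>s\<close> is natural, then \<open>s\<close> becomes arbitrary.\<close>
  have 1: "upow n u (of_nat a + t) = upow n u (of_nat a) * upow n u t" for a t
  proof (rule curve_eq_nat[where c = "\<lambda>t. upow n u (of_nat a + t)"
        and d = "\<lambda>t. upow n u (of_nat a) * upow n u t" and t = t])
    show "curve n (\<lambda>t. upow n u (of_nat a + t))"
      by (intro curve_comp[OF curve_upow[OF u]] polyfun_add polyfun_const polyfun_id)
    show "curve n (\<lambda>t. upow n u (of_nat a) * upow n u t)"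
      by (intro curve_mult curve_const curve_upow upow_unitriangular u)
    show "upow n u (of_nat a + of_nat b) = upow n u (of_nat a) * upow n u (of_nat b)" for b
      using pow_mat_add[OF unitriangularD(1)[OF u]] by (simp add: upow_of_nat[OF u] flip: of_nat_add)
  qed
  show ?thesis
  proof (rule curve_eq_nat[where c = "\<lambda>s. upow n u (s + t)"
        and d = "\<lambda>s. upow n u s * upow n u t" and t = s])
    show "curve n (\<lambda>s. upow n u (s + t))"
      by (intro curve_comp[OF curve_upow[OF u]] polyfun_add polyfun_const polyfun_id)
    show "curve n (\<lambda>s. upow n u s * upow n u t)"
      by (intro curve_mult curve_const curve_upow upow_unitriangular u)
  qed (rule 1)
qed

lemma upow_uminus:
  assumes u: "u \<in> unitriangular n"
  shows "upow n u (- t) = ginv n (upow n u t)"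
  using upow_add[OF u, of t "- t"] upow_zero[OF u]
    GL_inv_eqI(3)[of "upow n u t" "upow n u (- t)" n] unitriangularD(1)[OF upow_unitriangular[OF u]]
  by simp

lemma upow_upow:
  assumes u: "u \<in> unitriangular n"
  shows "upow n (upow n u s) t = upow n u (s * t)"
proof (rule curve_eq_nat[where d = "\<lambda>t. upow n u (s * t)"])
  show "curve n (upow n (upow n u s))" by (intro curve_upow upow_unitriangular u)
  show "curve n (\<lambda>t. upow n u (s * t))"
    by (intro curve_comp[OF curve_upow[OF u]] polyfun_mult polyfun_const polyfun_id)
  show "upow n (upow n u s) (of_nat a) = upow n u (s * of_nat a)" for a
  proof (induction a)
    case 0
    show ?case using upow_zero[OF u] upow_zero[OF upow_unitriangular[OF u]] by simp
  next
    case (Suc a)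
    have "upow n (upow n u s) (of_nat (Suc a)) = upow n (upow n u s) (of_nat a) * upow n u s"
      by (simp add: upow_of_nat upow_unitriangular u del: of_nat_Suc)
    also have "\<dots> = upow n u (s * of_nat a + s)" using Suc upow_add[OF u] by simp
    finally show ?case by (simp add: algebra_simps)
  qed
qed

text \<open>Binomial coefficients are polynomials with rational coefficients, and \<open>k\<close>
  contains the rationals; so even an exponent that varies with \<open>g\<close> keeps the map over
  \<open>k\<close>.\<close>

lemma regular_map_upow:
  fixes k :: "'a::field_char_0 set"
  assumes k: "is_subfield k" and \<phi>: "regular_map n k m \<phi>" and \<tau>: "\<tau> \<in> ureg n k"
  shows "regular_map n k m (\<lambda>g. upow m (\<phi> g) (\<tau> g))"
  unfolding regular_map_def
proof (intro conjI ballI allI impI)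
  show "upow m (\<phi> u) (\<tau> u) \<in> unitriangular m" if "u \<in> unitriangular n" for u
    using that by (intro upow_unitriangular regular_mapD(1)[OF \<phi>])
  fix i j assume ij: "i < m" "j < m"
  have g: "(\<lambda>g. \<tau> g gchoose a) \<in> ureg n k" for a
  proof -
    have "(\<lambda>g. (1 / fact a) * (\<Prod>i<a. \<tau> g - of_nat i)) \<in> ureg n k"
      by (intro ureg_cmult[OF k] ureg_prod[OF k] ureg_diff[OF k] ureg_const \<tau>
          subfield_of_nat[OF k] subfield_divide[OF k] subfield_one[OF k])
         (metis k of_nat_fact subfield_of_nat)
    then show ?thesis by (simp add: gbinomial_prod_rev atLeast0LessThan)
  qed
  have p: "(\<lambda>g. ((\<phi> g - 1\<^sub>m m) ^\<^sub>m a) $$ (i, j)) \<in> ureg n k" if "j < m" for a j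
    using that
  proof (induction a arbitrary: j)
    case 0
    show ?case
    proof (rule ureg_cong)
      show "(\<lambda>g. if i = j then 1 else 0) \<in> ureg n k"
        by (intro ureg_const) (simp add: subfield_zero[OF k] subfield_one[OF k])
    qed (use ij 0 unitriangularD[OF regular_mapD(1)[OF \<phi>]] in auto)
  next
    case (Suc a)
    show ?case
    proof (rule ureg_cong)
      show "(\<lambda>g. \<Sum>l<m. ((\<phi> g - 1\<^sub>m m) ^\<^sub>m a) $$ (i, l) *
          (\<phi> g $$ (l, j) - (if l = j then 1 else 0))) \<in> ureg n k"
        by (intro ureg_sum[OF k] ureg_mult Suc.IH ureg_diff[OF k] regular_mapD(2)[OF \<phi>] ureg_const)
           (auto simp: Suc.prems subfield_zero[OF k] subfield_one[OF k])
      fix u :: "'a mat" assume "u \<in> unitriangular n"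
      then have c: "\<phi> u \<in> carrier_mat m m" by (intro unitriangularD(1) regular_mapD(1)[OF \<phi>])
      then have c': "\<phi> u - 1\<^sub>m m \<in> carrier_mat m m" by auto
      show "((\<phi> u - 1\<^sub>m m) ^\<^sub>m Suc a) $$ (i, j) = (\<Sum>l<m. ((\<phi> u - 1\<^sub>m m) ^\<^sub>m a) $$ (i, l) *
          (\<phi> u $$ (l, j) - (if l = j then 1 else 0)))"
        using entry_mult[OF pow_carrier_mat[OF c'] c' ij(1) Suc.prems] c Suc.prems by simp
    qed
  qed
  show "(\<lambda>u. upow m (\<phi> u) (\<tau> u) $$ (i, j)) \<in> ureg n k"
    using ij by (simp add: upow_entry) (intro ureg_sum[OF k] ureg_mult g p, simp)
qed

text \<open>The inverse is the power with exponent \<open>-1\<close>.\<close>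

lemma regular_map_inv:
  fixes k :: "'a::field_char_0 set"
  assumes k: "is_subfield k" and \<phi>: "regular_map n k m \<phi>"
  shows "regular_map n k m (\<lambda>u. ginv m (\<phi> u))"
proof -
  have "regular_map n k m (\<lambda>u. upow m (\<phi> u) (-1))"
    by (intro regular_map_upow[OF k \<phi>] ureg_const subfield_uminus[OF k] subfield_one[OF k])
  moreover have "upow m (\<phi> u) (-1) = ginv m (\<phi> u)" if "u \<in> unitriangular n" for u
    using upow_uminus[of "\<phi> u" m 1] upow_one[of "\<phi> u" m] regular_mapD(1)[OF \<phi> that] by simp
  moreover have "(\<lambda>u. ginv m (\<phi> u) $$ (i, j)) \<in> ureg n k" if "i < m" "j < m" for i j
    by (rule ureg_cong[OF regular_mapD(2)[OF calculation(1) that]]) (simp add: calculation(2))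
  ultimately show ?thesis unfolding regular_map_def by auto
qed

text \<open>The natural powers lie in \<open>D\<close>, and a closed set containing a curve at the
  natural numbers contains all of it.\<close>

lemma closed_subgroup_upow:
  assumes "subgroup D (GL n)" "zariski_closed n D" "D \<subseteq> unitriangular n" "u \<in> D"
  shows "upow n u t \<in> D"
proof (rule curve_in_closed[OF curve_upow assms(2)])
  show u: "u \<in> unitriangular n" using assms by auto
  have "u ^\<^sub>m a \<in> D" for a
    by (induction a) (use subgroupD_GL[OF assms(1)] assms(4) unitriangularD(4)[OF u] in auto)
  then show "upow n u (of_nat a) \<in> D" for a by (simp add: upow_of_nat[OF u])
qed

subsection \<open>Density of rational points and descent\<close>

text \<open>\<open>U_n\<close> is an affine space and \<open>k\<close> is infinite, so the entries
  can be released from \<open>k\<close> one after the other, each time by a polynomial in one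
  variable.\<close>

lemma ureg_vanish_rational:
  fixes k :: "'a::field_char_0 set"
  assumes k: "is_subfield k" and f: "f \<in> ureg n UNIV"
    and zero: "\<And>u. u \<in> rat_points n k (unitriangular n) \<Longrightarrow> f u = 0"
    and u: "u \<in> unitriangular n"
  shows "f u = 0"
proof -
  \<comment> \<open>\<open>A\<close> is the set of positions whose entries need not lie in
    \<open>k\<close>; in the end it contains all positions.\<close>
  have main: "\<forall>u\<in>unitriangular n. (\<forall>i<n. \<forall>j<n. (i, j) \<notin> A \<longrightarrow> u $$ (i, j) \<in> k) \<longrightarrow> f u = 0"
    if "finite A" for A
    using that
  proof (induction A rule: finite_induct)
    case empty
    then show ?case using zero unitriangular_GL by (auto simp: rat_points_def)
  next
    case (insert x A)
    obtain a b where x: "x = (a, b)" by force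
    show ?case
    proof (intro ballI impI)
      fix u assume u: "u \<in> unitriangular n"
        and uk: "\<forall>i<n. \<forall>j<n. (i, j) \<notin> insert x A \<longrightarrow> u $$ (i, j) \<in> k"
      note U = unitriangularD[OF u]
      show "f u = 0"
      proof (cases "a < b \<and> b < n")
        case True
        \<comment> \<open>The line through \<open>u\<close> in the direction of the entry just
          released; the induction hypothesis covers it for \<open>t\<close> in
          \<open>k\<close>.\<close>
        define c where "c t = mat n n (\<lambda>(i, j). if (i, j) = (a, b) then t else u $$ (i, j))" for t
        have cu: "c t \<in> unitriangular n" for t
          by (rule unitriangularI) (use U True in \<open>auto simp: c_def\<close>)
        have cv: "curve n c"
          unfolding curve_def
        proof (intro conjI allI impI cu)
          show "polyfun (\<lambda>t. c t $$ (i, j))" if "i < n" "j < n" for i j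
            using that by (cases "(i, j) = (a, b)") (auto simp: c_def polyfun_const polyfun_id)
        qed
        have "f (c t) = 0" if "t \<in> k" for t
          using insert.IH cu[of t] uk that by (auto simp: c_def x)
        then have "f (c (u $$ (a, b))) = 0"
          by (rule polyfun_eq_zero[OF curve_ureg[OF cv f] subfield_infinite[OF k]])
        also have "c (u $$ (a, b)) = u" using U by (intro eq_matI) (auto simp: c_def)
        finally show ?thesis .
      next
        case False
        \<comment> \<open>The released position is not above the diagonal, where the entry is 0 or 1
          and lies in \<open>k\<close> anyway.\<close>
        have "u $$ (i, j) \<in> k" if "i < n" "j < n" "(i, j) \<notin> A" for i j
        proof (cases "(i, j) = (a, b)")
          case True
          then have "j \<le> i" using False that by auto
          then have "u $$ (i, j) = (if i = j then 1 else 0)" using U that by auto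
          then show ?thesis using subfield_zero[OF k] subfield_one[OF k] by simp
        qed (use uk x that in auto)
        then show ?thesis using insert.IH u by blast
      qed
    qed
  qed
  show ?thesis using main[of "{..<n} \<times> {..<n}"] u by auto
qed

lemma ureg_eq_rational:
  fixes k :: "'a::field_char_0 set"
  assumes k: "is_subfield k" and f: "f \<in> ureg n UNIV" "f' \<in> ureg n UNIV"
    and eq: "\<And>u. u \<in> rat_points n k (unitriangular n) \<Longrightarrow> f u = f' u"
    and u: "u \<in> unitriangular n"
  shows "f u = f' u"
  using ureg_vanish_rational[OF k ureg_diff[OF subfield_UNIV f] _ u] eq by simp

section \<open>Linear functionals over \<open>k\<close> and descent of functions\<close>

definition functional :: "'a::field set \<Rightarrow> ('a \<Rightarrow> 'a) \<Rightarrow> bool" where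
  "functional k l \<longleftrightarrow> (\<forall>x. l x \<in> k) \<and> (\<forall>x y. l (x + y) = l x + l y) \<and>
     (\<forall>c\<in>k. \<forall>x. l (c * x) = c * l x)"

definition k_subspace :: "'a::field set \<Rightarrow> 'a set \<Rightarrow> bool" where
  "k_subspace k M \<longleftrightarrow> 0 \<in> M \<and> (\<forall>x\<in>M. \<forall>y\<in>M. x + y \<in> M) \<and> (\<forall>c\<in>k. \<forall>x\<in>M. c * x \<in> M)"

text \<open>Applying \<open>k\<close>-linear functionals to the coefficients of regular functions takes the place of Galois
  descent.\<close>

lemma exists_functional:
  fixes k :: "'a::field set"
  assumes k: "is_subfield k" and M0: "k_subspace k M0" and b: "b \<notin> M0"
  obtains l where "functional k l" "l b = 1" "\<And>x. x \<in> M0 \<Longrightarrow> l x = 0"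
proof -
  \<comment> \<open>A maximal subspace avoiding \<open>b\<close> is a hyperplane complementary to
    the line \<open>k b\<close>; the functional is the coordinate along \<open>b\<close>.\<close>
  define A where "A = {M. M0 \<subseteq> M \<and> k_subspace k M \<and> b \<notin> M}"
  have "\<exists>M\<in>A. \<forall>Xs\<in>A. M \<subseteq> Xs \<longrightarrow> Xs = M"
  proof (rule subset_Zorn_nonempty)
    show "A \<noteq> {}" using M0 b by (auto simp: A_def)
    fix C assume C: "C \<noteq> {}" "subset.chain A C"
    have CA: "C \<subseteq> A" using C by (auto simp: subset_chain_def)
    have "k_subspace k (\<Union>C)"
      unfolding k_subspace_def
    proof (intro conjI ballI)
      show "0 \<in> \<Union>C" using C CA by (auto simp: A_def k_subspace_def)
      show "x + y \<in> \<Union>C" if "x \<in> \<Union>C" "y \<in> \<Union>C" for x y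
      proof -
        obtain Xs Y where XY: "Xs \<in> C" "Y \<in> C" "x \<in> Xs" "y \<in> Y" using \<open>x \<in> \<Union>C\<close> \<open>y \<in> \<Union>C\<close> by auto
        then have "Xs \<subseteq> Y \<or> Y \<subseteq> Xs" using C by (auto simp: subset_chain_def)
        then obtain Z where "Z \<in> C" "x \<in> Z" "y \<in> Z" using XY by auto
        then have "x + y \<in> Z" using CA unfolding A_def k_subspace_def by blast
        then show ?thesis using \<open>Z \<in> C\<close> by blast
      qed
      show "c * x \<in> \<Union>C" if "c \<in> k" "x \<in> \<Union>C" for c x
        using that CA by (auto simp: A_def k_subspace_def)
    qed
    then show "\<Union>C \<in> A" using C CA by (auto simp: A_def)
  qed
  then obtain M where "M \<in> A" and max: "\<And>Xs. Xs \<in> A \<Longrightarrow> M \<subseteq> Xs \<Longrightarrow> Xs = M" by auto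
  then have M: "M0 \<subseteq> M" "b \<notin> M" and M_0: "0 \<in> M"
    and M_add: "\<And>x y. x \<in> M \<Longrightarrow> y \<in> M \<Longrightarrow> x + y \<in> M"
    and M_scale: "\<And>c x. c \<in> k \<Longrightarrow> x \<in> M \<Longrightarrow> c * x \<in> M"
    by (auto simp: A_def k_subspace_def)
  have M_neg: "- x \<in> M" if "x \<in> M" for x
    using M_scale[OF subfield_uminus[OF k subfield_one[OF k]] that] by simp
  \<comment> \<open>If \<open>x\<close> is not in \<open>M\<close>, then \<open>M + k x\<close> is
    strictly larger, so by maximality it contains \<open>b\<close>, and the relation can be solved
    for \<open>x\<close>.\<close>
  have ex: "\<exists>c\<in>k. x - c * b \<in> M" for x
  proof (cases "x \<in> M")
    case True
    then show ?thesis using subfield_zero[OF k] by (intro bexI[of _ 0]) auto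
  next
    case False
    define Xs where "Xs = {m + c * x | m c. m \<in> M \<and> c \<in> k}"
    have MX: "M \<subseteq> Xs"
    proof
      fix m assume "m \<in> M"
      then have "m = m + 0 * x \<and> m \<in> M \<and> (0::'a) \<in> k" using subfield_zero[OF k] by simp
      then show "m \<in> Xs" unfolding Xs_def by blast
    qed
    have "x = 0 + 1 * x \<and> 0 \<in> M \<and> (1::'a) \<in> k" using M_0 subfield_one[OF k] by simp
    then have "x \<in> Xs" unfolding Xs_def by blast
    then have "Xs \<noteq> M" using False by auto
    have "k_subspace k Xs" unfolding k_subspace_def
    proof (intro conjI ballI)
      show "0 \<in> Xs" using M_0 MX by auto
      fix y z assume "y \<in> Xs" "z \<in> Xs"
      then obtain m c m' c' where "y = m + c * x" "z = m' + c' * x" "m \<in> M" "m' \<in> M" "c \<in> k" "c' \<in> k"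
        by (auto simp: Xs_def)
      then have "y + z = (m + m') + (c + c') * x \<and> m + m' \<in> M \<and> c + c' \<in> k"
        using M_add subfield_add[OF k] by (simp add: algebra_simps)
      then show "y + z \<in> Xs" unfolding Xs_def by blast
    next
      fix d y assume "d \<in> k" "y \<in> Xs"
      then obtain m c where "y = m + c * x" "m \<in> M" "c \<in> k" by (auto simp: Xs_def)
      then have "d * y = d * m + (d * c) * x \<and> d * m \<in> M \<and> d * c \<in> k"
        using M_scale subfield_mult[OF k] \<open>d \<in> k\<close> by (simp add: algebra_simps)
      then show "d * y \<in> Xs" unfolding Xs_def by blast
    qed
    then have "b \<in> Xs" using max[of Xs] MX M \<open>Xs \<noteq> M\<close> by (auto simp: A_def)
    then obtain m c where mc: "b = m + c * x" "m \<in> M" "c \<in> k" by (auto simp: Xs_def)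
    then have "c \<noteq> 0" using M by auto
    then have "x - inverse c * b = inverse c * (- m)" using mc by (simp add: field_simps)
    then show ?thesis using mc subfield_inverse[OF k] M_scale M_neg by metis
  qed
  have uniq: "c = c'" if "c \<in> k" "c' \<in> k" "x - c * b \<in> M" "x - c' * b \<in> M" for x c c'
  proof (rule ccontr)
    assume "c \<noteq> c'"
    have "(x - c' * b) + - (x - c * b) \<in> M" by (intro M_add M_neg that)
    then have "(c - c') * b \<in> M" by (simp add: algebra_simps)
    moreover have "inverse (c - c') \<in> k" by (intro subfield_inverse[OF k] subfield_diff[OF k] that)
    ultimately have "inverse (c - c') * ((c - c') * b) \<in> M" by (rule M_scale[rotated])
    moreover have "inverse (c - c') * ((c - c') * b) = b"
      unfolding mult.assoc[symmetric] using \<open>c \<noteq> c'\<close> by simp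
    ultimately show False using M by simp
  qed
  define l where "l x = (THE c. c \<in> k \<and> x - c * b \<in> M)" for x
  have l: "l x \<in> k \<and> x - l x * b \<in> M" for x
    unfolding l_def by (rule theI') (use ex uniq in blast)
  have leq: "l x = c" if "c \<in> k" "x - c * b \<in> M" for x c
    using uniq l that by blast
  show ?thesis
  proof
    show "functional k l" unfolding functional_def
    proof (intro conjI allI ballI)
      show "l x \<in> k" for x using l by auto
      show "l (x + y) = l x + l y" for x y
      proof (rule leq)
        show "l x + l y \<in> k" using l subfield_add[OF k] by auto
        have "(x - l x * b) + (y - l y * b) \<in> M" using l M_add by auto
        then show "x + y - (l x + l y) * b \<in> M" by (simp add: algebra_simps)
      qed
      show "l (c * x) = c * l x" if "c \<in> k" for c x
      proof (rule leq)
        show "c * l x \<in> k" using l that subfield_mult[OF k] by auto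
        have "c * (x - l x * b) \<in> M" using l that M_scale by auto
        then show "c * x - c * l x * b \<in> M" by (simp add: algebra_simps)
      qed
    qed
    show "l b = 1" by (rule leq) (use subfield_one[OF k] M_0 in auto)
    show "l x = 0" if "x \<in> M0" for x by (rule leq) (use subfield_zero[OF k] M that in auto)
  qed
qed

text \<open>The scalar extension of the coordinate ring over \<open>k\<close>: a functional can be
  applied to the coefficients \<open>c\<close> while the functions \<open>h\<close> stay
  untouched.\<close>

inductive_set reg_span :: "nat \<Rightarrow> 'a set \<Rightarrow> ('a::field mat \<Rightarrow> 'a) set" for n k where
  zero: "(\<lambda>g. 0) \<in> reg_span n k"
| step: "h \<in> regular_fun n k \<Longrightarrow> s \<in> reg_span n k \<Longrightarrow> (\<lambda>g. c * h g + s g) \<in> reg_span n k"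

lemma reg_span_single: "h \<in> regular_fun n k \<Longrightarrow> (\<lambda>g. c * h g) \<in> reg_span n k"
  using reg_span.step[OF _ reg_span.zero, of h n k c] by simp

lemma reg_span_add:
  assumes "s \<in> reg_span n k" "s' \<in> reg_span n k"
  shows "(\<lambda>g. s g + s' g) \<in> reg_span n k"
  using assms(1)
proof (induction rule: reg_span.induct)
  case (step h s c)
  have "(\<lambda>g. c * h g + (s g + s' g)) \<in> reg_span n k" by (intro reg_span.step step)
  then show ?case by (simp add: add.assoc)
qed (use assms in simp)

lemma reg_span_mult:
  assumes "s \<in> reg_span n k" "s' \<in> reg_span n k"
  shows "(\<lambda>g. s g * s' g) \<in> reg_span n k"
proof -
  have 1: "(\<lambda>g. d * h g * t g) \<in> reg_span n k" if "h \<in> regular_fun n k" "t \<in> reg_span n k" for d h t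
    using that(2)
  proof (induction rule: reg_span.induct)
    case (step h' t c)
    have "(\<lambda>g. (d * c) * (h g * h' g) + d * h g * t g) \<in> reg_span n k"
      by (intro reg_span.step regular_fun.mult step that)
    then show ?case by (simp add: algebra_simps)
  qed (use reg_span.zero in simp)
  from assms(1) show ?thesis
  proof (induction rule: reg_span.induct)
    case (step h s c)
    show ?case using reg_span_add[OF 1[OF step(1) assms(2), of c] step(3)] by (simp add: algebra_simps)
  qed (use reg_span.zero in simp)
qed

lemma regular_fun_reg_span:
  assumes k: "is_subfield k" and "f \<in> regular_fun n UNIV"
  shows "f \<in> reg_span n k"
  using assms(2)
proof (induction rule: regular_fun.induct)
  case (const c)
  show ?case using reg_span_single[OF regular_fun.const[OF subfield_one[OF k]], where n = n and c = c] by simp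
next
  case (coord i j)
  then show ?case using reg_span_single[OF regular_fun.coord, where c = 1] by simp
next
  case inv_det
  then show ?case using reg_span_single[OF regular_fun.inv_det, where c = 1] by simp
qed (auto intro: reg_span_add reg_span_mult)

text \<open>At a rational point \<open>h u\<close> lies in \<open>k\<close>, so
  \<open>l (c * h u) = l c * h u\<close>: replacing each coefficient by its image under
  \<open>l\<close> has the effect of \<open>l\<close> on the values. Values at other points are not
  controlled, but the rational ones determine the function on \<open>U_n\<close>.\<close>

lemma ureg_functional:
  assumes k: "is_subfield k" and f: "f \<in> ureg n UNIV" and l: "functional k l"
  obtains f' where "f' \<in> ureg n k" "\<And>u. u \<in> rat_points n k (unitriangular n) \<Longrightarrow> f' u = l (f u)"
proof -
  obtain h where h: "h \<in> regular_fun n UNIV" "\<And>u. u \<in> unitriangular n \<Longrightarrow> f u = h u"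
    using f by (rule uregE) blast
  have "\<exists>f'\<in>ureg n k. \<forall>u\<in>rat_points n k (unitriangular n). f' u = l (s u)"
    if "s \<in> reg_span n k" for s
    using that
  proof (induction rule: reg_span.induct)
    case zero
    have "l 0 = 0" using l subfield_zero[OF k] unfolding functional_def by (metis mult_zero_left)
    then show ?case by (intro bexI[OF _ ureg_const[OF subfield_zero[OF k]]]) simp
  next
    case (step h s c)
    then obtain s' where s': "s' \<in> ureg n k" "\<And>u. u \<in> rat_points n k (unitriangular n) \<Longrightarrow> s' u = l (s u)"
      by blast
    have lc: "l c \<in> k" using l by (simp add: functional_def)
    show ?case
    proof (intro bexI ballI)
      show "(\<lambda>g. l c * h g + s' g) \<in> ureg n k"
        by (intro ureg_add ureg_cmult[OF k] lc regular_fun_ureg step s')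
      fix u assume u: "u \<in> rat_points n k (unitriangular n)"
      have "h u \<in> k" by (rule ureg_rational_point[OF k regular_fun_ureg[OF step(1)] u])
      then have "l (h u * c + s u) = h u * l c + l (s u)" using l by (simp add: functional_def)
      then show "l c * h u + s' u = l (c * h u + s u)" using s'(2)[OF u] by (simp add: mult.commute)
    qed
  qed
  from this[OF regular_fun_reg_span[OF k h(1)]] that h(2) show ?thesis
    by (auto simp: rat_points_def)
qed

text \<open>A functional with \<open>l 1 = 1\<close> is the identity on \<open>k\<close>. It turns
  \<open>f\<close> into a function over \<open>k\<close> with the same values at rational points,
  hence the same values on \<open>U_n\<close>.\<close>

lemma ureg_descend:
  fixes k :: "'a::field_char_0 set"
  assumes k: "is_subfield k" and f: "f \<in> ureg n UNIV"
    and rat: "\<And>u. u \<in> rat_points n k (unitriangular n) \<Longrightarrow> f u \<in> k"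
  shows "f \<in> ureg n k"
proof -
  have "k_subspace k {0}" by (simp add: k_subspace_def)
  then obtain l where l: "functional k l" "l 1 = 1" by (rule exists_functional[OF k, of "{0}" 1]) auto
  obtain f' where f': "f' \<in> ureg n k" "\<And>u. u \<in> rat_points n k (unitriangular n) \<Longrightarrow> f' u = l (f u)"
    using ureg_functional[OF k f l(1)] by blast
  have "l c = c" if "c \<in> k" for c
    using l that unfolding functional_def by (metis mult.right_neutral)
  then have "f u = f' u" if "u \<in> unitriangular n" for u
    using f' rat by (intro ureg_eq_rational[OF k f ureg_UNIV[OF f'(1)] _ that]) simp
  then show ?thesis using ureg_cong[OF f'(1)] by simp
qed

text \<open>Write \<open>f\<close> as \<open>\<Sum> a i * e i\<close> with \<open>e i\<close> over
  \<open>k\<close> in the ideal of \<open>D\<close>. The functional only affects the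
  \<open>a i\<close>, so the new function is again a combination of the \<open>e i\<close> on
  rational points, hence on \<open>U_n\<close>, and vanishes on \<open>D\<close>.\<close>

lemma vanishing_functional:
  fixes k :: "'a::field_char_0 set"
  assumes k: "is_subfield k" and D: "defined_over n k D" "D \<subseteq> unitriangular n"
    and f: "f \<in> ureg n UNIV" "\<And>g. g \<in> D \<Longrightarrow> f g = 0" and l: "functional k l"
    and f': "f' \<in> ureg n k" "\<And>u. u \<in> rat_points n k (unitriangular n) \<Longrightarrow> f' u = l (f u)"
    and g: "g \<in> D"
  shows "f' g = 0"
proof -
  obtain h where h: "h \<in> regular_fun n UNIV" "\<And>u. u \<in> unitriangular n \<Longrightarrow> f u = h u"
    using f(1) by (rule uregE) blast
  have "h g = 0" if "g \<in> D" for g using h(2)[of g] f(2)[OF that] D(2) that by auto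
  then have "h \<in> vanishing_ideal n UNIV D" using h(1) by (simp add: vanishing_ideal_def)
  then obtain m a e where ae: "\<forall>i<m. a i \<in> regular_fun n UNIV \<and> e i \<in> vanishing_ideal n k D"
    "\<forall>g\<in>carrier (GL n). h g = (\<Sum>i<(m::nat). a i g * e i g)"
    using D(1) unfolding defined_over_def by blast
  have "\<forall>i. \<exists>a'. i < m \<longrightarrow> a' \<in> ureg n k \<and> (\<forall>u\<in>rat_points n k (unitriangular n). a' u = l (a i u))"
    using ae(1) ureg_functional[OF k regular_fun_ureg l] by metis
  then obtain a' where a': "\<And>i. i < m \<Longrightarrow> a' i \<in> ureg n k"
    "\<And>i u. i < m \<Longrightarrow> u \<in> rat_points n k (unitriangular n) \<Longrightarrow> a' i u = l (a i u)"
    by metis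
  have e: "e i \<in> ureg n k" "e i g = 0" if "i < m" for i
    using ae(1) that g by (auto simp: vanishing_ideal_def intro: regular_fun_ureg)
  define f'' where "f'' = (\<lambda>g. \<Sum>i<m. a' i g * e i g)"
  have f'': "f'' \<in> ureg n k" unfolding f''_def by (intro ureg_sum[OF k] ureg_mult a' e) auto
  have lsum: "l (\<Sum>i\<in>I. x i) = (\<Sum>i\<in>I. l (x i))" for x :: "nat \<Rightarrow> 'a" and I
  proof -
    have "l 0 = 0" using l subfield_zero[OF k] unfolding functional_def by (metis mult_zero_left)
    then show ?thesis using l
      by (induction I rule: infinite_finite_induct) (auto simp: functional_def)
  qed
  have eq: "f' u = f'' u" if u: "u \<in> rat_points n k (unitriangular n)" for u
  proof -
    have uU: "u \<in> unitriangular n" "u \<in> carrier (GL n)" using u by (auto simp: rat_points_def)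
    have "f' u = l (\<Sum>i<m. a i u * e i u)" using f'(2)[OF u] h(2)[OF uU(1)] ae(2) uU(2) by simp
    also have "\<dots> = (\<Sum>i<m. l (e i u * a i u))" by (simp add: lsum mult.commute)
    also have "\<dots> = f'' u" unfolding f''_def
    proof (rule sum.cong)
      fix i assume i: "i \<in> {..<m}"
      have "e i u \<in> k" using ureg_rational_point[OF k e(1) u] i by simp
      then have "l (e i u * a i u) = e i u * l (a i u)" using l by (simp add: functional_def)
      then show "l (e i u * a i u) = a' i u * e i u" using a'(2) i u by (simp add: mult.commute)
    qed simp
    finally show ?thesis .
  qed
  have "f' g = f'' g"
    by (rule ureg_eq_rational[OF k ureg_UNIV[OF f'(1)] ureg_UNIV[OF f''] eq subsetD[OF D(2) g]])
  then show ?thesis by (simp add: f''_def e)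
qed

subsection \<open>Normal forms of cosets\<close>

text \<open>The entries are numbered column by column, and from bottom to top in each column: with this order,
  right multiplication by a matrix whose coordinates before \<open>s\<close> vanish adds up the coordinates
  \<open>s\<close>.\<close>

definition ucoord :: "nat \<Rightarrow> nat \<Rightarrow> 'a::field mat \<Rightarrow> 'a" where
  "ucoord n s g = (if n - 1 - s mod n < s div n then g $$ (n - 1 - s mod n, s div n) else 0)"

lemma ucoord_index:
  fixes i j n :: nat
  assumes "i < n" "j < n"
  shows "j * n + (n - 1 - i) < n * n" "(j * n + (n - 1 - i)) mod n = n - 1 - i"
    "(j * n + (n - 1 - i)) div n = j" "n - 1 - (n - 1 - i) = i"
proof -
  have a: "n - 1 - i < n" using assms by simp
  have "j * n + (n - 1 - i) < (j + 1) * n" using a by simp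
  also have "\<dots> \<le> n * n" using assms by (intro mult_right_mono) auto
  finally show "j * n + (n - 1 - i) < n * n" .
  show "(j * n + (n - 1 - i)) mod n = n - 1 - i" using a by simp
  show "(j * n + (n - 1 - i)) div n = j" using a by simp
  show "n - 1 - (n - 1 - i) = i" using assms by simp
qed

lemma ucoord_entry:
  assumes "i < j" "j < n"
  shows "ucoord n (j * n + (n - 1 - i)) g = g $$ (i, j)"
  using ucoord_index[of i n j] assms unfolding ucoord_def by simp

lemma ucoord_bounds: "(s::nat) < n * n \<Longrightarrow> n - 1 - s mod n < n \<and> s div n < n"
  by (cases "n = 0") (auto simp: less_mult_imp_div_less)

lemma ucoord_ureg:
  assumes "s < n * n" "is_subfield k"
  shows "ucoord n s \<in> ureg n k"
  using ucoord_bounds[OF assms(1)] ureg_coord[of "n - 1 - s mod n" n "s div n" k]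
    ureg_const[OF subfield_zero[OF assms(2)], of n] unfolding ucoord_def by (cases "n - 1 - s mod n < s div n") auto

lemma ucoord_one: "s < n * n \<Longrightarrow> ucoord n s (1\<^sub>m n) = 0"
  using ucoord_bounds[of s n] by (auto simp: ucoord_def)

lemma ucoord_eqI:
  assumes g: "g \<in> unitriangular n" and h: "h \<in> unitriangular n"
    and eq: "\<And>s. s < n * n \<Longrightarrow> ucoord n s g = ucoord n s h"
  shows "g = h"
proof (rule eq_matI)
  note G = unitriangularD[OF g] and H = unitriangularD[OF h]
  fix i j assume "i < dim_row h" "j < dim_col h"
  then have ij: "i < n" "j < n" using H by auto
  show "g $$ (i, j) = h $$ (i, j)"
  proof (cases i j rule: linorder_cases)
    case less
    then show ?thesis using eq[OF ucoord_index(1)[OF ij]] ucoord_entry[OF less ij(2)] by metis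
  qed (use G H ij in auto)
qed (use unitriangularD[OF g] unitriangularD[OF h] in auto)

lemma ucoord_mult:
  assumes g: "g \<in> unitriangular n" and h: "h \<in> unitriangular n" and s: "s < n * n"
    and zero: "\<And>s'. s' < s \<Longrightarrow> ucoord n s' h = 0"
  shows "ucoord n s (g * h) = ucoord n s g + ucoord n s h"
proof -
  note G = unitriangularD[OF g] and H = unitriangularD[OF h]
  define i j where "i = n - 1 - s mod n" and "j = s div n"
  have ij: "i < n" "j < n" using ucoord_bounds[OF s] by (auto simp: i_def j_def)
  have "n > 0" using s by (cases n) auto
  then have "s mod n = n - 1 - i" using mod_less_divisor[of n s] unfolding i_def by arith
  then have s_eq: "s = j * n + (n - 1 - i)" using div_mult_mod_eq[of s n] by (simp add: j_def)
  show ?thesis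
  proof (cases "i < j")
    case True
    have "(g * h) $$ (i, j) = (\<Sum>l<n. (if l = i then h $$ (i, j) else 0) + (if l = j then g $$ (i, j) else 0))"
      unfolding entry_mult[OF G(1) H(1) ij]
    proof (rule sum.cong)
      fix l assume "l \<in> {..<n}"
      then have l: "l < n" by simp
      consider "l < i" | "l = i" | "i < l" "l < j" | "l = j" | "j < l" using True by linarith
      then show "g $$ (i, l) * h $$ (l, j) =
        (if l = i then h $$ (i, j) else 0) + (if l = j then g $$ (i, j) else 0)"
      proof cases
        \<comment> \<open>The position \<open>(l, j)\<close> lies below \<open>(i, j)\<close> in the
          same column, so it comes earlier in the order and \<open>h\<close> vanishes there.\<close>
        case 3
        have "j * n + (n - 1 - l) < s" using 3 l by (simp add: s_eq)
        then have "h $$ (l, j) = 0" using zero ucoord_entry[OF 3(2) ij(2), of h] by metis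
        then show ?thesis using 3 by simp
      qed (use G H ij l True in auto)
    qed simp
    then have "(g * h) $$ (i, j) = h $$ (i, j) + g $$ (i, j)" using ij by (simp add: sum.distrib)
    then show ?thesis using True by (simp add: ucoord_def i_def j_def)
  qed (simp add: ucoord_def i_def j_def)
qed

lemma ucoord_upow:
  assumes u: "u \<in> unitriangular n" and s: "s < n * n"
    and zero: "\<And>s'. s' < s \<Longrightarrow> ucoord n s' u = 0"
  shows "ucoord n s (upow n u t) = t * ucoord n s u"
proof (rule polyfun_eq_nat[where g = "\<lambda>t. t * ucoord n s u"])
  show "polyfun (\<lambda>t. ucoord n s (upow n u t))"
    by (rule curve_ureg[OF curve_upow[OF u] ucoord_ureg[OF s subfield_UNIV]])
  show "polyfun (\<lambda>t. t * ucoord n s u)" by (intro polyfun_mult polyfun_id polyfun_const)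
  show "ucoord n s (upow n u (of_nat a)) = of_nat a * ucoord n s u" for a
    unfolding upow_of_nat[OF u]
  proof (induction a)
    case 0
    show ?case using ucoord_one[OF s] unitriangularD(4)[OF u] by simp
  next
    case (Suc a)
    then show ?case
      using ucoord_mult[OF unitriangular_pow_mat[OF u] u s zero] by (simp add: algebra_simps)
  qed
qed

lemma ucoord_leading:
  assumes "u \<in> unitriangular n" "u \<noteq> 1\<^sub>m n"
  obtains s where "s < n * n" "ucoord n s u \<noteq> 0" "\<And>s'. s' < s \<Longrightarrow> ucoord n s' u = 0"
proof -
  define P where "P s \<longleftrightarrow> s < n * n \<and> ucoord n s u \<noteq> 0" for s
  have "\<exists>s. P s"
  proof (rule ccontr)
    assume "\<nexists>s. P s"
    then have "u = 1\<^sub>m n"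
      by (intro ucoord_eqI[OF assms(1) unitriangular_one]) (auto simp: P_def ucoord_one)
    then show False using assms(2) by simp
  qed
  then have L: "P (LEAST s. P s)" by (rule LeastI_ex)
  define m where "m = (LEAST s. P s)"
  have m: "m < n * n" "ucoord n m u \<noteq> 0" using L by (simp_all add: m_def P_def)
  have "ucoord n s' u = 0" if "s' < m" for s'
  proof -
    have "\<not> P s'" using not_less_Least[of s' P] that by (simp add: m_def)
    then show ?thesis using less_trans[OF that m(1)] by (simp add: P_def)
  qed
  with m show ?thesis by (rule that)
qed

text \<open>The pivot positions of \<open>D\<close>, as in an echelon form: the places of the
  leading coordinates of its elements.\<close>

definition jumps :: "nat \<Rightarrow> 'a::field mat set \<Rightarrow> nat set" where
  "jumps n D = {s. s < n * n \<and> (\<exists>u\<in>D. ucoord n s u \<noteq> 0 \<and> (\<forall>s'<s. ucoord n s' u = 0))}"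

text \<open>If \<open>h = g y\<close> with \<open>y \<noteq> 1\<close>, then the leading position of
  \<open>y\<close> is a jump, and there the coordinates of \<open>g\<close> and \<open>h\<close>
  differ by the nonzero coordinate of \<open>y\<close>.\<close>

lemma coset_eqI:
  assumes D: "D \<subseteq> unitriangular n" and g: "g \<in> unitriangular n" and h: "h \<in> unitriangular n"
    and gh: "ginv n g * h \<in> D" and eq: "\<And>s. s \<in> jumps n D \<Longrightarrow> ucoord n s g = ucoord n s h"
  shows "g = h"
proof (rule ccontr)
  assume "g \<noteq> h"
  define y where "y = ginv n g * h"
  have y: "y \<in> unitriangular n" "y \<in> D" using gh D by (auto simp: y_def)
  note gG = unitriangular_GL[OF g]
  have hgy: "h = g * y" unfolding y_def
    using assoc_mult_mat[OF GL_carrier_mat[OF gG] GL_carrier_mat[OF GL_inv_closed[OF gG]]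
        unitriangularD(1)[OF h]] GL_r_inv[OF gG] unitriangularD(1)[OF h] by simp
  have "y \<noteq> 1\<^sub>m n" using hgy \<open>g \<noteq> h\<close> unitriangularD(1)[OF g] by auto
  then obtain s where s: "s < n * n" "ucoord n s y \<noteq> 0" "\<And>s'. s' < s \<Longrightarrow> ucoord n s' y = 0"
    using ucoord_leading[OF y(1)] by blast
  have "ucoord n s h = ucoord n s g + ucoord n s y" unfolding hgy by (rule ucoord_mult[OF g y(1) s(1,3)])
  moreover have "s \<in> jumps n D" using s y by (auto simp: jumps_def)
  ultimately show False using eq s(2) by simp
qed

lemma GL_assoc:
  assumes "a \<in> carrier (GL n)" "b \<in> carrier (GL n)" "c \<in> carrier (GL n)"
  shows "a * b * c = a * (b * c)"
  using assms by (intro assoc_mult_mat) (auto simp: carrier_GL)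

lemma GL_cancel:
  assumes "a \<in> carrier (GL n)" "b \<in> carrier (GL n)"
  shows "ginv n a * (a * b) = b" "a * (ginv n a * b) = b" "ginv n (a * b) = ginv n b * ginv n a"
proof -
  have b: "b \<in> carrier_mat n n" using assms by (auto simp: carrier_GL)
  note i = GL_inv_closed[OF assms(1)]
  show "ginv n a * (a * b) = b"
    using GL_assoc[OF i assms] GL_l_inv[OF assms(1)] b by simp
  show "a * (ginv n a * b) = b"
    using GL_assoc[OF assms(1) i assms(2)] GL_r_inv[OF assms(1)] b by simp
  show "ginv n (a * b) = ginv n b * ginv n a"
    using group.inv_mult_group[OF group_GL assms] by simp
qed

lemma GL_one_mult:
  assumes "a \<in> carrier (GL n)"
  shows "1\<^sub>m n * a = a" "a * 1\<^sub>m n = a" "ginv n (ginv n a) = a"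
  using GL_carrier_mat[OF assms] group.inv_inv[OF group_GL assms] by auto

lemma GL_inv_one: "ginv n (1\<^sub>m n :: 'a::field mat) = 1\<^sub>m n"
  by (rule GL_inv_eqI(3)) auto

lemmas GL_simps = GL_assoc GL_cancel GL_one_mult GL_inv_one GL_l_inv GL_r_inv GL_mult_closed GL_inv_closed

text \<open>Normal form of a left coset of \<open>D\<close>: Gaussian elimination of the coordinates in the jumps of \<open>D\<close>.\<close>

lemma exists_reduction:
  fixes D :: "'a::field_char_0 mat set"
  assumes sg: "subgroup D (GL n)" and cl: "zariski_closed n D" and D: "D \<subseteq> unitriangular n"
  obtains r where "regular_map n UNIV n r" "\<And>g. g \<in> unitriangular n \<Longrightarrow> ginv n g * r g \<in> D"
    "\<And>g s. g \<in> unitriangular n \<Longrightarrow> s \<in> jumps n D \<Longrightarrow> ucoord n s (r g) = 0"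
proof -
  \<comment> \<open>Only the jumps before \<open>S\<close> are cleared so far. The next correction
    is an element of \<open>D\<close> without coordinates before \<open>S\<close>, so it does not
    disturb them.\<close>
  have "\<exists>r. regular_map n UNIV n r \<and> (\<forall>g\<in>unitriangular n. ginv n g * r g \<in> D \<and>
      (\<forall>s\<in>jumps n D. s < S \<longrightarrow> ucoord n s (r g) = 0))" for S
  proof (induction S)
    case 0
    show ?case
      by (rule exI[of _ "\<lambda>u. u"])
         (auto simp: regular_map_id GL_l_inv unitriangular_GL subgroupD_GL(1)[OF sg])
  next
    case (Suc S)
    then obtain r where r: "regular_map n UNIV n r"
      and rD: "\<And>g. g \<in> unitriangular n \<Longrightarrow> ginv n g * r g \<in> D"
      and r0: "\<And>g s. g \<in> unitriangular n \<Longrightarrow> s \<in> jumps n D \<Longrightarrow> s < S \<Longrightarrow> ucoord n s (r g) = 0"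
      by blast
    show ?case
    proof (cases "S \<in> jumps n D")
      case False
      then show ?thesis using r rD r0 by (intro exI[of _ r]) (auto simp: less_Suc_eq)
    next
      case True
      then obtain u where S: "S < n * n" and u: "u \<in> D" "ucoord n S u \<noteq> 0" "\<And>s'. s' < S \<Longrightarrow> ucoord n s' u = 0"
        by (auto simp: jumps_def)
      have uU: "u \<in> unitriangular n" using u D by auto
      \<comment> \<open>The exponent for which \<open>u^t\<close> contributes the negative of the
        coordinate \<open>S\<close> of \<open>r g\<close>.\<close>
      define t where "t g = (- 1 / ucoord n S u) * ucoord n S (r g)" for g
      define r' where "r' g = r g * upow n u (t g)" for g
      have "t \<in> ureg n UNIV" unfolding t_def
        by (intro ureg_cmult[OF subfield_UNIV] ureg_comp[OF ucoord_ureg r] S subfield_UNIV) auto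
      then have r': "regular_map n UNIV n r'" unfolding r'_def
        by (intro regular_map_mult[OF subfield_UNIV r] regular_map_upow[OF subfield_UNIV] regular_map_const uU) auto
      show ?thesis
      proof (intro exI[of _ r'] conjI ballI impI r')
        fix g :: "'a mat" assume g: "g \<in> unitriangular n"
        have rg: "r g \<in> unitriangular n" by (rule regular_mapD(1)[OF r g])
        have p: "upow n u (t g) \<in> D" by (rule closed_subgroup_upow[OF sg cl D u(1)])
        then have pU: "upow n u (t g) \<in> unitriangular n" using D by auto
        have "ginv n g * r' g = ginv n g * r g * upow n u (t g)" unfolding r'_def
          using unitriangular_GL[OF g] unitriangular_GL[OF rg] unitriangular_GL[OF pU]
          by (simp add: GL_simps[where n = n])
        then show "ginv n g * r' g \<in> D" using subgroupD_GL(2)[OF sg rD[OF g] p] by simp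
        fix s assume s: "s \<in> jumps n D" "s < Suc S"
        have ps: "ucoord n s' (upow n u (t g)) = t g * ucoord n s' u" if "s' \<le> S" for s'
          by (rule ucoord_upow[OF uU]) (use that S u(3) in auto)
        have "ucoord n s (r' g) = ucoord n s (r g) + ucoord n s (upow n u (t g))" unfolding r'_def
          by (rule ucoord_mult[OF rg pU]) (use s S ps u(3) in auto)
        also have "\<dots> = 0"
        proof (cases "s = S")
          case True
          then show ?thesis using ps[of S] u(2) by (simp add: t_def)
        next
          case False
          then show ?thesis using ps[of s] u(3)[of s] s r0[OF g s(1)] by simp
        qed
        finally show "ucoord n s (r' g) = 0" .
      qed
    qed
  qed
  from this[of "n * n"] that show ?thesis by (auto simp: jumps_def)
qed

subsection \<open>Groups defined over \<open>k\<close> and density of \<open>k\<close>-points\<close>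

definition k_dense :: "nat \<Rightarrow> 'a set \<Rightarrow> 'a::field mat set \<Rightarrow> bool" where
  "k_dense n k D \<longleftrightarrow>
     (\<forall>f\<in>ureg n UNIV. (\<forall>g\<in>rat_points n k D. f g = 0) \<longrightarrow> (\<forall>g\<in>D. f g = 0))"

lemma rat_mult:
  assumes "is_subfield k" "u \<in> rat_points n k (unitriangular n)" "v \<in> rat_points n k (unitriangular n)"
  shows "u * v \<in> rat_points n k (unitriangular n)"
proof -
  have "regular_map n k n (\<lambda>v. u * v)"
    by (intro regular_map_mult assms regular_map_const regular_map_id) (use assms(2) in \<open>auto simp: rat_points_def\<close>)
  from regular_map_rational[OF assms(1) this assms(3)] show ?thesis .
qed

lemma rat_inv:
  assumes "is_subfield (k :: 'a::field_char_0 set)" "u \<in> rat_points n k (unitriangular n)"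
  shows "ginv n u \<in> rat_points n k (unitriangular n)"
  using regular_map_rational[OF assms(1) regular_map_inv[OF assms(1) regular_map_id] assms(2)] .

lemma rat_upow:
  assumes "is_subfield (k :: 'a::field_char_0 set)" "u \<in> rat_points n k (unitriangular n)" "t \<in> k"
  shows "upow n u t \<in> rat_points n k (unitriangular n)"
  using regular_map_rational[OF assms(1) regular_map_upow[OF assms(1) regular_map_id ureg_const[OF assms(3)]] assms(2)] .

text \<open>Both normal forms lie in the coset \<open>g D\<close> and vanish at the jumps, so
  \<open>coset_eqI\<close> identifies them.\<close>

lemma reduction_right_invariant:
  assumes sg: "subgroup D (GL n)" and D: "D \<subseteq> unitriangular n" and r: "regular_map n k n r"
    and rD: "\<And>g. g \<in> unitriangular n \<Longrightarrow> ginv n g * r g \<in> D"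
    and r0: "\<And>g s. g \<in> unitriangular n \<Longrightarrow> s \<in> jumps n D \<Longrightarrow> ucoord n s (r g) = 0"
    and g: "g \<in> unitriangular n" and d: "d \<in> D"
  shows "r (g * d) = r g"
proof (rule coset_eqI[OF D])
  note rU = regular_mapD(1)[OF r]
  have dU: "d \<in> unitriangular n" using d D by auto
  have gd: "g * d \<in> unitriangular n" by (rule unitriangular_mult[OF g dU])
  show "r (g * d) \<in> unitriangular n" "r g \<in> unitriangular n" using rU gd g by auto
  note G = unitriangular_GL[OF g] unitriangular_GL[OF dU] unitriangular_GL[OF rU[OF gd]] unitriangular_GL[OF rU[OF g]]
  have "ginv n (ginv n (g * d) * r (g * d)) * (ginv n d * (ginv n g * r g)) \<in> D"
    using rD[OF gd] rD[OF g] d subgroupD_GL[OF sg] by simp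
  also have "ginv n (ginv n (g * d) * r (g * d)) * (ginv n d * (ginv n g * r g)) = ginv n (r (g * d)) * r g"
    using G by (simp add: GL_simps[where n = n])
  finally show "ginv n (r (g * d)) * r g \<in> D" .
  show "ucoord n s (r (g * d)) = ucoord n s (r g)" if "s \<in> jumps n D" for s
    using r0[OF gd that] r0[OF g that] by simp
qed

text \<open>Suppose that an entry of \<open>r g0\<close> is outside \<open>k\<close>, and let
  \<open>l\<close> kill \<open>k\<close> and be 1 on this entry. Let \<open>a\<close> be the entry
  as a function of \<open>g\<close>, and \<open>a'\<close> its image under \<open>l\<close>. On
  rational normal forms \<open>r\<close> is the identity, so \<open>a'\<close> vanishes there, hence
  on all normal forms, in particular at \<open>r g0\<close>. But \<open>a\<close> is constant on
  cosets of \<open>D\<close>, and since \<open>D\<close> is defined over \<open>k\<close> the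
  function \<open>a'\<close> is constant on \<open>g0 D\<close>, so \<open>a' g0 = 0\<close>,
  against \<open>a' g0 = 1\<close>.\<close>

lemma reduction_rational:
  fixes k :: "'a::field_char_0 set"
  assumes k: "is_subfield k" and sg: "subgroup D (GL n)" and D: "D \<subseteq> unitriangular n"
    and def: "defined_over n k D" and r: "regular_map n UNIV n r"
    and rD: "\<And>g. g \<in> unitriangular n \<Longrightarrow> ginv n g * r g \<in> D"
    and r0: "\<And>g s. g \<in> unitriangular n \<Longrightarrow> s \<in> jumps n D \<Longrightarrow> ucoord n s (r g) = 0"
    and g0: "g0 \<in> rat_points n k (unitriangular n)"
  shows "r g0 \<in> rat_points n k (unitriangular n)"
proof -
  note rU = regular_mapD(1)[OF r]
  have g0U: "g0 \<in> unitriangular n" using g0 by (auto simp: rat_points_def)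
  \<comment> \<open>\<open>z\<close> parametrizes the normal forms over \<open>k\<close> by clearing
    the entries at jumps; composing with it allows the density of rational points of
    \<open>U_n\<close> to be used.\<close>
  define z where "z g = mat n n (\<lambda>(i, j). if i < j \<and> j * n + (n - 1 - i) \<in> jumps n D then 0 else g $$ (i, j))"
    for g :: "'a mat"
  have zU: "z g \<in> unitriangular n" if "g \<in> unitriangular n" for g
    by (rule unitriangularI) (use unitriangularD[OF that] in \<open>auto simp: z_def\<close>)
  have z: "regular_map n k n z" unfolding regular_map_def
  proof (intro conjI ballI allI impI zU)
    show "(\<lambda>u. z u $$ (i, j)) \<in> ureg n k" if "i < n" "j < n" for i j
      using that ureg_coord[of i n j k] ureg_const[OF subfield_zero[OF k], of n]
      by (cases "i < j \<and> j * n + (n - 1 - i) \<in> jumps n D") (auto simp: z_def)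
  qed
  have uxz: "ucoord n s (z g) = (if s \<in> jumps n D then 0 else ucoord n s g)" if s: "s < n * n" for s and g :: "'a mat"
  proof -
    define i j where "i = n - 1 - s mod n" and "j = s div n"
    have ij: "i < n" "j < n" using ucoord_bounds[OF s] by (auto simp: i_def j_def)
    have "n > 0" using s by (cases n) auto
    then have "s mod n = n - 1 - i" using mod_less_divisor[of n s] unfolding i_def by arith
    then have s_eq: "j * n + (n - 1 - i) = s" using div_mult_mod_eq[of s n] by (simp add: j_def)
    show ?thesis unfolding ucoord_def i_def[symmetric] j_def[symmetric] using ij s_eq by (simp add: z_def)
  qed
  have z_id: "z g = g" if "g \<in> unitriangular n" "\<And>s. s \<in> jumps n D \<Longrightarrow> ucoord n s g = 0" for g
    by (rule ucoord_eqI[OF zU[OF that(1)] that(1)]) (use uxz that(2) in auto)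
  have r_id: "r g = g" if g: "g \<in> unitriangular n" "\<And>s. s \<in> jumps n D \<Longrightarrow> ucoord n s g = 0" for g
    by (rule coset_eqI[OF D g(1) rU[OF g(1)] rD[OF g(1)], symmetric]) (simp add: g(2) r0[OF g(1)])
  have r_inv: "r (g * d) = r g" if "g \<in> unitriangular n" "d \<in> D" for g d
    by (rule reduction_right_invariant[OF sg D r rD r0 that])
  have "r g0 $$ (i, j) \<in> k" if ij: "i < n" "j < n" for i j
  proof (rule ccontr)
    assume nk: "r g0 $$ (i, j) \<notin> k"
    have "k_subspace k k" by (auto simp: k_subspace_def intro: subfield_closed[OF k])
    then obtain l where l: "functional k l" "l (r g0 $$ (i, j)) = 1" "\<And>x. x \<in> k \<Longrightarrow> l x = 0"
      using exists_functional[OF k _ nk] by blast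
    define a where "a g = r g $$ (i, j)" for g
    have a: "a \<in> ureg n UNIV" unfolding a_def by (rule regular_mapD(2)[OF r ij])
    obtain a' where a': "a' \<in> ureg n k" "\<And>u. u \<in> rat_points n k (unitriangular n) \<Longrightarrow> a' u = l (a u)"
      using ureg_functional[OF k a l(1)] by blast
    have "a' (z g) = 0" if g: "g \<in> unitriangular n" for g
    proof (rule ureg_vanish_rational[OF k _ _ g])
      show "(\<lambda>g. a' (z g)) \<in> ureg n UNIV"
        by (rule ureg_UNIV[OF ureg_comp[OF a'(1) z subfield_one[OF k]]])
      fix u assume u: "u \<in> rat_points n k (unitriangular n)"
      have zu: "z u \<in> rat_points n k (unitriangular n)" by (rule regular_map_rational[OF k z u])
      have "z u \<in> unitriangular n" using zu by (auto simp: rat_points_def)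
      then have "r (z u) = z u" by (rule r_id) (use uxz in \<open>auto simp: jumps_def\<close>)
      then have "a (z u) \<in> k" using zu ij by (auto simp: a_def rat_points_def)
      then show "a' (z u) = 0" using a'(2)[OF zu] l(3) by simp
    qed
    then have a'0: "a' (r g0) = 0" using z_id[OF rU[OF g0U]] r0[OF g0U] rU[OF g0U] by metis
    define d where "d = ginv n g0 * r g0"
    have d: "d \<in> D" unfolding d_def by (rule rD[OF g0U])
    have g0d: "g0 * d = r g0" unfolding d_def
      using unitriangular_GL[OF g0U] unitriangular_GL[OF rU[OF g0U]] by (simp add: GL_simps[where n = n])
    have tr: "regular_map n k n (\<lambda>g. g0 * g)"
      using g0 by (intro regular_map_mult[OF k] regular_map_const regular_map_id) (auto simp: rat_points_def)
    \<comment> \<open>The function \<open>a (g0 * g) - a g0\<close> vanishes for \<open>g\<close> in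
      \<open>D\<close>; applying \<open>l\<close> to it gives the function at hand, because
      \<open>a' g0\<close> is the value of \<open>l\<close> at \<open>a g0\<close>.\<close>
    have "a' (g0 * d) - a' g0 = 0"
    proof (rule vanishing_functional[OF k def D, where f = "\<lambda>g. a (g0 * g) - a g0" and f' = "\<lambda>g. a' (g0 * g) - a' g0"])
      show "(\<lambda>g. a (g0 * g) - a g0) \<in> ureg n UNIV"
        by (intro ureg_diff[OF subfield_UNIV] ureg_const ureg_comp[OF a regular_map_UNIV[OF tr]]) auto
      show "a (g0 * g) - a g0 = 0" if "g \<in> D" for g using r_inv[OF g0U that] by (simp add: a_def)
      have a'g0: "a' g0 \<in> k" by (rule ureg_rational_point[OF k a'(1) g0])
      show "(\<lambda>g. a' (g0 * g) - a' g0) \<in> ureg n k"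
        by (intro ureg_diff[OF k] ureg_const ureg_comp[OF a'(1) tr] subfield_one[OF k] a'g0)
      fix u assume u: "u \<in> rat_points n k (unitriangular n)"
      have "l x = l (x - y) + l y" for x y using l(1) unfolding functional_def by (metis diff_add_cancel)
      then have "l (a (g0 * u) - a g0) = l (a (g0 * u)) - l (a g0)" by (simp add: eq_diff_eq)
      then show "a' (g0 * u) - a' g0 = l (a (g0 * u) - a g0)"
        using a'(2)[OF rat_mult[OF k g0 u]] a'(2)[OF g0] by simp
    qed (use l d in auto)
    then have "a' g0 = 0" using a'0 g0d by simp
    moreover have "a' g0 = 1" using a'(2)[OF g0] l(2) by (simp add: a_def)
    ultimately show False by simp
  qed
  then show ?thesis using rU[OF g0U] unitriangular_GL by (auto simp: rat_points_def)
qed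

text \<open>The map \<open>q g = (r g)^-1 g\<close> is a retraction of \<open>U_n\<close> onto
  \<open>D\<close> that takes rational points to rational points. So density in \<open>D\<close>
  follows from density in \<open>U_n\<close>.\<close>

lemma defined_over_dense:
  fixes k :: "'a::field_char_0 set"
  assumes k: "is_subfield k" and sg: "subgroup D (GL n)" and D: "D \<subseteq> unitriangular n"
    and def: "defined_over n k D"
  shows "k_dense n k D"
  unfolding k_dense_def
proof (intro ballI impI)
  fix f g assume f: "f \<in> ureg n UNIV" and f0: "\<forall>g\<in>rat_points n k D. f g = 0" and g: "g \<in> D"
  have cl: "zariski_closed n D" using def by (simp add: defined_over_def)
  obtain r where r: "regular_map n UNIV n r" and rD: "\<And>g. g \<in> unitriangular n \<Longrightarrow> ginv n g * r g \<in> D"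
    and r0: "\<And>g s. g \<in> unitriangular n \<Longrightarrow> s \<in> jumps n D \<Longrightarrow> ucoord n s (r g) = 0"
    using exists_reduction[OF sg cl D] by blast
  note rU = regular_mapD(1)[OF r]
  define q where "q g = ginv n (r g) * g" for g
  have q: "regular_map n UNIV n q" unfolding q_def
    by (intro regular_map_mult[OF subfield_UNIV] regular_map_inv[OF subfield_UNIV] r regular_map_id)
  have qD: "q u \<in> D" if u: "u \<in> unitriangular n" for u
  proof -
    have "q u = ginv n (ginv n u * r u)" unfolding q_def
      using unitriangular_GL[OF u] unitriangular_GL[OF rU[OF u]] by (simp add: GL_simps[where n = n])
    then show ?thesis using subgroupD_GL(3)[OF sg rD[OF u]] by simp
  qed
  have gU: "g \<in> unitriangular n" using g D by auto
  have "f (q g) = 0"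
  proof (rule ureg_vanish_rational[OF k _ _ gU])
    show "(\<lambda>u. f (q u)) \<in> ureg n UNIV" by (rule ureg_comp[OF f q]) simp
    fix u assume u: "u \<in> rat_points n k (unitriangular n)"
    then have uU: "u \<in> unitriangular n" by (auto simp: rat_points_def)
    have "r u \<in> rat_points n k (unitriangular n)" by (rule reduction_rational[OF k sg D def r rD r0 u])
    then have "q u \<in> rat_points n k (unitriangular n)" unfolding q_def
      by (intro rat_mult[OF k] rat_inv[OF k] u)
    then have "q u \<in> rat_points n k D" using qD[OF uU] rat_points_unitriangular[OF D] by blast
    then show "f (q u) = 0" using f0 by blast
  qed
  moreover have "r g = 1\<^sub>m n"
  proof (rule coset_eqI[OF D rU[OF gU] unitriangular_one])
    have "r g = g * (ginv n g * r g)"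
      using unitriangular_GL[OF gU] unitriangular_GL[OF rU[OF gU]] by (simp add: GL_simps[where n = n])
    then have "r g \<in> D" using subgroupD_GL(2)[OF sg g rD[OF gU]] by simp
    then show "ginv n (r g) * 1\<^sub>m n \<in> D"
      using subgroupD_GL(3)[OF sg] subgroupD_GL(2)[OF sg _ subgroupD_GL(1)[OF sg]] by blast
    show "ucoord n s (r g) = ucoord n s (1\<^sub>m n)" if "s \<in> jumps n D" for s
      using r0[OF gU that] ucoord_one[of s n] that by (simp add: jumps_def)
  qed
  then have "q g = g" unfolding q_def using unitriangular_GL[OF gU]
    by (simp add: GL_simps[where n = n])
  ultimately show "f g = 0" by simp
qed

lemma reg_span_sum:
  "s \<in> reg_span n k \<Longrightarrow> \<exists>(M::nat) c h. (\<forall>i<M. h i \<in> regular_fun n k) \<and> (\<forall>g. s g = (\<Sum>i<M. c i * h i g))"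
proof (induction rule: reg_span.induct)
  case zero
  show ?case by (rule exI[of _ 0]) simp
next
  case (step h0 s c0)
  then obtain M :: nat and c h where h: "\<And>i. i < M \<Longrightarrow> h i \<in> regular_fun n k"
    and s: "\<And>g. s g = (\<Sum>i<M. c i * h i g)" by blast
  show ?case
  proof (intro exI conjI allI impI)
    show "(h(M := h0)) i \<in> regular_fun n k" if "i < Suc M" for i
      using that h step(1) by (auto simp: less_Suc_eq)
    show "c0 * h0 g + s g = (\<Sum>i<Suc M. (c(M := c0)) i * (h(M := h0)) i g)" for g
      by (simp add: s add.commute)
  qed
qed

text \<open>A combination of functions over \<open>k\<close> that vanishes on \<open>D(k)\<close> becomes shorter as long as one of
  the functions is nonzero at a point of \<open>D(k)\<close>, because the value at this point is a linear relation
  over \<open>k\<close> between the coefficients.\<close>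

lemma vanishing_combination:
  fixes k :: "'a::field_char_0 set"
  assumes k: "is_subfield k" and D: "D \<subseteq> unitriangular n" and dense: "k_dense n k D"
  shows "finite I \<Longrightarrow> (\<And>i. i \<in> I \<Longrightarrow> h i \<in> regular_fun n k) \<Longrightarrow>
     (\<And>g. g \<in> rat_points n k D \<Longrightarrow> (\<Sum>i\<in>I. c i * h i g) = 0) \<Longrightarrow>
     \<exists>a e. (\<forall>i\<in>I. a i \<in> regular_fun n UNIV \<and> e i \<in> vanishing_ideal n k D) \<and>
       (\<forall>g. (\<Sum>i\<in>I. c i * h i g) = (\<Sum>i\<in>I. a i g * e i g))"
proof (induction "card I" arbitrary: I h)
  case 0
  then show ?case by simp
next
  case (Suc m)
  show ?case
  proof (cases "\<forall>i\<in>I. \<forall>g\<in>rat_points n k D. h i g = 0")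
    case True
    have "h i \<in> vanishing_ideal n k D" if "i \<in> I" for i
      using dense True that Suc.prems(2)[OF that] ureg_UNIV[OF regular_fun_ureg]
      unfolding k_dense_def vanishing_ideal_def by blast
    then show ?thesis by (intro exI[of _ "\<lambda>i g. c i"] exI[of _ h]) (auto intro: regular_fun.const)
  next
    case False
    then obtain p g0 where p: "p \<in> I" and g0: "g0 \<in> rat_points n k D" and nz: "h p g0 \<noteq> 0" by blast
    have g0k: "h i g0 \<in> k" if "i \<in> I" for i
      using ureg_rational_point[OF k regular_fun_ureg[OF Suc.prems(2)[OF that]]] g0
        rat_points_unitriangular[OF D] by blast
    \<comment> \<open>With these numbers every \<open>h' i\<close> vanishes at \<open>g0\<close>,
      and the relation at \<open>g0\<close> reads \<open>c p = \<Sum> c i * q i\<close>; therefore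
      \<open>h p\<close> can be absorbed into the other functions without changing the sum.\<close>
    define q where "q i = - (h i g0 / h p g0)" for i
    have qk: "q i \<in> k" if "i \<in> I" for i
      unfolding q_def by (intro subfield_uminus[OF k] subfield_divide[OF k] g0k p that)
    define h' where "h' i = (\<lambda>g. h i g + q i * h p g)" for i
    have h': "h' i \<in> regular_fun n k" if "i \<in> I" for i unfolding h'_def
      by (intro regular_fun.add regular_fun.mult regular_fun.const qk Suc.prems(2) p that)
    have fin: "finite (I - {p})" using Suc.prems by simp
    have "c p * h p g0 + (\<Sum>i\<in>I - {p}. c i * h i g0) = 0"
      using Suc.prems(3)[OF g0] sum.remove[OF Suc.prems(1) p, of "\<lambda>i. c i * h i g0"] by simp
    then have "c p * h p g0 = - (\<Sum>i\<in>I - {p}. c i * h i g0)"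
      by (simp only: eq_neg_iff_add_eq_0)
    then have "c p = - (\<Sum>i\<in>I - {p}. c i * h i g0) / h p g0"
      using nz by (simp only: nonzero_eq_divide_eq not_False_eq_True)
    then have cp: "c p = (\<Sum>i\<in>I - {p}. c i * q i)"
      by (simp add: q_def sum_negf sum_divide_distrib)
    have eq: "(\<Sum>i\<in>I. c i * h i g) = (\<Sum>i\<in>I - {p}. c i * h' i g)" for g
    proof -
      have "(\<Sum>i\<in>I - {p}. c i * h' i g) = (\<Sum>i\<in>I - {p}. c i * h i g) + c p * h p g"
        unfolding cp h'_def by (simp add: algebra_simps sum.distrib sum_distrib_left)
      then show ?thesis using sum.remove[OF Suc.prems(1) p, of "\<lambda>i. c i * h i g"] by simp
    qed
    have "\<exists>a e. (\<forall>i\<in>I - {p}. a i \<in> regular_fun n UNIV \<and> e i \<in> vanishing_ideal n k D) \<and>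
       (\<forall>g. (\<Sum>i\<in>I - {p}. c i * h' i g) = (\<Sum>i\<in>I - {p}. a i g * e i g))"
    proof (rule Suc.hyps(1))
      show "m = card (I - {p})" using Suc.hyps(2) p Suc.prems(1) by simp
      show "(\<Sum>i\<in>I - {p}. c i * h' i g) = 0" if "g \<in> rat_points n k D" for g
        using Suc.prems(3)[OF that] eq by simp
    qed (use fin h' in auto)
    then obtain a e where ae: "\<And>i. i \<in> I - {p} \<Longrightarrow> a i \<in> regular_fun n UNIV \<and> e i \<in> vanishing_ideal n k D"
      "\<And>g. (\<Sum>i\<in>I - {p}. c i * h' i g) = (\<Sum>i\<in>I - {p}. a i g * e i g)" by blast
    \<comment> \<open>The index \<open>p\<close> has dropped out; it is filled with zero functions
      to return to the index set \<open>I\<close>.\<close>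
    define a' where "a' = a(p := \<lambda>g. 0)"
    define e' where "e' = e(p := \<lambda>g. 0)"
    show ?thesis
    proof (intro exI conjI ballI allI)
      fix i assume "i \<in> I"
      then show "a' i \<in> regular_fun n UNIV" "e' i \<in> vanishing_ideal n k D"
        using ae(1)[of i] subfield_zero[OF k]
        by (auto simp: a'_def e'_def vanishing_ideal_def intro: regular_fun.const)
    next
      show "(\<Sum>i\<in>I. c i * h i g) = (\<Sum>i\<in>I. a' i g * e' i g)" for g
        unfolding eq ae(2) sum.remove[OF Suc.prems(1) p, of "\<lambda>i. a' i g * e' i g"]
        by (simp add: a'_def e'_def)
    qed
  qed
qed

lemma dense_defined_over:
  fixes k :: "'a::field_char_0 set"
  assumes k: "is_subfield k" and D: "D \<subseteq> unitriangular n" and cl: "zariski_closed n D"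
    and dense: "k_dense n k D"
  shows "defined_over n k D"
  unfolding defined_over_def
proof (intro conjI ballI cl)
  fix f assume f: "f \<in> vanishing_ideal n UNIV D"
  then obtain M :: nat and c h where h: "\<And>i. i < M \<Longrightarrow> h i \<in> regular_fun n k"
    and f_eq: "\<And>g. f g = (\<Sum>i<M. c i * h i g)"
    using reg_span_sum[OF regular_fun_reg_span[OF k]] unfolding vanishing_ideal_def by blast
  have "\<exists>a e. (\<forall>i\<in>{..<M}. a i \<in> regular_fun n UNIV \<and> e i \<in> vanishing_ideal n k D) \<and>
       (\<forall>g. (\<Sum>i<M. c i * h i g) = (\<Sum>i<M. a i g * e i g))"
  proof (rule vanishing_combination[OF k D dense])
    show "(\<Sum>i<M. c i * h i g) = 0" if "g \<in> rat_points n k D" for g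
      using f that f_eq[of g] by (auto simp: vanishing_ideal_def rat_points_def)
  qed (use h in auto)
  then obtain a e where ae: "\<And>i. i < M \<Longrightarrow> a i \<in> regular_fun n UNIV \<and> e i \<in> vanishing_ideal n k D"
    "\<And>g. (\<Sum>i<M. c i * h i g) = (\<Sum>i<M. a i g * e i g)" by auto
  show "\<exists>(m::nat) a h. (\<forall>i<m. a i \<in> regular_fun n UNIV \<and> h i \<in> vanishing_ideal n k D) \<and>
      (\<forall>g\<in>carrier (GL n). f g = (\<Sum>i<m. a i g * h i g))"
    by (intro exI[of _ M] exI[of _ a] exI[of _ e]) (use ae f_eq in auto)
qed

lemma k_denseD:
  assumes "k_dense n k D" "f \<in> ureg n UNIV" "\<And>g. g \<in> rat_points n k D \<Longrightarrow> f g = 0" "g \<in> D"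
  shows "f g = 0"
  using assms unfolding k_dense_def by simp

text \<open>The working form of a \<open>k\<close>-subgroup of \<open>U_n\<close>: density takes the
  place of generators of the ideal, and \<open>k_group_iff\<close> shows that nothing is lost inside
  \<open>U_n\<close>.\<close>

definition k_group :: "nat \<Rightarrow> 'a set \<Rightarrow> 'a::field mat set \<Rightarrow> bool" where
  "k_group n k D \<longleftrightarrow> subgroup D (GL n) \<and> D \<subseteq> unitriangular n \<and> zariski_closed n D \<and> k_dense n k D"

lemma k_groupD:
  assumes "k_group n k D"
  shows "subgroup D (GL n)" "D \<subseteq> unitriangular n" "zariski_closed n D" "k_dense n k D"
    "u \<in> D \<Longrightarrow> u \<in> unitriangular n" "u \<in> D \<Longrightarrow> u \<in> carrier (GL n)"
  using assms unitriangular_GL by (auto simp: k_group_def)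

lemma k_group_iff:
  fixes k :: "'a::field_char_0 set"
  assumes k: "is_subfield k"
  shows "k_group n k D \<longleftrightarrow> unipotent_k_subgroup n k D \<and> D \<subseteq> unitriangular n"
  unfolding k_group_def unipotent_k_subgroup_def unipotent_alg_subgroup_def
  using dense_defined_over[OF k] defined_over_dense[OF k] unitriangular_unipotent by blast

lemma closed_subset:
  assumes D: "zariski_closed n D" "D \<subseteq> unitriangular n" and f: "f \<in> ureg n UNIV"
  shows "zariski_closed n {g \<in> D. f g = 0}"
proof -
  obtain S where S: "S \<subseteq> regular_fun n UNIV" "D = {g \<in> carrier (GL n). \<forall>f\<in>S. f g = 0}"
    using D by (auto simp: zariski_closed_def)
  obtain h where h: "h \<in> regular_fun n UNIV" "\<And>u. u \<in> unitriangular n \<Longrightarrow> f u = h u"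
    using f by (rule uregE) blast
  have "{g \<in> D. f g = 0} = {g \<in> D. h g = 0}" using h(2) D(2) by (metis (lifting) subsetD)
  also have "\<dots> = {g \<in> carrier (GL n). \<forall>f\<in>insert h S. f g = 0}" using S(2) by auto
  finally show ?thesis unfolding zariski_closed_def
    using h(1) S(1) by (intro exI[of _ "insert h S"]) auto
qed

lemma closed_unitriangular: "zariski_closed n (unitriangular n :: 'a::field_char_0 mat set)"
proof -
  \<comment> \<open>The equations are written with \<open>+ (- 1)\<close> to match the addition rule
    of \<open>regular_fun\<close>.\<close>
  define S :: "('a mat \<Rightarrow> 'a) set" where
    "S = {(\<lambda>g. g $$ (i, i) + (- 1)) | i. i < n} \<union> {(\<lambda>g. g $$ (i, j)) | i j. j < i \<and> i < n}"
  have "(\<lambda>g. g $$ (i, i) + (- 1)) \<in> regular_fun n (UNIV :: 'a set)" if "i < n" for i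
    by (intro regular_fun.intros that UNIV_I)
  then have "S \<subseteq> regular_fun n UNIV"
    unfolding S_def by (auto simp del: add_uminus_conv_diff intro: regular_fun.coord)
  moreover have "unitriangular n = {g \<in> carrier (GL n). \<forall>f\<in>S. f g = 0}"
  proof (intro Set.set_eqI iffI)
    fix g :: "'a mat" assume g: "g \<in> unitriangular n"
    then show "g \<in> {g \<in> carrier (GL n). \<forall>f\<in>S. f g = 0}"
      using unitriangularD[OF g] unitriangular_GL[OF g] by (auto simp: S_def)
  next
    fix g :: "'a mat" assume g: "g \<in> {g \<in> carrier (GL n). \<forall>f\<in>S. f g = 0}"
    show "g \<in> unitriangular n"
    proof (rule unitriangularI)
      show "g \<in> carrier_mat n n" using g GL_carrier_mat by auto
      show "g $$ (i, i) = 1" if "i < n" for i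
      proof -
        have "(\<lambda>g. g $$ (i, i) + (- 1)) \<in> S" unfolding S_def using that by blast
        moreover have "\<forall>f\<in>S. f g = 0" using g by simp
        ultimately have "g $$ (i, i) + (- 1) = 0" by (rule bspec[rotated])
        then show ?thesis by simp
      qed
      show "g $$ (i, j) = 0" if "j < i" "i < n" for i j
      proof -
        have "(\<lambda>g. g $$ (i, j)) \<in> S" unfolding S_def using that by blast
        moreover have "\<forall>f\<in>S. f g = 0" using g by simp
        ultimately show ?thesis by (rule bspec[rotated])
      qed
    qed
  qed
  ultimately show ?thesis unfolding zariski_closed_def by (intro exI[of _ S] conjI)
qed

lemma closed_preimage:
  fixes D :: "'a::field_char_0 mat set"
  assumes D: "zariski_closed m D" and \<phi>: "regular_map n UNIV m \<phi>"
  shows "zariski_closed n {g \<in> unitriangular n. \<phi> g \<in> D}"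
proof -
  obtain S where S: "S \<subseteq> regular_fun m UNIV" "D = {g \<in> carrier (GL m). \<forall>f\<in>S. f g = 0}"
    using D by (auto simp: zariski_closed_def)
  obtain T :: "('a mat \<Rightarrow> 'a) set" where T: "T \<subseteq> regular_fun n UNIV" "unitriangular n = {g \<in> carrier (GL n). \<forall>f\<in>T. f g = 0}"
    using closed_unitriangular[of n, where 'a = 'a] unfolding zariski_closed_def by blast
  \<comment> \<open>The pulled back equations are regular functions only up to equality on
    \<open>U_n\<close>; they cut out the right set together with the equations \<open>T\<close> of
    \<open>U_n\<close>.\<close>
  define R where "R = {h \<in> regular_fun n UNIV. \<exists>f\<in>S. \<forall>u\<in>unitriangular n. h u = f (\<phi> u)}"
  have "{g \<in> unitriangular n. \<phi> g \<in> D} = {g \<in> carrier (GL n). \<forall>f\<in>T \<union> R. f g = 0}"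
  proof (intro Set.set_eqI iffI)
    fix g assume g: "g \<in> {g \<in> unitriangular n. \<phi> g \<in> D}"
    then show "g \<in> {g \<in> carrier (GL n). \<forall>f\<in>T \<union> R. f g = 0}"
      using S(2) T(2) by (auto simp: R_def)
  next
    fix g assume g: "g \<in> {g \<in> carrier (GL n). \<forall>f\<in>T \<union> R. f g = 0}"
    then have gU: "g \<in> unitriangular n" using T(2) by blast
    have "f (\<phi> g) = 0" if f: "f \<in> S" for f
    proof -
      have "(\<lambda>u. f (\<phi> u)) \<in> ureg n UNIV"
        by (rule ureg_comp[OF regular_fun_ureg \<phi>]) (use f S(1) in auto)
      then obtain h where h: "h \<in> regular_fun n UNIV" "\<And>u. u \<in> unitriangular n \<Longrightarrow> f (\<phi> u) = h u"
        by (rule uregE) blast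
      have "\<forall>u\<in>unitriangular n. h u = f (\<phi> u)" using h(2) by simp
      then have "h \<in> R" using f h(1) unfolding R_def by blast
      then show ?thesis using g h(2)[OF gU] by auto
    qed
    then show "g \<in> {g \<in> unitriangular n. \<phi> g \<in> D}"
      using gU S(2) unitriangular_GL[OF regular_mapD(1)[OF \<phi> gU]] by auto
  qed
  moreover have "T \<union> R \<subseteq> regular_fun n UNIV" using T by (auto simp: R_def)
  ultimately show ?thesis unfolding zariski_closed_def by blast
qed

subsection \<open>Kernels and extensions by one-parameter subgroups\<close>

text \<open>Additivity gives the formula for natural \<open>t\<close>, and both sides are
  polynomials in \<open>t\<close>. This is where additive functions become linear over the whole
  field.\<close>

lemma additive_upow:
  fixes D :: "'a::field_char_0 mat set"
  assumes sg: "subgroup D (GL n)" and cl: "zariski_closed n D" and D: "D \<subseteq> unitriangular n"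
    and \<phi>: "\<phi> \<in> ureg n k" and add: "\<And>u v. u \<in> D \<Longrightarrow> v \<in> D \<Longrightarrow> \<phi> (u * v) = \<phi> u + \<phi> v" and u: "u \<in> D"
  shows "\<phi> (upow n u t) = t * \<phi> u"
proof (rule polyfun_eq_nat[where g = "\<lambda>t. t * \<phi> u"])
  have uU: "u \<in> unitriangular n" using u D by auto
  show "polyfun (\<lambda>t. \<phi> (upow n u t))" by (rule curve_ureg[OF curve_upow[OF uU] \<phi>])
  show "polyfun (\<lambda>t. t * \<phi> u)" by (intro polyfun_mult polyfun_id polyfun_const)
  have "u ^\<^sub>m a \<in> D \<and> \<phi> (u ^\<^sub>m a) = of_nat a * \<phi> u" for a
  proof (induction a)
    case 0
    have "\<phi> (1\<^sub>m n) = 0" using add[OF subgroupD_GL(1)[OF sg] subgroupD_GL(1)[OF sg]] by simp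
    then show ?case using subgroupD_GL(1)[OF sg] unitriangularD(4)[OF uU] by simp
  next
    case (Suc a)
    then show ?case using add[of "u ^\<^sub>m a" u] subgroupD_GL(2)[OF sg, of "u ^\<^sub>m a" u] u
      by (simp add: algebra_simps)
  qed
  then show "\<phi> (upow n u (of_nat a)) = of_nat a * \<phi> u" for a by (simp add: upow_of_nat[OF uU])
qed

lemma additive_one_inv:
  fixes \<phi> :: "'a::field mat \<Rightarrow> 'a"
  assumes sg: "subgroup D (GL n)" and add: "\<And>u v. u \<in> D \<Longrightarrow> v \<in> D \<Longrightarrow> \<phi> (u * v) = \<phi> u + \<phi> v"
  shows "\<phi> (1\<^sub>m n) = 0" "u \<in> D \<Longrightarrow> \<phi> (ginv n u) = - \<phi> u"
proof -
  have "\<phi> (1\<^sub>m n) = \<phi> (1\<^sub>m n) + \<phi> (1\<^sub>m n)"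
    using add[OF subgroupD_GL(1)[OF sg] subgroupD_GL(1)[OF sg]] by (simp only: left_mult_one_mat[OF one_carrier_mat])
  then show 0: "\<phi> (1\<^sub>m n) = 0" by (simp only: add_cancel_right_right)
  show "\<phi> (ginv n u) = - \<phi> u" if "u \<in> D"
    using add[OF subgroupD_GL(3)[OF sg that] that] GL_l_inv[OF subgroupD_GL(4)[OF sg that]] 0
    by (simp add: eq_neg_iff_add_eq_0)
qed

text \<open>By density a nonzero \<open>\<phi>\<close> is nonzero at some rational \<open>u\<close>;
  the power of \<open>u\<close> with exponent \<open>1 / \<phi> u\<close> in \<open>k\<close>
  normalizes the value.\<close>

lemma rational_unit:
  fixes k :: "'a::field_char_0 set"
  assumes k: "is_subfield k" and D: "k_group n k D" and \<phi>: "\<phi> \<in> ureg n k"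
    and add: "\<And>u v. u \<in> D \<Longrightarrow> v \<in> D \<Longrightarrow> \<phi> (u * v) = \<phi> u + \<phi> v"
    and nz: "v \<in> D" "\<phi> v \<noteq> 0"
  obtains u where "u \<in> rat_points n k D" "\<phi> u = 1"
proof -
  note K = k_groupD[OF D]
  obtain u where u: "u \<in> rat_points n k D" "\<phi> u \<noteq> 0"
    using K(4) ureg_UNIV[OF \<phi>] nz unfolding k_dense_def by blast
  then have uD: "u \<in> D" "u \<in> rat_points n k (unitriangular n)"
    using rat_points_unitriangular[OF K(2)] by blast+
  have "\<phi> u \<in> k" by (rule ureg_rational_point[OF k \<phi> uD(2)])
  then have "upow n u (inverse (\<phi> u)) \<in> rat_points n k (unitriangular n)"
    by (intro rat_upow[OF k uD(2)] subfield_inverse[OF k])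
  then have "upow n u (inverse (\<phi> u)) \<in> rat_points n k D"
    using closed_subgroup_upow[OF K(1,3,2) uD(1)] rat_points_unitriangular[OF K(2)] by blast
  moreover have "\<phi> (upow n u (inverse (\<phi> u))) = 1"
    using additive_upow[OF K(1,3,2) \<phi> add uD(1)] u(2) by simp
  ultimately show ?thesis by (rule that)
qed

text \<open>With a rational \<open>u\<close> of value 1, \<open>g \<mapsto> g u^(- \<phi> g)\<close>
  is a retraction of \<open>D\<close> onto the kernel over \<open>k\<close>, so the rational points
  of the kernel inherit density from those of \<open>D\<close>.\<close>

lemma k_group_kernel:
  fixes k :: "'a::field_char_0 set"
  assumes k: "is_subfield k" and D: "k_group n k D" and \<phi>: "\<phi> \<in> ureg n k"
    and add: "\<And>u v. u \<in> D \<Longrightarrow> v \<in> D \<Longrightarrow> \<phi> (u * v) = \<phi> u + \<phi> v"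
  shows "k_group n k {u \<in> D. \<phi> u = 0}"
proof (cases "\<forall>u\<in>D. \<phi> u = 0")
  case True
  then have "{u \<in> D. \<phi> u = 0} = D" by auto
  then show ?thesis using D by simp
next
  case False
  note K = k_groupD[OF D]
  note one_inv = additive_one_inv[OF K(1) add]
  obtain u where u: "u \<in> rat_points n k D" "\<phi> u = 1"
    using False rational_unit[OF k D \<phi> add] by blast
  then have uD: "u \<in> D" and uU: "u \<in> rat_points n k (unitriangular n)"
    using rat_points_unitriangular[OF K(2)] by blast+
  define q where "q g = g * upow n u (- \<phi> g)" for g
  have q: "regular_map n k n q" unfolding q_def
    by (intro regular_map_mult[OF k] regular_map_id regular_map_upow[OF k] regular_map_const ureg_uminus[OF k] \<phi>)
       (use uU in \<open>auto simp: rat_points_def\<close>)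
  have qD: "q g \<in> D" "\<phi> (q g) = 0" if "g \<in> D" for g
  proof -
    have p: "upow n u (- \<phi> g) \<in> D" by (rule closed_subgroup_upow[OF K(1,3,2) uD])
    show "q g \<in> D" unfolding q_def by (rule subgroupD_GL(2)[OF K(1) that p])
    show "\<phi> (q g) = 0" unfolding q_def
      using add[OF that p] additive_upow[OF K(1,3,2) \<phi> add uD, of "- \<phi> g"] u(2) by simp
  qed
  have "subgroup {u \<in> D. \<phi> u = 0} (GL n)"
    by (rule subgroupI_GL) (use subgroupD_GL[OF K(1)] add one_inv in auto)
  moreover have "k_dense n k {u \<in> D. \<phi> u = 0}" unfolding k_dense_def
  proof (intro ballI impI)
    fix f g assume f: "f \<in> ureg n UNIV" "\<forall>g\<in>rat_points n k {u \<in> D. \<phi> u = 0}. f g = 0"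
      and g: "g \<in> {u \<in> D. \<phi> u = 0}"
    have fq: "(\<lambda>g. f (q g)) \<in> ureg n UNIV" by (rule ureg_comp[OF f(1) regular_map_UNIV[OF q]]) simp
    have q0: "f (q g) = 0" if "g \<in> rat_points n k D" for g
    proof -
      have g: "g \<in> D" "g \<in> rat_points n k (unitriangular n)" using that rat_points_unitriangular[OF K(2)] by blast+
      have "q g \<in> rat_points n k (unitriangular n)" by (rule regular_map_rational[OF k q g(2)])
      moreover have "q g \<in> {u \<in> D. \<phi> u = 0}" using qD[OF g(1)] by simp
      ultimately have "q g \<in> rat_points n k {u \<in> D. \<phi> u = 0}"
        by (simp only: rat_points_def mem_Collect_eq Int_iff) simp
      then show ?thesis by (rule bspec[OF f(2)])
    qed
    have gD: "g \<in> D" using g by simp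
    have "f (q g) = 0" by (rule k_denseD[OF K(4) fq q0 gD])
    moreover have "q g = g"
    proof -
      have "g \<in> D" using g by simp
      then have "g \<in> carrier_mat n n" by (rule unitriangularD(1)[OF K(5)])
      moreover have "q g = g * upow n u 0" using g by (simp add: q_def)
      ultimately show ?thesis using upow_zero[OF K(5)[OF uD]] by simp
    qed
    ultimately show "f g = 0" by simp
  qed
  ultimately show ?thesis
    using closed_subset[OF K(3,2) ureg_UNIV[OF \<phi>]] K(2) by (auto simp: k_group_def)
qed

definition adjoin :: "nat \<Rightarrow> 'a::field_char_0 mat set \<Rightarrow> 'a mat \<Rightarrow> 'a mat set" where
  "adjoin n D w = {d * upow n w t | d t. d \<in> D}"

lemma adjoin_mult:
  assumes "w \<in> unitriangular n" "d \<in> carrier (GL n)" "d' \<in> carrier (GL n)"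
  shows "(d * upow n w s) * (d' * upow n w t) =
    (d * (upow n w s * d' * ginv n (upow n w s))) * upow n w (s + t)"
  using assms(2,3) unitriangular_GL[OF upow_unitriangular[OF assms(1)]]
  by (simp add: upow_add[OF assms(1)] GL_simps[where n = n])

lemma adjoin_inv:
  assumes "w \<in> unitriangular n" "d \<in> carrier (GL n)"
  shows "ginv n (d * upow n w s) =
    (upow n w (- s) * ginv n d * ginv n (upow n w (- s))) * upow n w (- s)"
  using assms(2) unitriangular_GL[OF upow_unitriangular[OF assms(1)]]
  by (simp add: upow_uminus[OF assms(1)] GL_simps[where n = n])

text \<open>The exponent is read off from a normal form. Since \<open>w^t\<close> normalizes
  \<open>D\<close>, the elements \<open>d w^t\<close>, \<open>w^t\<close> and \<open>w'^t\<close>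
  have the same normal form modulo \<open>D\<close>, where \<open>w' = r w\<close>; at the leading
  position of \<open>w'\<close> its coordinate is proportional to \<open>t\<close>.\<close>

lemma adjoin_parameter:
  fixes k :: "'a::field_char_0 set"
  assumes k: "is_subfield k" and D: "k_group n k D" and w: "w \<in> rat_points n k (unitriangular n)" "w \<notin> D"
    and norm: "\<And>t d. d \<in> D \<Longrightarrow> upow n w t * d * ginv n (upow n w t) \<in> D"
  obtains \<tau> where "\<tau> \<in> ureg n k" "\<And>d t. d \<in> D \<Longrightarrow> \<tau> (d * upow n w t) = t"
proof -
  note K = k_groupD[OF D]
  have def: "defined_over n k D" by (rule dense_defined_over[OF k K(2-4)])
  have wU: "w \<in> unitriangular n" using w by (auto simp: rat_points_def)
  obtain r where r: "regular_map n UNIV n r" and rD: "\<And>g. g \<in> unitriangular n \<Longrightarrow> ginv n g * r g \<in> D"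
    and r0: "\<And>g s. g \<in> unitriangular n \<Longrightarrow> s \<in> jumps n D \<Longrightarrow> ucoord n s (r g) = 0"
    using exists_reduction[OF K(1,3,2)] by blast
  note rU = regular_mapD(1)[OF r]
  have rinv: "r (g * d) = r g" if "g \<in> unitriangular n" "d \<in> D" for g d
    by (rule reduction_right_invariant[OF K(1,2) r rD r0 that])
  define w' where "w' = r w"
  have w'U: "w' \<in> unitriangular n" unfolding w'_def by (rule rU[OF wU])
  have w'k: "w' \<in> rat_points n k (unitriangular n)" unfolding w'_def
    by (rule reduction_rational[OF k K(1,2) def r rD r0 w(1)])
  note G = unitriangular_GL[OF wU] unitriangular_GL[OF w'U]
    unitriangular_GL[OF upow_unitriangular[OF wU]] unitriangular_GL[OF upow_unitriangular[OF w'U]]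
  have "w' \<noteq> 1\<^sub>m n"
  proof
    assume "w' = 1\<^sub>m n"
    then have "ginv n w \<in> D" using rD[OF wU] G by (simp add: w'_def GL_simps[where n = n])
    then have "ginv n (ginv n w) \<in> D" by (rule subgroupD_GL(3)[OF K(1)])
    then show False using w(2) G by (simp add: GL_simps[where n = n])
  qed
  then obtain p where p: "p < n * n" "ucoord n p w' \<noteq> 0" "\<And>s'. s' < p \<Longrightarrow> ucoord n s' w' = 0"
    using ucoord_leading[OF w'U] by blast
  have pJ: "p \<notin> jumps n D" using r0[OF wU, of p] p(2) by (auto simp: w'_def)
  \<comment> \<open>Dividing by the coordinate of \<open>w'\<close> makes the parameter of
    \<open>w\<close> equal to 1. It descends to \<open>k\<close> because \<open>r\<close> preserves
    rational points.\<close>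
  define \<tau> where "\<tau> g = inverse (ucoord n p w') * ucoord n p (r g)" for g
  have \<tau>: "\<tau> \<in> ureg n k"
  proof (rule ureg_descend[OF k])
    show "\<tau> \<in> ureg n UNIV" unfolding \<tau>_def
      by (intro ureg_cmult[OF subfield_UNIV] ureg_comp[OF ucoord_ureg r] p subfield_UNIV) auto
    show "\<tau> u \<in> k" if u: "u \<in> rat_points n k (unitriangular n)" for u
      unfolding \<tau>_def
      by (intro subfield_mult[OF k] subfield_inverse[OF k] ureg_rational_point[OF k ucoord_ureg[OF p(1) k]] w'k
          reduction_rational[OF k K(1,2) def r rD r0 u])
  qed
  \<comment> \<open>For natural \<open>t\<close> this is an induction using that powers of
    \<open>w\<close> normalize \<open>D\<close>; closedness of \<open>D\<close> gives the
    rest.\<close>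
  have coset: "ginv n (upow n w t) * upow n w' t \<in> D" for t
  proof (rule curve_in_closed[OF _ K(3), where c = "\<lambda>t. ginv n (upow n w t) * upow n w' t"])
    show "curve n (\<lambda>t. ginv n (upow n w t) * upow n w' t)"
      by (intro curve_mult curve_upow w'U
          curve_regular_map[OF regular_map_inv[OF subfield_UNIV regular_map_id] curve_upow[OF wU]])
    show "ginv n (upow n w (of_nat a)) * upow n w' (of_nat a) \<in> D" for a
    proof (induction a)
      case 0
      show ?case using upow_zero[OF wU] upow_zero[OF w'U] subgroupD_GL(1)[OF K(1)]
        by (simp add: GL_simps[where n = n])
    next
      case (Suc a)
      define x where "x = ginv n (upow n w (of_nat a)) * upow n w' (of_nat a)"
      have x: "x \<in> D" unfolding x_def by (rule Suc)
      have "upow n w (- 1) * x * ginv n (upow n w (- 1)) * (ginv n w * w') \<in> D"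
        using subgroupD_GL(2)[OF K(1) norm[OF x, of "- 1"] rD[OF wU]] by (simp add: w'_def)
      also have "upow n w (- 1) * x * ginv n (upow n w (- 1)) * (ginv n w * w') =
         ginv n (upow n w (of_nat (Suc a))) * upow n w' (of_nat (Suc a))"
      proof -
        define A where "A = upow n w (of_nat a)"
        define B where "B = upow n w' (of_nat a)"
        have AB: "A \<in> carrier (GL n)" "B \<in> carrier (GL n)" unfolding A_def B_def using G by auto
        have 1: "upow n w (- 1) = ginv n w" using upow_uminus[OF wU, of 1] upow_one[OF wU] by simp
        have 2: "upow n w (of_nat (Suc a)) = A * w" "upow n w' (of_nat (Suc a)) = B * w'"
          unfolding A_def B_def
          using upow_add[OF wU, of "of_nat a" 1] upow_add[OF w'U, of "of_nat a" 1] upow_one[OF wU] upow_one[OF w'U]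
          by (simp_all add: add.commute)
        show ?thesis unfolding x_def 1 2 A_def[symmetric] B_def[symmetric]
          using G(1,2) AB by (simp add: GL_simps[where n = n])
      qed
      finally show ?case .
    qed
  qed
  have "\<tau> (d * upow n w t) = t" if d: "d \<in> D" for d t
  proof -
    define W where "W = upow n w t"
    define W' where "W' = upow n w' t"
    have WU: "W \<in> unitriangular n" "W' \<in> unitriangular n"
      unfolding W_def W'_def by (intro upow_unitriangular wU w'U)+
    note G' = unitriangular_GL[OF WU(1)] unitriangular_GL[OF WU(2)] K(6)[OF d]
    have "ginv n W * d * W \<in> D"
      using norm[OF d, of "- t"] G' by (simp add: upow_uminus[OF wU] W_def[symmetric] GL_simps[where n = n])
    then have "r (W * (ginv n W * d * W)) = r W" by (rule rinv[OF WU(1)])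
    also have "W * (ginv n W * d * W) = d * W" using G' by (simp add: GL_simps[where n = n])
    finally have 1: "r (d * W) = r W" .
    have "r (W * (ginv n W * W')) = r W"
      by (rule rinv[OF WU(1)]) (use coset in \<open>simp add: W_def W'_def\<close>)
    then have 2: "r W' = r W" using G' by (simp add: GL_simps[where n = n])
    define y where "y = r W'"
    define e where "e = ginv n W' * y"
    have yU: "y \<in> unitriangular n" unfolding y_def by (rule rU[OF WU(2)])
    have eD: "e \<in> D" unfolding e_def y_def by (rule rD[OF WU(2)])
    have eU: "e \<in> unitriangular n" by (rule K(5)[OF eD])
    have ye: "y = W' * e" unfolding e_def using G' unitriangular_GL[OF yU] by (simp add: GL_simps[where n = n])
    have uxW: "ucoord n s W' = t * ucoord n s w'" if "s \<le> p" for s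
      unfolding W'_def by (rule ucoord_upow[OF w'U]) (use that p in auto)
    \<comment> \<open>Reducing \<open>W'\<close> to \<open>y\<close> multiplies it by
      \<open>e\<close>. If \<open>e \<noteq> 1\<close>, its leading position \<open>q\<close> is a
      jump where \<open>y\<close> vanishes, so \<open>W'\<close> does not vanish there and
      \<open>q \<ge> p\<close>; as \<open>p\<close> is no jump, \<open>q > p\<close>, and the
      coordinate \<open>p\<close> is unaffected.\<close>
    have "ucoord n p y = t * ucoord n p w'"
    proof (cases "e = 1\<^sub>m n")
      case True
      then show ?thesis using ye uxW[of p] unitriangularD(1)[OF WU(2)] by simp
    next
      case False
      then obtain q where q: "q < n * n" "ucoord n q e \<noteq> 0" "\<And>s'. s' < q \<Longrightarrow> ucoord n s' e = 0"
        using ucoord_leading[OF eU] by blast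
      then have qJ: "q \<in> jumps n D" using eD by (auto simp: jumps_def)
      have "ucoord n q y = ucoord n q W' + ucoord n q e" unfolding ye by (rule ucoord_mult[OF WU(2) eU q(1,3)])
      moreover have "ucoord n q y = 0" unfolding y_def by (rule r0[OF WU(2) qJ])
      ultimately have "ucoord n q W' \<noteq> 0" using q(2) by auto
      then have "\<not> q < p" using uxW[of q] p(3)[of q] by auto
      moreover have "q \<noteq> p" using qJ pJ by auto
      ultimately have "p < q" by simp
      then have "ucoord n p y = ucoord n p W' + ucoord n p e" unfolding ye
        by (intro ucoord_mult[OF WU(2) eU p(1)] q(3)) auto
      then show ?thesis using q(3)[OF \<open>p < q\<close>] uxW[of p] by simp
    qed
    then show ?thesis using 1 2 p(2) by (simp add: \<tau>_def y_def W_def)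
  qed
  then show ?thesis using that \<tau> by blast
qed

text \<open>The group is the preimage of \<open>D\<close> under
  \<open>g \<mapsto> g w^(- \<tau> g)\<close>, hence closed; and it is parametrized over
  \<open>k\<close> by \<open>D\<close> and the line, so density follows in two stages, first in
  \<open>D\<close> for an exponent in \<open>k\<close>, then in the exponent.\<close>

lemma k_group_adjoin:
  fixes k :: "'a::field_char_0 set"
  assumes k: "is_subfield k" and D: "k_group n k D" and w: "w \<in> rat_points n k (unitriangular n)" "w \<notin> D"
    and norm: "\<And>t d. d \<in> D \<Longrightarrow> upow n w t * d * ginv n (upow n w t) \<in> D"
  shows "k_group n k (adjoin n D w)"
proof -
  note K = k_groupD[OF D]
  have wU: "w \<in> unitriangular n" using w by (auto simp: rat_points_def)
  note WU = upow_unitriangular[OF wU]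
  obtain \<tau> where \<tau>: "\<tau> \<in> ureg n k" "\<And>d t. d \<in> D \<Longrightarrow> \<tau> (d * upow n w t) = t"
    using adjoin_parameter[OF assms] by blast
  have AU: "adjoin n D w \<subseteq> unitriangular n"
    unfolding adjoin_def using unitriangular_mult[OF K(5) WU] by blast
  have sg: "subgroup (adjoin n D w) (GL n)"
  proof (rule subgroupI_GL)
    show "adjoin n D w \<subseteq> carrier (GL n)" using AU unitriangular_GL by blast
    have "1\<^sub>m n = 1\<^sub>m n * upow n w 0" using upow_zero[OF wU] by simp
    then show "1\<^sub>m n \<in> adjoin n D w" unfolding adjoin_def using subgroupD_GL(1)[OF K(1)] by blast
  next
    fix g h assume "g \<in> adjoin n D w" "h \<in> adjoin n D w"
    then obtain d s d' t where gh: "g = d * upow n w s" "h = d' * upow n w t" "d \<in> D" "d' \<in> D"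
      by (auto simp: adjoin_def)
    have "g * h = (d * (upow n w s * d' * ginv n (upow n w s))) * upow n w (s + t)"
      unfolding gh(1,2) by (rule adjoin_mult[OF wU K(6)[OF gh(3)] K(6)[OF gh(4)]])
    moreover have "d * (upow n w s * d' * ginv n (upow n w s)) \<in> D"
      by (rule subgroupD_GL(2)[OF K(1) gh(3) norm[OF gh(4)]])
    ultimately show "g * h \<in> adjoin n D w" unfolding adjoin_def by blast
  next
    fix g assume "g \<in> adjoin n D w"
    then obtain d s where g: "g = d * upow n w s" "d \<in> D" by (auto simp: adjoin_def)
    have "ginv n g = (upow n w (- s) * ginv n d * ginv n (upow n w (- s))) * upow n w (- s)"
      unfolding g(1) by (rule adjoin_inv[OF wU K(6)[OF g(2)]])
    moreover have "upow n w (- s) * ginv n d * ginv n (upow n w (- s)) \<in> D"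
      by (rule norm[OF subgroupD_GL(3)[OF K(1) g(2)]])
    ultimately show "ginv n g \<in> adjoin n D w" unfolding adjoin_def by blast
  qed
  have "adjoin n D w = {g \<in> unitriangular n. g * upow n w (- \<tau> g) \<in> D}"
  proof (intro Set.set_eqI iffI)
    fix g assume "g \<in> adjoin n D w"
    then obtain d s where g: "g = d * upow n w s" "d \<in> D" by (auto simp: adjoin_def)
    have "g * upow n w (- \<tau> g) = d" using g \<tau>(2)[OF g(2)] K(6)[OF g(2)] unitriangular_GL[OF WU]
      by (simp add: upow_uminus[OF wU] GL_simps[where n = n])
    then show "g \<in> {g \<in> unitriangular n. g * upow n w (- \<tau> g) \<in> D}"
      using g unitriangular_mult[OF K(5)[OF g(2)] WU[of s]] by simp
  next
    fix g assume "g \<in> {g \<in> unitriangular n. g * upow n w (- \<tau> g) \<in> D}"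
    then have g: "g \<in> unitriangular n" "g * upow n w (- \<tau> g) \<in> D" by auto
    have "g = (g * upow n w (- \<tau> g)) * upow n w (\<tau> g)"
      using unitriangular_GL[OF g(1)] unitriangular_GL[OF WU] by (simp add: upow_uminus[OF wU] GL_simps[where n = n])
    then show "g \<in> adjoin n D w" using g(2) unfolding adjoin_def by blast
  qed
  moreover have "regular_map n UNIV n (\<lambda>g. g * upow n w (- \<tau> g))"
    by (intro regular_map_mult[OF subfield_UNIV] regular_map_id regular_map_upow[OF subfield_UNIV]
        regular_map_const wU ureg_uminus[OF subfield_UNIV] ureg_UNIV[OF \<tau>(1)]) auto
  ultimately have cl: "zariski_closed n (adjoin n D w)" using closed_preimage[OF K(3)] by simp
  have dense: "k_dense n k (adjoin n D w)" unfolding k_dense_def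
  proof (intro ballI impI)
    fix f g assume f: "f \<in> ureg n UNIV" "\<forall>g\<in>rat_points n k (adjoin n D w). f g = 0" and "g \<in> adjoin n D w"
    then obtain d s where g: "g = d * upow n w s" "d \<in> D" by (auto simp: adjoin_def)
    have fk: "f (d * upow n w t) = 0" if t: "t \<in> k" for t
    proof -
      have ft: "(\<lambda>d. f (d * upow n w t)) \<in> ureg n UNIV"
        by (intro ureg_comp[OF f(1)] regular_map_mult[OF subfield_UNIV] regular_map_id regular_map_const WU) auto
      have f0: "f (d * upow n w t) = 0" if "d \<in> rat_points n k D" for d
      proof -
        have d: "d \<in> D" "d \<in> rat_points n k (unitriangular n)" using that rat_points_unitriangular[OF K(2)] by blast+
        have "d * upow n w t \<in> rat_points n k (unitriangular n)" by (intro rat_mult[OF k] d rat_upow[OF k w(1) t])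
        moreover have "d * upow n w t \<in> adjoin n D w" using d by (auto simp: adjoin_def)
        ultimately have "d * upow n w t \<in> rat_points n k (adjoin n D w)"
          using rat_points_unitriangular[OF AU] by blast
        then show ?thesis by (rule bspec[OF f(2)])
      qed
      show ?thesis by (rule k_denseD[OF K(4) ft f0 g(2)])
    qed
    have cv: "curve n (\<lambda>t. d * upow n w t)"
      by (intro curve_mult curve_const curve_upow wU K(5) g(2))
    have "f (d * upow n w s) = 0"
      by (rule polyfun_eq_zero[OF curve_ureg[OF cv f(1)] subfield_infinite[OF k] fk])
    then show "f g = 0" by (simp add: g)
  qed
  show ?thesis using sg AU cl dense by (simp add: k_group_def)
qed

subsection \<open>Additive functions and the first row\<close>

lemma AFs_overI:
  fixes k :: "'a::field_char_0 set"
  assumes k: "is_subfield k" and D: "k_group n k D" and h: "h \<in> ureg n k"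
    and add: "\<And>u v. u \<in> D \<Longrightarrow> v \<in> D \<Longrightarrow> h (u * v) = h u + h v"
  shows "(D, restrict h D) \<in> AFs_over n k"
proof -
  have D': "unipotent_k_subgroup n k D" "D \<subseteq> unitriangular n" using k_group_iff[OF k] D by auto
  obtain f where f: "f \<in> regular_fun n k" "\<And>u. u \<in> unitriangular n \<Longrightarrow> h u = f u"
    using h by (rule uregE) blast
  have *: "\<forall>u\<in>D. fun_af (D, restrict h D) u = f u" using f D'(2) by auto
  have "u * v \<in> D" if "u \<in> D" "v \<in> D" for u v
    using subgroupD_GL(2)[OF k_groupD(1)[OF D] that] .
  then show ?thesis
    unfolding AFs_over_def additive_function_def
    using D'(1) add f(1) regular_fun_UNIV[OF f(1)] * by (auto simp: unipotent_k_subgroup_def)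
qed

lemma AFs_overD:
  fixes k :: "'a::field_char_0 set"
  assumes k: "is_subfield k" and F: "F \<in> AFs_over n k" "dom_af F \<subseteq> unitriangular n"
  shows "k_group n k (dom_af F)" "fun_af F \<in> extensional (dom_af F)"
    "\<And>u v. u \<in> dom_af F \<Longrightarrow> v \<in> dom_af F \<Longrightarrow> fun_af F (u * v) = fun_af F u + fun_af F v"
    "\<exists>h\<in>ureg n k. \<forall>u\<in>dom_af F. fun_af F u = h u"
proof -
  show "k_group n k (dom_af F)"
    unfolding k_group_iff[OF k] unipotent_k_subgroup_def
    using F by (auto simp: AFs_over_def additive_function_def)
  show "fun_af F \<in> extensional (dom_af F)"
    "\<And>u v. u \<in> dom_af F \<Longrightarrow> v \<in> dom_af F \<Longrightarrow> fun_af F (u * v) = fun_af F u + fun_af F v"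
    using F by (auto simp: AFs_over_def additive_function_def)
  show "\<exists>h\<in>ureg n k. \<forall>u\<in>dom_af F. fun_af F u = h u"
    using F regular_fun_ureg by (fastforce simp: AFs_over_def)
qed

lemma af_eqI:
  assumes "dom_af F = dom_af G" "fun_af F \<in> extensional (dom_af F)" "fun_af G \<in> extensional (dom_af G)"
    "\<And>u. u \<in> dom_af F \<Longrightarrow> fun_af F u = fun_af G u"
  shows "F = G"
  using assms by (intro prod_eqI extensionalityI[where A = "dom_af F"]) auto

lemma restrict_eq_iff: "restrict f A = restrict g A \<longleftrightarrow> (\<forall>x\<in>A. f x = g x)"
  by (metis restrict_apply' restrict_ext)

lemma comm_subgroup_subset:
  assumes "subgroup C (GL n)"
    "\<And>a b. a \<in> A \<Longrightarrow> b \<in> B \<Longrightarrow> a * b * ginv n a * ginv n b \<in> C"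
  shows "comm_subgroup n A B \<subseteq> C"
  unfolding comm_subgroup_def
  by (rule group.generate_subgroup_incl[OF group_GL _ assms(1)]) (use assms(2) in auto)

lemma comm_subgroup_mem: "a \<in> A \<Longrightarrow> b \<in> B \<Longrightarrow> a * b * ginv n a * ginv n b \<in> comm_subgroup n A B"
  unfolding comm_subgroup_def by (rule generate.incl) blast

lemma unitriangular_mult_one:
  assumes "u \<in> unitriangular n"
  shows "u * 1\<^sub>m n = u" "1\<^sub>m n * u = u"
  using unitriangularD(1)[OF assms] by simp_all

text \<open>The elements of \<open>V\<close>. The value \<open>x 0\<close> is ignored, because the
  diagonal entry is 1; so vectors only matter at positive indices.\<close>

definition rowv :: "nat \<Rightarrow> (nat \<Rightarrow> 'a::field) \<Rightarrow> 'a mat" where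
  "rowv n x = mat n n (\<lambda>(a, b). if a = b then 1 else if a = 0 then x b else 0)"

lemma rowv_unitriangular: "rowv n x \<in> unitriangular n"
  by (rule unitriangularI) (auto simp: rowv_def)

lemma rowv_carrier: "rowv n x \<in> carrier_mat n n"
  by (simp add: rowv_def)

lemma rowv_entry: "a < n \<Longrightarrow> b < n \<Longrightarrow>
    rowv n x $$ (a, b) = (if a = b then 1 else if a = 0 then x b else 0)"
  by (simp add: rowv_def)

lemma rowv_cong: "(\<And>b. 0 < b \<Longrightarrow> b < n \<Longrightarrow> x b = y b) \<Longrightarrow> rowv n x = rowv n y"
  by (intro eq_matI) (auto simp: rowv_def)

lemma rowv_left_mult:
  assumes g: "g \<in> carrier_mat n n" and ab: "a < n" "b < n"
  shows "(rowv n x * g) $$ (a, b) = g $$ (a, b) + (if a = 0 then \<Sum>l\<in>{1..<n}. x l * g $$ (l, b) else 0)"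
proof -
  have "(rowv n x * g) $$ (a, b) =
    (\<Sum>l<n. (if l = a then g $$ (a, b) else 0) + (if a = 0 \<and> l \<in> {1..<n} then x l * g $$ (l, b) else 0))"
    unfolding entry_mult[OF rowv_carrier g ab] by (intro sum.cong) (use ab in \<open>auto simp: rowv_entry\<close>)
  also have "\<dots> = g $$ (a, b) + (\<Sum>l<n. if a = 0 \<and> l \<in> {1..<n} then x l * g $$ (l, b) else 0)"
    using ab by (simp add: sum.distrib)
  also have "(\<Sum>l<n. if a = 0 \<and> l \<in> {1..<n} then x l * g $$ (l, b) else 0) =
      (if a = 0 then \<Sum>l\<in>{1..<n}. x l * g $$ (l, b) else 0)"
  proof (cases "a = 0")
    case True
    have "{..<n} \<inter> {1..<n} = {1..<n}" by auto
    then show ?thesis using True sum.inter_restrict[of "{..<n}" "\<lambda>l. x l * g $$ (l, b)" "{1..<n}"] by simp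
  qed simp
  finally show ?thesis .
qed

lemma rowv_right_mult:
  assumes g: "g \<in> carrier_mat n n" and ab: "a < n" "b < n"
  shows "(g * rowv n x) $$ (a, b) = g $$ (a, b) + (if b = 0 then 0 else g $$ (a, 0) * x b)"
proof -
  have "(g * rowv n x) $$ (a, b) =
    (\<Sum>l<n. (if l = b then g $$ (a, b) else 0) + (if l = 0 then (if b = 0 then 0 else g $$ (a, 0) * x b) else 0))"
    unfolding entry_mult[OF g rowv_carrier ab] by (intro sum.cong) (use ab in \<open>auto simp: rowv_entry\<close>)
  also have "\<dots> = g $$ (a, b) + (if b = 0 then 0 else g $$ (a, 0) * x b)"
    using ab by (simp add: sum.distrib)
  finally show ?thesis .
qed

lemma rowv_mult: "rowv n x * rowv n y = rowv n (\<lambda>b. x b + y b)"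
proof (rule eq_matI)
  fix a b assume "a < dim_row (rowv n (\<lambda>b. x b + y b))" "b < dim_col (rowv n (\<lambda>b. x b + y b))"
  then have ab: "a < n" "b < n" by (simp_all add: rowv_def)
  then show "(rowv n x * rowv n y) $$ (a, b) = rowv n (\<lambda>b. x b + y b) $$ (a, b)"
    unfolding rowv_right_mult[OF rowv_carrier ab] by (auto simp: rowv_entry)
qed (auto simp: rowv_def)

lemma rowv_zero: "rowv n (\<lambda>b. 0) = 1\<^sub>m n"
  by (rule eq_matI) (auto simp: rowv_def)

lemma rowv_inv: "ginv n (rowv n x) = rowv n (\<lambda>b. - x b)"
  by (rule GL_inv_eqI(3)) (simp_all add: rowv_mult rowv_zero rowv_carrier)

lemma upow_rowv: "upow n (rowv n x) t = rowv n (\<lambda>b. t * x b)"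
proof (rule curve_eq_nat[where d = "\<lambda>t. rowv n (\<lambda>b. t * x b)"])
  show "curve n (upow n (rowv n x))" by (rule curve_upow[OF rowv_unitriangular])
  show "curve n (\<lambda>t. rowv n (\<lambda>b. t * x b))" unfolding curve_def
  proof (intro conjI allI impI rowv_unitriangular)
    show "polyfun (\<lambda>t. rowv n (\<lambda>b. t * x b) $$ (i, j))" if "i < n" "j < n" for i j
      using that by (cases "i = j"; cases "i = 0")
        (simp_all add: rowv_entry polyfun_const polyfun_mult polyfun_id)
  qed
  show "upow n (rowv n x) (of_nat a) = rowv n (\<lambda>b. of_nat a * x b)" for a
    unfolding upow_of_nat[OF rowv_unitriangular]
  proof (induction a)
    case 0
    show ?case using rowv_carrier[of n x] by (simp add: rowv_zero)
  next
    case (Suc a)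
    then show ?case by (simp add: rowv_mult algebra_simps)
  qed
qed

lemma inv_fixes_first_column:
  assumes d: "d \<in> carrier (GL n)" and col: "\<And>a. a < n \<Longrightarrow> d $$ (a, 0) = (if a = 0 then 1 else 0)"
    and a: "a < n"
  shows "ginv n d $$ (a, 0) = (if a = 0 then 1 else 0)"
proof -
  have n: "0 < n" using a by simp
  have "(ginv n d * d) $$ (a, 0) = (\<Sum>l<n. if l = 0 then ginv n d $$ (a, 0) else 0)"
    unfolding entry_mult[OF GL_carrier_mat[OF GL_inv_closed[OF d]] GL_carrier_mat[OF d] a n]
    by (intro sum.cong) (auto simp: col)
  then show ?thesis using GL_l_inv[OF d] a n by simp
qed

text \<open>A matrix that fixes the first basis vector normalizes \<open>V\<close>, on which it acts
  by multiplying row vectors with the inverse of its lower right block.\<close>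

lemma rowv_conj:
  assumes d: "d \<in> carrier (GL n)" and col: "\<And>a. a < n \<Longrightarrow> d $$ (a, 0) = (if a = 0 then 1 else 0)"
  shows "d * rowv n x * ginv n d = rowv n (\<lambda>b. \<Sum>l\<in>{1..<n}. x l * ginv n d $$ (l, b))"
    (is "_ = rowv n ?y")
proof -
  define e where "e = ginv n d"
  have eG: "e \<in> carrier (GL n)" unfolding e_def by (rule GL_inv_closed[OF d])
  note dm = GL_carrier_mat[OF d] and em = GL_carrier_mat[OF eG]
  have "d * rowv n x = rowv n ?y * d"
  proof (rule eq_matI)
    fix a b assume "a < dim_row (rowv n ?y * d)" "b < dim_col (rowv n ?y * d)"
    then have ab: "a < n" "b < n" using dm by (auto simp: rowv_def)
    have "(\<Sum>l\<in>{1..<n}. ?y l * d $$ (l, b)) = (\<Sum>m\<in>{1..<n}. x m * (\<Sum>l\<in>{1..<n}. e $$ (m, l) * d $$ (l, b)))"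
      by (simp add: e_def sum_distrib_left sum_distrib_right mult.assoc) (rule sum.swap)
    also have "\<dots> = (\<Sum>m\<in>{1..<n}. if m = b then x b else 0)"
    proof (rule sum.cong)
      fix m assume m: "m \<in> {1..<n}"
      have "(\<Sum>l<n. e $$ (m, l) * d $$ (l, b)) = (if m = b then 1 else 0)"
        using entry_mult[OF em dm, of m b] m ab GL_l_inv[OF d] by (simp add: e_def)
      moreover have "{..<n} = insert 0 {1..<n}" using m by auto
      moreover have "e $$ (m, 0) = 0" using inv_fixes_first_column[OF d col] m by (simp add: e_def)
      ultimately have "(\<Sum>l\<in>{1..<n}. e $$ (m, l) * d $$ (l, b)) = (if m = b then 1 else 0)" by simp
      then show "x m * (\<Sum>l\<in>{1..<n}. e $$ (m, l) * d $$ (l, b)) = (if m = b then x b else 0)" by simp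
    qed simp
    also have "\<dots> = (if b = 0 then 0 else x b)" using ab by simp
    finally show "(d * rowv n x) $$ (a, b) = (rowv n ?y * d) $$ (a, b)"
      unfolding rowv_right_mult[OF dm ab] rowv_left_mult[OF dm ab] using col[OF ab(1)] by (cases "a = 0") auto
  qed (use dm in \<open>auto simp: rowv_def\<close>)
  then have "d * rowv n x * ginv n d = rowv n ?y * d * ginv n d" by simp
  also have "\<dots> = rowv n ?y" using d by (simp add: GL_simps[where n = n] unitriangular_GL[OF rowv_unitriangular])
  finally show ?thesis .
qed

text \<open>The group \<open>V_j\<close> of the overview, with columns numbered from 0. As
  \<open>x 0\<close> is ignored, \<open>j = 1\<close> gives all of \<open>V\<close>, while
  \<open>j = n\<close> gives the trivial group.\<close>

definition row_tail :: "nat \<Rightarrow> nat \<Rightarrow> 'a::field mat set" where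
  "row_tail n j = {rowv n x | x. \<forall>b<j. x b = 0}"

lemma unitriangular_first_column:
  "u \<in> unitriangular n \<Longrightarrow> a < n \<Longrightarrow> u $$ (a, 0) = (if a = 0 then 1 else 0)"
  using unitriangularD[of u n] by (cases "a = 0") auto

section \<open>Adjoining one entry of the first row: the e-step and the eu-step\<close>

locale row_exchange =
  fixes k :: "'a::field_char_0 set" and n i :: nat and F :: "'a af" and h :: "'a mat \<Rightarrow> 'a"
    and D :: "'a mat set" and w :: "'a mat"
  assumes k: "is_subfield k" and F: "F \<in> AFs_over n k" and D: "dom_af F = D" and DU: "D \<subseteq> unitriangular n"
    and i: "0 < i" "i < n" and tail: "row_tail n (Suc i) \<subseteq> D"
    and w: "w = rowv n (\<lambda>b. if b = i then 1 else 0)" and wD: "w \<notin> D"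
    and h: "h \<in> ureg n k" and Fh: "\<And>u. u \<in> D \<Longrightarrow> fun_af F u = h u"
begin

abbreviation "W \<equiv> upow n w"

lemma wU: "w \<in> unitriangular n" unfolding w by (rule rowv_unitriangular)

lemma w_rat: "w \<in> rat_points n k (unitriangular n)"
  using wU unitriangular_GL[OF wU] subfield_zero[OF k] subfield_one[OF k]
  by (auto simp: rat_points_def w rowv_entry)

lemma W_eq: "W t = rowv n (\<lambda>b. if b = i then t else 0)"
  unfolding w upow_rowv by (rule rowv_cong) simp

lemma WU: "W t \<in> unitriangular n" by (rule upow_unitriangular[OF wU])
lemma WG: "W t \<in> carrier (GL n)" by (rule unitriangular_GL[OF WU])
lemma W1: "W 1 = w" by (rule upow_one[OF wU])
lemma W0: "W 0 = 1\<^sub>m n" by (rule upow_zero[OF wU])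

lemma domU: "dom_af F \<subseteq> unitriangular n" using DU D by simp

lemma KD: "k_group n k D" using AFs_overD(1)[OF k F domU] by (simp add: D)
lemmas K = k_groupD[OF KD]
lemmas Dsub = subgroupD_GL[OF K(1)]

lemma h_add: "u \<in> D \<Longrightarrow> v \<in> D \<Longrightarrow> h (u * v) = h u + h v"
  using AFs_overD(3)[OF k F domU, of u v] Fh Dsub(2)[of u v] by (simp add: D)

lemma h_inv: "u \<in> D \<Longrightarrow> h (ginv n u) = - h u" and h_one: "h (1\<^sub>m n) = 0"
  using additive_one_inv[OF K(1) h_add] by auto

definition c :: "'a mat \<Rightarrow> 'a \<Rightarrow> 'a mat" where
  "c d t = d * W t * ginv n d * ginv n (W t)"

text \<open>The commutator stays in \<open>V\<close> and is linear in \<open>t\<close>: up to this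
  factor its row is row \<open>i\<close> of \<open>d^-1\<close> minus the unit vector, which
  vanishes up to column \<open>i\<close>.\<close>

lemma c_eq:
  assumes d: "d \<in> unitriangular n"
  shows "c d t = rowv n (\<lambda>b. t * (ginv n d $$ (i, b) - (if b = i then 1 else 0)))"
proof -
  have "d * W t * ginv n d = rowv n (\<lambda>b. \<Sum>l\<in>{1..<n}. (if l = i then t else 0) * ginv n d $$ (l, b))"
    unfolding W_eq by (rule rowv_conj[OF unitriangular_GL[OF d] unitriangular_first_column[OF d]])
  also have "\<dots> = rowv n (\<lambda>b. t * ginv n d $$ (i, b))"
  proof (rule rowv_cong)
    fix b
    have "(\<Sum>l\<in>{1..<n}. (if l = i then t else 0) * ginv n d $$ (l, b)) =
       (\<Sum>l\<in>{1..<n}. if l = i then t * ginv n d $$ (i, b) else 0)"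
      by (intro sum.cong) auto
    then show "(\<Sum>l\<in>{1..<n}. (if l = i then t else 0) * ginv n d $$ (l, b)) = t * ginv n d $$ (i, b)"
      using i by simp
  qed
  finally show ?thesis unfolding c_def W_eq rowv_inv by (simp add: rowv_mult, intro rowv_cong) (simp add: algebra_simps)
qed

lemma c_upow: "d \<in> unitriangular n \<Longrightarrow> c d t = upow n (c d 1) t"
  by (simp add: c_eq upow_rowv)

lemma c_tail:
  assumes d: "d \<in> unitriangular n"
  shows "c d t \<in> row_tail n (Suc i)"
proof -
  note E = unitriangularD[OF unitriangular_inv[OF d]]
  define x where "x b = (if b < Suc i then 0 else t * (ginv n d $$ (i, b) - (if b = i then 1 else 0)))" for b
  have "c d t = rowv n x" unfolding c_eq[OF d] by (rule rowv_cong) (use E i in \<open>auto simp: x_def less_Suc_eq\<close>)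
  then show ?thesis unfolding row_tail_def by (auto simp: x_def)
qed

lemma c_D: "d \<in> unitriangular n \<Longrightarrow> c d t \<in> D"
  using c_tail tail by (auto simp: D)

definition phi :: "'a mat \<Rightarrow> 'a" where "phi d = h (c d 1)"

lemma phi_ureg: "phi \<in> ureg n k"
proof -
  have "regular_map n k n (\<lambda>d. c d 1)" unfolding c_def W1
    using w_rat rat_inv[OF k w_rat]
    by (intro regular_map_mult[OF k] regular_map_id regular_map_inv[OF k] regular_map_const)
       (auto simp: rat_points_def)
  from ureg_comp[OF h this subfield_one[OF k]] show ?thesis unfolding phi_def[abs_def] .
qed

lemma h_c: "d \<in> D \<Longrightarrow> h (c d t) = t * phi d"
  unfolding phi_def using c_upow[OF K(5)] additive_upow[OF K(1,3,2) h h_add c_D[OF K(5)], of d 1 t] by metis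

lemma h_conj:
  assumes "d \<in> D" "x \<in> D"
  shows "h (d * x * ginv n d) = h x"
  using assms h_add Dsub h_inv by simp

text \<open>\<open>[d e, w] = d [e, w] d^-1 [d, w]\<close>, and \<open>h\<close> does not see the
  conjugation by \<open>d\<close>.\<close>

lemma phi_add:
  assumes d: "d \<in> D" and e: "e \<in> D"
  shows "phi (d * e) = phi d + phi e"
proof -
  have "c (d * e) 1 = (d * c e 1 * ginv n d) * c d 1"
    using K(6)[OF d] K(6)[OF e] WG[of 1] unfolding c_def by (simp add: GL_simps[where n = n])
  then show ?thesis unfolding phi_def
    using h_add[of "d * c e 1 * ginv n d" "c d 1"] h_conj[OF d c_D[OF K(5)[OF e]]]
      Dsub(2,3) d c_D K(5) e by simp
qed

lemma conj_W:
  assumes d: "d \<in> D"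
  shows "W t * d * ginv n (W t) = d * c (ginv n d) t"
  using K(6)[OF d] WG[of t] unfolding c_def by (simp add: GL_simps[where n = n])

definition D0 :: "'a mat set" where "D0 = {d \<in> D. phi d = 0}"

lemma D0_D: "d \<in> D0 \<Longrightarrow> d \<in> D" by (simp add: D0_def)

lemma KD0: "k_group n k D0"
  unfolding D0_def by (rule k_group_kernel[OF k KD phi_ureg phi_add])
lemmas K0 = k_groupD[OF KD0]
lemmas D0sub = subgroupD_GL[OF K0(1)]

text \<open>\<open>V\<close> is commutative, so the commutators with \<open>w\<close> are
  trivial.\<close>

lemma tail_D0: "row_tail n (Suc i) \<subseteq> D0"
proof
  fix v :: "'a mat" assume v: "v \<in> row_tail n (Suc i)"
  then obtain x where x: "v = rowv n x" by (auto simp: row_tail_def)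
  have "c v 1 = 1\<^sub>m n" unfolding c_def W_eq x by (simp add: rowv_mult rowv_inv rowv_zero)
  then show "v \<in> D0" using v tail h_one by (auto simp: D0_def phi_def D)
qed

lemma c_D0: "d \<in> unitriangular n \<Longrightarrow> c d t \<in> D0"
  using c_tail tail_D0 by auto

lemma phi_inv: "d \<in> D \<Longrightarrow> phi (ginv n d) = - phi d"
  using additive_one_inv[OF K(1) phi_add] by auto

lemma D0_normal:
  assumes "d \<in> D" "x \<in> D0"
  shows "d * x * ginv n d \<in> D0"
  using assms Dsub phi_add phi_inv by (simp add: D0_def)

lemma norm: "d \<in> D0 \<Longrightarrow> W t * d * ginv n (W t) \<in> D0"
  using conj_W[OF D0_D] D0sub(2) c_D0[OF K0(5)[OF D0sub(3)]] by simp

text \<open>Conjugation by \<open>w^t\<close> multiplies \<open>d\<close> by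
  \<open>[d^-1, w^t]\<close>, whose value is \<open>- t * phi d\<close>. Restricting to the kernel
  of \<open>phi\<close> makes this vanish, and that is what lets \<open>F\<close> extend.\<close>

lemma h_norm: "d \<in> D0 \<Longrightarrow> h (W t * d * ginv n (W t)) = h d"
  using conj_W[OF D0_D] h_add[OF D0_D c_D[OF K0(5)[OF D0sub(3)]]] h_c[OF Dsub(3)[OF D0_D]] phi_inv[OF D0_D]
  by (simp add: D0_def)

lemma wD0: "w \<notin> D0" using wD by (auto simp: D0_def D)

definition N0 :: "'a mat set" where "N0 = adjoin n D0 w"

lemma KN0: "k_group n k N0"
  unfolding N0_def by (rule k_group_adjoin[OF k KD0 w_rat wD0 norm])
lemmas KN = k_groupD[OF KN0]
lemmas N0sub = subgroupD_GL[OF KN(1)]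

lemma N0_cases:
  assumes "g \<in> N0"
  obtains d t where "d \<in> D0" "g = d * W t"
  using assms by (auto simp: N0_def adjoin_def)

lemma N0I: "d \<in> D0 \<Longrightarrow> d * W t \<in> N0"
  by (auto simp: N0_def adjoin_def)

lemma D0_N0: "d \<in> D0 \<Longrightarrow> d \<in> N0"
  using N0I[of d 0] unitriangular_mult_one(1)[OF K0(5)[of d]] by (simp add: W0)

lemma W_N0: "W t \<in> N0"
  using N0I[OF D0sub(1), of t] unitriangular_mult_one(2)[OF WU[of t]] by simp

definition tau :: "'a mat \<Rightarrow> 'a" where
  "tau = (SOME \<tau>. \<tau> \<in> ureg n k \<and> (\<forall>d\<in>D0. \<forall>t. \<tau> (d * W t) = t))"

lemma tau: "tau \<in> ureg n k" "d \<in> D0 \<Longrightarrow> tau (d * W t) = t"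
proof -
  have "\<exists>\<tau>. \<tau> \<in> ureg n k \<and> (\<forall>d\<in>D0. \<forall>t. \<tau> (d * W t) = t)"
  proof (rule adjoin_parameter[OF k KD0 w_rat wD0 norm])
    fix \<tau> assume "\<tau> \<in> ureg n k" "\<And>d t. d \<in> D0 \<Longrightarrow> \<tau> (d * W t) = t"
    then show ?thesis by (intro exI[of _ \<tau>]) simp
  qed
  from someI_ex[OF this] show "tau \<in> ureg n k" "d \<in> D0 \<Longrightarrow> tau (d * W t) = t"
    unfolding tau_def by blast+
qed

lemma tau_W: "tau (W t) = t"
  using tau(2)[OF D0sub(1), of t] unitriangular_mult_one(2)[OF WU[of t]] by simp

lemma tau_add:
  assumes "g \<in> N0" "g' \<in> N0"
  shows "tau (g * g') = tau g + tau g'"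
proof -
  obtain d s where g: "d \<in> D0" "g = d * W s" using N0_cases[OF assms(1)] .
  obtain d' t where g': "d' \<in> D0" "g' = d' * W t" using N0_cases[OF assms(2)] .
  have "g * g' = (d * (W s * d' * ginv n (W s))) * W (s + t)"
    unfolding g(2) g'(2) by (rule adjoin_mult[OF wU K0(6)[OF g(1)] K0(6)[OF g'(1)]])
  then show ?thesis using tau(2)[OF D0sub(2)[OF g(1) norm[OF g'(1)]]] tau(2) g g' by simp
qed

lemma tau_zero: "g \<in> N0 \<Longrightarrow> tau g = 0 \<Longrightarrow> g \<in> D0"
  by (elim N0_cases) (use unitriangular_mult_one(1)[OF K0(5)] in \<open>simp add: tau W0\<close>)

text \<open>\<open>tau\<close> is a homomorphism to a commutative group with kernel in
  \<open>D0\<close>.\<close>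

lemma comm_N0: "comm_subgroup n N0 N0 \<subseteq> D0"
proof (rule comm_subgroup_subset[OF K0(1)])
  fix a b assume ab: "a \<in> N0" "b \<in> N0"
  have inv: "tau (ginv n g) = - tau g" if "g \<in> N0" for g
    using additive_one_inv[OF KN(1) tau_add] that by auto
  show "a * b * ginv n a * ginv n b \<in> D0"
    by (rule tau_zero) (use ab N0sub tau_add inv in simp_all)
qed

text \<open>The extension of \<open>h\<close> from \<open>D0\<close> that is 0 at
  \<open>w\<close>.\<close>

definition h0 :: "'a mat \<Rightarrow> 'a" where "h0 g = h (g * W (- tau g))"

lemma h0_ureg: "h0 \<in> ureg n k"
proof -
  have "regular_map n k n (\<lambda>g. g * W (- tau g))"
    by (intro regular_map_mult[OF k] regular_map_id regular_map_upow[OF k] regular_map_const wU ureg_uminus[OF k] tau(1))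
       (use w_rat in \<open>auto simp: rat_points_def\<close>)
  from ureg_comp[OF h this subfield_one[OF k]] show ?thesis unfolding h0_def[abs_def] .
qed

lemma h0_eq: "d \<in> D0 \<Longrightarrow> h0 (d * W t) = h d"
  using K0(6)[of d] WG[of t] by (simp add: h0_def tau upow_uminus[OF wU] GL_simps[where n = n])

lemma h0_D0: "d \<in> D0 \<Longrightarrow> h0 d = h d"
  using h0_eq[of d 0] unitriangular_mult_one(1)[OF K0(5)[of d]] by (simp add: W0)

lemma h0_add:
  assumes "g \<in> N0" "g' \<in> N0"
  shows "h0 (g * g') = h0 g + h0 g'"
proof -
  obtain d s where g: "d \<in> D0" "g = d * W s" using N0_cases[OF assms(1)] .
  obtain d' t where g': "d' \<in> D0" "g' = d' * W t" using N0_cases[OF assms(2)] .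
  have "g * g' = (d * (W s * d' * ginv n (W s))) * W (s + t)"
    unfolding g(2) g'(2) by (rule adjoin_mult[OF wU K0(6)[OF g(1)] K0(6)[OF g'(1)]])
  then have "h0 (g * g') = h (d * (W s * d' * ginv n (W s)))"
    using h0_eq[OF D0sub(2)[OF g(1) norm[OF g'(1)]]] by simp
  also have "\<dots> = h d + h d'" using h_add[OF D0_D D0_D] g(1) norm[OF g'(1)] h_norm[OF g'(1)] by simp
  finally show ?thesis using h0_eq g g' by simp
qed

definition Z0 :: "'a af" where "Z0 = (N0, restrict h0 N0)"

lemma Z0: "Z0 \<in> AFs_over n k" "dom_af Z0 = N0" "d \<in> D0 \<Longrightarrow> fun_af Z0 d = fun_af F d"
  unfolding Z0_def using AFs_overI[OF k KN0 h0_ureg h0_add] h0_D0 Fh D0_N0 D0_D by (auto simp: D)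

lemma tail_N0: "row_tail n i \<subseteq> N0"
proof
  fix v :: "'a mat" assume "v \<in> row_tail n i"
  then obtain x where x: "v = rowv n x" "\<forall>b<i. x b = 0" by (auto simp: row_tail_def)
  have "v = rowv n (x(i := 0)) * W (x i)" unfolding x(1) W_eq rowv_mult by (rule rowv_cong) simp
  moreover have "rowv n (x(i := 0)) \<in> row_tail n (Suc i)"
    unfolding row_tail_def using x(2) by (auto simp: less_Suc_eq)
  ultimately show "v \<in> N0" using tail_D0 N0I by auto
qed

text \<open>If \<open>D\<close> contained \<open>w^t\<close> with \<open>t \<noteq> 0\<close>, it
  would contain the power of this element with exponent \<open>1 / t\<close>, which is
  \<open>w\<close>.\<close>

lemma D_inter_N0: "D \<inter> N0 = D0"
proof (intro equalityI subsetI)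
  fix g assume g: "g \<in> D \<inter> N0"
  then obtain d t where dt: "d \<in> D0" "g = d * W t" by (auto elim: N0_cases)
  have "ginv n d * g \<in> D" using g Dsub(2,3) D0_D[OF dt(1)] by auto
  then have Wt: "W t \<in> D" using dt(2) K0(6)[OF dt(1)] WG by (simp add: GL_simps[where n = n])
  have "t = 0"
  proof (rule ccontr)
    assume t: "t \<noteq> 0"
    have "upow n (W t) (inverse t) \<in> D" by (rule closed_subgroup_upow[OF K(1,3,2) Wt])
    then show False using t wD upow_upow[OF wU, of t "inverse t"] W1 by (simp add: D)
  qed
  then show "g \<in> D0" using dt unitriangular_mult_one(1)[OF K0(5)[OF dt(1)]] by (simp add: W0)
qed (use D0_D D0_N0 in auto)

lemma D_conj_N0:
  assumes d: "d \<in> D" and e: "e \<in> D0"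
  shows "d * (e * W t) * ginv n d = (d * e * ginv n d * c d t) * W t"
  using K(6)[OF d] K0(6)[OF e] WG[of t] unfolding c_def by (simp add: GL_simps[where n = n])

lemma D_conj_N0_mem:
  assumes d: "d \<in> D" and g: "g \<in> N0"
  shows "d * g * ginv n d \<in> N0"
  using g
proof (rule N0_cases)
  fix e t assume e: "e \<in> D0" "g = e * W t"
  show ?thesis unfolding e(2) D_conj_N0[OF d e(1)]
    by (intro N0I D0sub(2) D0_normal d e c_D0 K(5))
qed

text \<open>An extension is determined by its value at \<open>w\<close>, since it is linear along
  \<open>w^t\<close>.\<close>

lemma ext_value:
  assumes Q: "Q \<in> AFs_on n k N0" and QF: "\<And>u. u \<in> D0 \<Longrightarrow> fun_af Q u = fun_af F u" and d: "d \<in> D0"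
  shows "fun_af Q (d * W t) = h d + t * fun_af Q w"
proof -
  have Q': "Q \<in> AFs_over n k" "dom_af Q = N0" using Q by (auto simp: AFs_on_def)
  have QU: "dom_af Q \<subseteq> unitriangular n" using Q'(2) KN(2) by simp
  obtain q where q: "q \<in> ureg n k" "\<And>u. u \<in> N0 \<Longrightarrow> fun_af Q u = q u"
    using AFs_overD(4)[OF k Q'(1) QU] Q'(2) by auto
  have qadd: "q (u * v) = q u + q v" if "u \<in> N0" "v \<in> N0" for u v
    using AFs_overD(3)[OF k Q'(1) QU, of u v] Q'(2) q(2) that N0sub(2)[OF that] by simp
  have "q (W t) = t * q w" using additive_upow[OF KN(1,3,2) q(1) qadd W_N0, of 1 t] by (simp add: W1)
  then have "q (d * W t) = q d + t * q w" using qadd[OF D0_N0[OF d] W_N0] by simp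
  moreover have "q d = h d" using q(2)[OF D0_N0[OF d]] QF[OF d] Fh D0_D[OF d] by (simp add: D)
  ultimately show ?thesis using q(2)[OF N0I[OF d]] q(2)[OF W_N0[of 1]] by (simp add: W1)
qed

text \<open>Conjugation by \<open>d\<close> keeps the values on \<open>D0\<close> and moves the
  value at \<open>w\<close> by \<open>- phi d\<close>. So \<open>D\<close> acts on the extensions by
  translations, through \<open>phi\<close>.\<close>

lemma conj_af_ext:
  assumes Q: "Q \<in> AFs_on n k N0" and QF: "\<And>u. u \<in> D0 \<Longrightarrow> fun_af Q u = fun_af F u" and d: "d \<in> D"
  shows "conj_af n d Q = (N0, restrict (\<lambda>g. fun_af Q g - tau g * phi d) N0)"
proof -
  have QN: "dom_af Q = N0" using Q by (auto simp: AFs_on_def)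
  note dG = K(6)[OF d]
  have im: "(\<lambda>u. d * u * ginv n d) ` N0 = N0"
  proof (intro equalityI subsetI)
    fix g assume g: "g \<in> N0"
    have "ginv n d * g * d \<in> N0" using D_conj_N0_mem[OF Dsub(3)[OF d] g] dG by (simp add: GL_simps[where n = n])
    moreover have "g = d * (ginv n d * g * d) * ginv n d" using dG KN(6)[OF g] by (simp add: GL_simps[where n = n])
    ultimately show "g \<in> (\<lambda>u. d * u * ginv n d) ` N0" by blast
  qed (use D_conj_N0_mem[OF d] in auto)
  have "fun_af Q (ginv n d * g * d) = fun_af Q g - tau g * phi d" if "g \<in> N0" for g
    using that
  proof (rule N0_cases)
    fix e t assume e: "e \<in> D0" "g = e * W t"
    note d' = Dsub(3)[OF d]
    have "ginv n d * g * d = (ginv n d * e * ginv n (ginv n d) * c (ginv n d) t) * W t"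
      using D_conj_N0[OF d' e(1), of t] dG by (simp add: e(2) GL_simps[where n = n])
    moreover have x: "ginv n d * e * ginv n (ginv n d) \<in> D0" by (rule D0_normal[OF d' e(1)])
    moreover have y: "c (ginv n d) t \<in> D0" by (rule c_D0[OF K(5)[OF d']])
    ultimately have "fun_af Q (ginv n d * g * d) = h (ginv n d * e * ginv n (ginv n d)) + h (c (ginv n d) t) + t * fun_af Q w"
      using ext_value[OF Q QF D0sub(2)[OF x y]] h_add[OF D0_D[OF x] D0_D[OF y]] by simp
    then show ?thesis
      using h_conj[OF d' D0_D[OF e(1)]] h_c[OF d'] phi_inv[OF d] ext_value[OF Q QF e(1)] tau(2)[OF e(1)] e(2)
      by simp
  qed
  then show ?thesis unfolding conj_af_def QN im Let_def by (auto intro!: restrict_ext)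
qed

lemma e_case:
  assumes "\<And>d. d \<in> D \<Longrightarrow> phi d = 0"
  shows "e_step_subgroup n k F N0" "Z0 \<in> e_outputs n k F N0"
proof -
  have DD: "D0 = D" using assms by (auto simp: D0_def)
  have "w \<in> N0" using W_N0[of 1] by (simp add: W1)
  then show "e_step_subgroup n k F N0" unfolding e_step_subgroup_def
    using KN0 comm_N0 DD D0_N0 wD k_group_iff[OF k, of n N0] by (auto simp: D)
  show "Z0 \<in> e_outputs n k F N0"
    using Z0 DD by (simp add: e_outputs_def AFs_on_def restrict_eq_iff D)
qed

text \<open>The extensions over \<open>k\<close> are distinguished by their values at
  \<open>w\<close>, which lie in \<open>k\<close>. Translation by \<open>phi\<close> has the
  stabilizers \<open>D0(k)\<close>, and it is transitive because \<open>phi\<close> maps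
  \<open>D(k)\<close> onto \<open>k\<close>.\<close>

lemma eu_case:
  assumes e: "e \<in> D" "phi e \<noteq> 0"
  shows "eu_step n k F Z0"
proof -
  obtain u0 where u0: "u0 \<in> rat_points n k D" "phi u0 = 1"
    using rational_unit[OF k KD phi_ureg phi_add e] by blast
  have u0': "u0 \<in> D" "u0 \<in> rat_points n k (unitriangular n)"
    using u0(1) rat_points_unitriangular[OF K(2)] by blast+
  have commD: "comm_subgroup n D D \<subseteq> D0"
  proof (rule comm_subgroup_subset[OF K0(1)])
    fix a b assume "a \<in> D" "b \<in> D"
    then show "a * b * ginv n a * ginv n b \<in> D0"
      using Dsub phi_add phi_inv by (simp add: D0_def)
  qed
  have commDN: "comm_subgroup n D N0 \<subseteq> D0"
  proof (rule comm_subgroup_subset[OF K0(1)])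
    fix a b assume a: "a \<in> D" and b: "b \<in> N0"
    have ab: "a * b * ginv n a \<in> N0" by (rule D_conj_N0_mem[OF a b])
    have "tau (a * b * ginv n a) = tau b"
      using b
    proof (rule N0_cases)
      fix e t assume e: "e \<in> D0" "b = e * W t"
      show ?thesis unfolding e(2) D_conj_N0[OF a e(1)]
        using tau(2) D0sub(2)[OF D0_normal[OF a e(1)] c_D0[OF K(5)[OF a]]] e(1) by simp
    qed
    moreover have "tau (ginv n b) = - tau b" using additive_one_inv[OF KN(1) tau_add] b by auto
    ultimately show "a * b * ginv n a * ginv n b \<in> D0"
      using tau_zero[OF N0sub(2)[OF ab N0sub(3)[OF b]]] tau_add[OF ab N0sub(3)[OF b]] by simp
  qed
  define E where "E = {Q \<in> AFs_on n k N0. restrict (fun_af Q) D0 = restrict (fun_af F) D0}"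
  have E: "Q \<in> AFs_on n k N0" "\<And>u. u \<in> D0 \<Longrightarrow> fun_af Q u = fun_af F u" if "Q \<in> E" for Q
    using that by (auto simp: E_def restrict_eq_iff)
  have Eext: "fun_af Q \<in> extensional N0" if "Q \<in> E" for Q
    using E(1)[OF that] by (auto simp: AFs_on_def AFs_over_def additive_function_def)
  have wN: "w \<in> N0" "tau w = 1" using W_N0[of 1] tau_W[of 1] by (simp_all add: W1)
  have stab: "{d \<in> rat_points n k D. conj_af n d Q = Q} = rat_points n k D0" if Q: "Q \<in> E" for Q
  proof -
    have "conj_af n d Q = Q \<longleftrightarrow> phi d = 0" if d: "d \<in> D" for d
    proof
      assume "conj_af n d Q = Q"
      then have "fun_af (conj_af n d Q) w = fun_af Q w" by simp
      then show "phi d = 0" using conj_af_ext[OF E[OF Q] d] wN by simp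
    next
      assume "phi d = 0"
      then show "conj_af n d Q = Q"
        using conj_af_ext[OF E[OF Q] d] E(1)[OF Q] Eext[OF Q]
        by (intro prod_eqI) (simp_all add: AFs_on_def extensional_restrict)
    qed
    then show ?thesis by (auto simp: rat_points_def D0_def)
  qed
  have trans: "\<exists>d\<in>rat_points n k D. conj_af n d Q = Q'" if Q: "Q \<in> E" and Q': "Q' \<in> E" for Q Q'
  proof -
    \<comment> \<open>\<open>w\<close> is a rational point and \<open>P\<close> is defined over
      \<open>k\<close>, so the difference of two values is available as an exponent in
      \<open>k\<close>.\<close>
    have val: "fun_af P w \<in> k" if "P \<in> E" for P
    proof -
      have P: "P \<in> AFs_over n k" "dom_af P = N0" using E(1)[OF that] by (auto simp: AFs_on_def)
      obtain q where "q \<in> ureg n k" "\<forall>u\<in>N0. fun_af P u = q u"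
        using AFs_overD(4)[OF k P(1)] P(2) KN(2) by auto
      then show ?thesis using ureg_rational_point[OF k _ w_rat] wN(1) by auto
    qed
    define a where "a = fun_af Q w - fun_af Q' w"
    have ak: "a \<in> k" unfolding a_def by (intro subfield_diff[OF k] val Q Q')
    define d where "d = upow n u0 a"
    have dD: "d \<in> D" unfolding d_def by (rule closed_subgroup_upow[OF K(1,3,2) u0'(1)])
    have "d \<in> rat_points n k (unitriangular n)" unfolding d_def by (rule rat_upow[OF k u0'(2) ak])
    then have dk: "d \<in> rat_points n k D" using dD rat_points_unitriangular[OF K(2)] by blast
    have phid: "phi d = a" unfolding d_def using additive_upow[OF K(1,3,2) phi_ureg phi_add u0'(1)] u0(2) by simp
    have "fun_af Q g - tau g * a = fun_af Q' g" if "g \<in> N0" for g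
      using that
    proof (rule N0_cases)
      fix e t assume e: "e \<in> D0" "g = e * W t"
      show ?thesis unfolding e(2)
        using ext_value[OF E[OF Q] e(1)] ext_value[OF E[OF Q'] e(1)] tau(2)[OF e(1)]
        by (simp add: a_def algebra_simps)
    qed
    then have "conj_af n d Q = Q'"
      using conj_af_ext[OF E[OF Q] dD] E(1)[OF Q'] Eext[OF Q'] phid
      by (intro prod_eqI) (auto simp: AFs_on_def intro!: extensionalityI[where A = N0])
    then show ?thesis using dk by blast
  qed
  have D0D: "D0 \<noteq> D" using e by (auto simp: D0_def)
  have FZ: "restrict (fun_af F) D0 = restrict (fun_af Z0) D0" using Z0(3) by (simp add: restrict_eq_iff)
  show ?thesis
    unfolding eu_step_def Let_def Z0(2) D D_inter_N0 E_def[symmetric]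
    using Z0(1) D0D commD commDN comm_N0 FZ stab trans by blast
qed

end

subsection \<open>Filling the first row\<close>

text \<open>A step described by the set of its output AFs alone; vertices are only attached when the
  tree is built.\<close>

definition step_to :: "nat \<Rightarrow> 'a set \<Rightarrow> 'a::field af \<Rightarrow> 'a af set \<Rightarrow> bool" where
  "step_to n k F B \<longleftrightarrow>
     (\<exists>N. e_step_subgroup n k F N \<and> B = e_outputs n k F N) \<or>
     (\<exists>Z. B = {Z} \<and> eu_step n k F Z) \<or>
     (\<exists>\<gamma>\<in>rat_points n k (Mir n). B = {conj_af n \<gamma> F})"

definition af_in :: "nat \<Rightarrow> 'a set \<Rightarrow> 'a::field af \<Rightarrow> bool" where
  "af_in n k F \<longleftrightarrow> F \<in> AFs_over n k \<and> dom_af F \<subseteq> unitriangular n"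

text \<open>All labels can be kept inside \<open>U\<^sub>n\<close>, which lies in \<open>Mir\<^sub>n\<close>. The depth is bounded explicitly because
  an e-step has infinitely many outputs.\<close>

primrec reach :: "nat \<Rightarrow> 'a set \<Rightarrow> nat \<Rightarrow> 'a::field af \<Rightarrow> bool" where
  "reach n k 0 F \<longleftrightarrow> af_in n k F \<and> dom_af F = unitriangular n"
| "reach n k (Suc d) F \<longleftrightarrow> af_in n k F \<and>
     (dom_af F = unitriangular n \<or> (\<exists>B. B \<noteq> {} \<and> step_to n k F B \<and> (\<forall>Z\<in>B. reach n k d Z)))"

lemma reach_af_in: "reach n k d F \<Longrightarrow> af_in n k F"
  by (cases d) auto

lemma reach_Suc: "reach n k d F \<Longrightarrow> reach n k (Suc d) F"
proof (induction d arbitrary: F)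
  case (Suc d)
  then show ?case unfolding reach.simps(2)[of n k "Suc d"] reach.simps(2)[of n k d F] by blast
qed simp

text \<open>Each of the columns \<open>i, ..., 1\<close> costs at most one step, which explains the
  bound \<open>d + i\<close>; \<open>d\<close> is what remains once \<open>V\<close> lies in the
  domain.\<close>

lemma reach_fill_row:
  fixes k :: "'a::field_char_0 set"
  assumes k: "is_subfield k"
    and base: "\<And>F. af_in n k F \<Longrightarrow> row_tail n 1 \<subseteq> dom_af F \<Longrightarrow> reach n k d F"
  shows "i < n \<Longrightarrow> af_in n k F \<Longrightarrow> row_tail n (Suc i) \<subseteq> dom_af F \<Longrightarrow> reach n k (d + i) F"
proof (induction i arbitrary: F)
  case 0
  then show ?case using base by simp
next
  case (Suc i)
  define j where "j = Suc i"
  define w :: "'a mat" where "w = rowv n (\<lambda>b. if b = j then 1 else 0)"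
  have F: "F \<in> AFs_over n k" "dom_af F \<subseteq> unitriangular n" using Suc.prems(2) by (auto simp: af_in_def)
  note K = k_groupD[OF AFs_overD(1)[OF k F]]
  show ?case
  proof (cases "w \<in> dom_af F")
    case True
    \<comment> \<open>The domain already contains \<open>w\<close>, hence all \<open>w^t\<close>;
      together with the shorter rows they give the next tail without any step.\<close>
    have "row_tail n j \<subseteq> dom_af F"
    proof
      fix v :: "'a mat" assume "v \<in> row_tail n j"
      then obtain x where x: "v = rowv n x" "\<forall>b<j. x b = 0" by (auto simp: row_tail_def)
      have "v = rowv n (x(j := 0)) * upow n w (x j)"
        unfolding x(1) w_def upow_rowv rowv_mult by (rule rowv_cong) simp
      moreover have "rowv n (x(j := 0)) \<in> row_tail n (Suc j)"
        unfolding row_tail_def using x(2) by (auto simp: less_Suc_eq)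
      then have "rowv n (x(j := 0)) \<in> dom_af F" using Suc.prems(3) by (auto simp: j_def)
      moreover have "upow n w (x j) \<in> dom_af F" by (rule closed_subgroup_upow[OF K(1,3,2) True])
      ultimately show "v \<in> dom_af F" using subgroupD_GL(2)[OF K(1)] by simp
    qed
    then have "reach n k (d + i) F" using Suc.IH[of F] Suc.prems by (simp add: j_def)
    then show ?thesis using reach_Suc by simp
  next
    case False
    obtain h where h: "h \<in> ureg n k" "\<And>u. u \<in> dom_af F \<Longrightarrow> fun_af F u = h u"
      using AFs_overD(4)[OF k F] by auto
    interpret row_exchange k n j F h "dom_af F" w
    proof (rule row_exchange.intro)
      show "is_subfield k" by (rule k)
      show "fun_af F u = h u" if "u \<in> dom_af F" for u by (rule h(2)[OF that])
      show "row_tail n (Suc j) \<subseteq> dom_af F" using Suc.prems(3) by (simp add: j_def)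
    qed (use F Suc.prems False h(1) in \<open>auto simp: j_def w_def\<close>)
    have IH: "reach n k (d + i) Z" if "Z \<in> AFs_over n k" "dom_af Z = N0" for Z
      using Suc.IH[of Z] Suc.prems(1) that KN(2) tail_N0 by (simp add: af_in_def j_def)
    have "\<exists>B. B \<noteq> {} \<and> step_to n k F B \<and> (\<forall>Z\<in>B. reach n k (d + i) Z)"
    proof (cases "\<forall>e\<in>dom_af F. phi e = 0")
      case True
      then have e: "e_step_subgroup n k F N0" "Z0 \<in> e_outputs n k F N0" using e_case by auto
      show ?thesis
      \<comment> \<open>\<open>Z0\<close> only shows that there is an output. The induction
        hypothesis is applied to all outputs and uses nothing but their common domain
        \<open>N0\<close>.\<close>
      proof (intro exI[of _ "e_outputs n k F N0"] conjI ballI)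
        show "step_to n k F (e_outputs n k F N0)" unfolding step_to_def using e(1) by blast
        show "reach n k (d + i) Z" if "Z \<in> e_outputs n k F N0" for Z
          using that by (intro IH) (auto simp: e_outputs_def AFs_on_def)
      qed (use e(2) in auto)
    next
      case False
      then obtain e where "e \<in> dom_af F" "phi e \<noteq> 0" by auto
      then have "eu_step n k F Z0" by (rule eu_case)
      then have "step_to n k F {Z0}" unfolding step_to_def by blast
      then show ?thesis using IH[OF Z0(1,2)] by (intro exI[of _ "{Z0}"]) auto
    qed
    then show ?thesis using Suc.prems(2) by simp
  qed
qed

section \<open>Conjugation of additive functions by rational matrices\<close>

lemma regular_fun_conj:
  assumes f: "f \<in> regular_fun n k" and k: "is_subfield k"
    and \<beta>: "\<beta> \<in> carrier_mat n n" "\<And>i j. i < n \<Longrightarrow> j < n \<Longrightarrow> \<beta> $$ (i, j) \<in> k"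
    and \<gamma>: "\<gamma> \<in> carrier_mat n n" "\<And>i j. i < n \<Longrightarrow> j < n \<Longrightarrow> \<gamma> $$ (i, j) \<in> k"
    and \<beta>\<gamma>: "\<beta> * \<gamma> = 1\<^sub>m n"
  shows "\<exists>f'\<in>regular_fun n k. \<forall>g\<in>carrier_mat n n. f' g = f (\<beta> * g * \<gamma>)"
  using f
proof (induction rule: regular_fun.induct)
  case (const c)
  then show ?case by (intro bexI[OF _ regular_fun.const]) auto
next
  case (coord i j)
  have sum: "(\<lambda>g. \<Sum>x\<in>A. F x g) \<in> regular_fun n k" if "\<And>x. x \<in> A \<Longrightarrow> F x \<in> regular_fun n k"
    for A :: "nat set" and F
    using that by (induction A rule: infinite_finite_induct)
      (auto intro: regular_fun.add regular_fun.const subfield_zero[OF k])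
  show ?case
  proof (intro bexI ballI)
    show "(\<lambda>g. \<Sum>m<n. (\<Sum>l<n. \<beta> $$ (i, l) * g $$ (l, m)) * \<gamma> $$ (m, j)) \<in> regular_fun n k"
      using coord by (intro sum regular_fun.mult regular_fun.const regular_fun.coord \<beta> \<gamma>) auto
    fix g :: "'a mat" assume g: "g \<in> carrier_mat n n"
    show "(\<Sum>m<n. (\<Sum>l<n. \<beta> $$ (i, l) * g $$ (l, m)) * \<gamma> $$ (m, j)) = (\<beta> * g * \<gamma>) $$ (i, j)"
      unfolding entry_mult[OF mult_carrier_mat[OF \<beta>(1) g] \<gamma>(1) coord]
      using entry_mult[OF \<beta>(1) g coord(1)] by simp
  qed
next
  case inv_det
  have "det (\<beta> * g * \<gamma>) = det g" if g: "g \<in> carrier_mat n n" for g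
  proof -
    have "det (\<beta> * g * \<gamma>) = det (\<beta> * \<gamma>) * det g"
      using det_mult[OF mult_carrier_mat[OF \<beta>(1) g] \<gamma>(1)] det_mult[OF \<beta>(1) g] det_mult[OF \<beta>(1) \<gamma>(1)] by simp
    then show ?thesis by (simp add: \<beta>\<gamma>)
  qed
  then show ?case by (intro bexI[OF _ regular_fun.inv_det]) simp
next
  case (add f h)
  then obtain f' h' where "f' \<in> regular_fun n k" "h' \<in> regular_fun n k"
    "\<forall>g\<in>carrier_mat n n. f' g = f (\<beta> * g * \<gamma>)" "\<forall>g\<in>carrier_mat n n. h' g = h (\<beta> * g * \<gamma>)" by blast
  then show ?case by (intro bexI[OF _ regular_fun.add[of f' n k h']]) auto
next
  case (mult f h)
  then obtain f' h' where "f' \<in> regular_fun n k" "h' \<in> regular_fun n k"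
    "\<forall>g\<in>carrier_mat n n. f' g = f (\<beta> * g * \<gamma>)" "\<forall>g\<in>carrier_mat n n. h' g = h (\<beta> * g * \<gamma>)" by blast
  then show ?case by (intro bexI[OF _ regular_fun.mult[of f' n k h']]) auto
qed

text \<open>Only the image of the domain is known to lie in \<open>U_n\<close>;
  \<open>\<gamma>\<close> need not normalize \<open>U_n\<close>. Functions are therefore transported
  as regular functions on \<open>GL_n\<close>, and density by conjugating rational points.\<close>

lemma conj_af_AFs_over:
  fixes k :: "'a::field_char_0 set"
  assumes k: "is_subfield k" and F: "af_in n k F"
    and \<gamma>: "\<gamma> \<in> carrier_mat n n" "\<And>i j. i < n \<Longrightarrow> j < n \<Longrightarrow> \<gamma> $$ (i, j) \<in> k"
    and \<beta>: "\<beta> \<in> carrier_mat n n" "\<And>i j. i < n \<Longrightarrow> j < n \<Longrightarrow> \<beta> $$ (i, j) \<in> k"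
    and \<gamma>\<beta>: "\<gamma> * \<beta> = 1\<^sub>m n"
    and U: "\<And>u. u \<in> dom_af F \<Longrightarrow> \<gamma> * u * \<beta> \<in> unitriangular n"
  shows "af_in n k (conj_af n \<gamma> F)"
proof -
  note G = GL_inv_eqI[OF \<gamma>\<beta> \<gamma>(1) \<beta>(1)]
  have \<beta>\<gamma>: "\<beta> * \<gamma> = 1\<^sub>m n" using GL_l_inv[OF G(1)] G(3) by simp
  have F': "F \<in> AFs_over n k" "dom_af F \<subseteq> unitriangular n" using F by (auto simp: af_in_def)
  define D where "D = dom_af F"
  have KD: "k_group n k D" unfolding D_def by (rule AFs_overD(1)[OF k F'])
  note K = k_groupD[OF KD]
  define E where "E = (\<lambda>u. \<gamma> * u * \<beta>) ` D"
  have cancel: "\<beta> * (\<gamma> * u * \<beta>) * \<gamma> = u" "\<gamma> * (\<beta> * u * \<gamma>) * \<beta> = u" if "u \<in> carrier (GL n)" for u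
    using that G(1,2) unfolding G(3)[symmetric] by (simp_all add: GL_simps[where n = n])
  have E_iff: "u \<in> E \<longleftrightarrow> u \<in> carrier (GL n) \<and> \<beta> * u * \<gamma> \<in> D" for u
  proof
    assume "u \<in> E"
    then obtain d where d: "d \<in> D" "u = \<gamma> * d * \<beta>" by (auto simp: E_def)
    then show "u \<in> carrier (GL n) \<and> \<beta> * u * \<gamma> \<in> D"
      using cancel(1)[OF K(6)[OF d(1)]] G(1,2) K(6)[OF d(1)] by (simp add: GL_mult_closed)
  next
    assume u: "u \<in> carrier (GL n) \<and> \<beta> * u * \<gamma> \<in> D"
    then have "u = \<gamma> * (\<beta> * u * \<gamma>) * \<beta>" using cancel(2) by simp
    then show "u \<in> E" unfolding E_def using u by blast
  qed
  have EU: "E \<subseteq> unitriangular n" using U by (auto simp: E_def D_def)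
  have \<gamma>\<beta>_mult: "\<gamma> * (u * v) * \<beta> = (\<gamma> * u * \<beta>) * (\<gamma> * v * \<beta>)" "\<beta> * (u * v) * \<gamma> = (\<beta> * u * \<gamma>) * (\<beta> * v * \<gamma>)"
    if "u \<in> carrier (GL n)" "v \<in> carrier (GL n)" for u v
    using that G(1,2) unfolding G(3)[symmetric] by (simp_all add: GL_simps[where n = n])
  have \<gamma>\<beta>_inv: "ginv n (\<gamma> * u * \<beta>) = \<gamma> * ginv n u * \<beta>" if "u \<in> carrier (GL n)" for u
    using that G(1,2) unfolding G(3)[symmetric] by (simp_all add: GL_simps[where n = n])
  have sg: "subgroup E (GL n)"
  proof (rule subgroupI_GL)
    show "E \<subseteq> carrier (GL n)" using EU unitriangular_GL by blast
    have "\<gamma> * 1\<^sub>m n * \<beta> = 1\<^sub>m n" using \<gamma>(1) \<gamma>\<beta> by simp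
    then show "1\<^sub>m n \<in> E" unfolding E_def using subgroupD_GL(1)[OF K(1)] by (metis imageI)
    show "g * h \<in> E" if gh: "g \<in> E" "h \<in> E" for g h
    proof -
      obtain u v where uv: "u \<in> D" "v \<in> D" "g = \<gamma> * u * \<beta>" "h = \<gamma> * v * \<beta>" using gh by (auto simp: E_def)
      then have "g * h = \<gamma> * (u * v) * \<beta>" using \<gamma>\<beta>_mult(1)[OF K(6)[OF uv(1)] K(6)[OF uv(2)]] by simp
      then show ?thesis unfolding E_def using subgroupD_GL(2)[OF K(1) uv(1,2)] by blast
    qed
    show "ginv n g \<in> E" if g: "g \<in> E" for g
    proof -
      obtain u where u: "u \<in> D" "g = \<gamma> * u * \<beta>" using g by (auto simp: E_def)
      then have "ginv n g = \<gamma> * ginv n u * \<beta>" using \<gamma>\<beta>_inv[OF K(6)[OF u(1)]] by simp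
      then show ?thesis unfolding E_def using subgroupD_GL(3)[OF K(1) u(1)] by blast
    qed
  qed
  have cl: "zariski_closed n E"
  proof -
    obtain S where S: "S \<subseteq> regular_fun n UNIV" "D = {g \<in> carrier (GL n). \<forall>f\<in>S. f g = 0}"
      using K(3) by (auto simp: zariski_closed_def)
    define T where "T = {f' \<in> regular_fun n UNIV. \<exists>f\<in>S. \<forall>g\<in>carrier_mat n n. f' g = f (\<beta> * g * \<gamma>)}"
    have "E = {g \<in> carrier (GL n). \<forall>f\<in>T. f g = 0}"
    proof (intro Set.set_eqI iffI)
      fix g assume "g \<in> E"
      then have g: "g \<in> carrier (GL n)" "\<beta> * g * \<gamma> \<in> D" using E_iff by auto
      then have "f' g = 0" if "f' \<in> T" for f' using that S(2) GL_carrier_mat[OF g(1)] by (auto simp: T_def)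
      then show "g \<in> {g \<in> carrier (GL n). \<forall>f\<in>T. f g = 0}" using g by simp
    next
      fix g assume g: "g \<in> {g \<in> carrier (GL n). \<forall>f\<in>T. f g = 0}"
      then have gG: "g \<in> carrier (GL n)" and gT: "\<And>f. f \<in> T \<Longrightarrow> f g = 0" by simp_all
      have "f (\<beta> * g * \<gamma>) = 0" if f: "f \<in> S" for f
      proof -
        obtain f' where f': "f' \<in> regular_fun n UNIV" "\<forall>g\<in>carrier_mat n n. f' g = f (\<beta> * g * \<gamma>)"
          using regular_fun_conj[OF subsetD[OF S(1) f] subfield_UNIV \<beta>(1) _ \<gamma>(1) _ \<beta>\<gamma>] by auto
        then have "f' \<in> T" using f unfolding T_def by blast
        then have "f' g = 0" by (rule gT)
        then show ?thesis using bspec[OF f'(2) GL_carrier_mat[OF gG]] by simp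
      qed
      then have "\<beta> * g * \<gamma> \<in> D" using S(2) gG G(1,2) by (simp add: GL_mult_closed)
      then show "g \<in> E" using E_iff gG by simp
    qed
    moreover have "T \<subseteq> regular_fun n UNIV" by (auto simp: T_def)
    ultimately show ?thesis unfolding zariski_closed_def by blast
  qed
  have kmat: "(a * b) $$ (i, j) \<in> k" if "a \<in> carrier_mat n n" "b \<in> carrier_mat n n" "i < n" "j < n"
    "\<And>i j. i < n \<Longrightarrow> j < n \<Longrightarrow> a $$ (i, j) \<in> k" "\<And>i j. i < n \<Longrightarrow> j < n \<Longrightarrow> b $$ (i, j) \<in> k" for a b i j
    unfolding entry_mult[OF that(1-4)] by (intro subfield_sum[OF k] subfield_mult[OF k] that) auto
  have dense: "k_dense n k E" unfolding k_dense_def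
  proof (intro ballI impI)
    fix f g assume f: "f \<in> ureg n UNIV" and f0: "\<forall>g\<in>rat_points n k E. f g = 0" and g: "g \<in> E"
    obtain q where q: "q \<in> regular_fun n UNIV" "\<And>u. u \<in> unitriangular n \<Longrightarrow> f u = q u"
      using f by (rule uregE) blast
    obtain q' where q': "q' \<in> regular_fun n UNIV" "\<forall>g\<in>carrier_mat n n. q' g = q (\<gamma> * g * \<beta>)"
      using regular_fun_conj[OF q(1) subfield_UNIV \<gamma>(1) _ \<beta>(1) _ \<gamma>\<beta>] by auto
    have eq: "q' d = f (\<gamma> * d * \<beta>)" if "d \<in> D" for d
      using q'(2) q(2)[OF U] GL_carrier_mat[OF K(6)[OF that]] that by (simp add: D_def)
    have q0: "q' d = 0" if "d \<in> rat_points n k D" for d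
    proof -
      have d: "d \<in> D" "\<And>i j. i < n \<Longrightarrow> j < n \<Longrightarrow> d $$ (i, j) \<in> k" using that by (auto simp: rat_points_def)
      have dc: "d \<in> carrier_mat n n" by (rule GL_carrier_mat[OF K(6)[OF d(1)]])
      have "(\<gamma> * d * \<beta>) $$ (i, j) \<in> k" if "i < n" "j < n" for i j
        by (rule kmat[OF mult_carrier_mat[OF \<gamma>(1) dc] \<beta>(1) that kmat[OF \<gamma>(1) dc _ _ \<gamma>(2) d(2)] \<beta>(2)])
      moreover have "\<gamma> * d * \<beta> \<in> E" using d(1) by (auto simp: E_def)
      ultimately have "\<gamma> * d * \<beta> \<in> rat_points n k E"
        using unitriangular_GL[OF subsetD[OF EU]] by (simp add: rat_points_def)
      then show ?thesis using f0 eq[OF d(1)] by simp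
    qed
    obtain d where d: "d \<in> D" "g = \<gamma> * d * \<beta>" using g by (auto simp: E_def)
    have "q' d = 0" by (rule k_denseD[OF K(4) regular_fun_ureg[OF q'(1)] q0 d(1)])
    then show "f g = 0" using eq[OF d(1)] d(2) by simp
  qed
  have KE: "k_group n k E" using sg EU cl dense by (simp add: k_group_def)
  obtain f where f: "f \<in> regular_fun n k" "\<And>u. u \<in> D \<Longrightarrow> fun_af F u = f u"
    using F'(1) by (auto simp: AFs_over_def D_def)
  obtain f' where f': "f' \<in> regular_fun n k" "\<forall>g\<in>carrier_mat n n. f' g = f (\<beta> * g * \<gamma>)"
    using regular_fun_conj[OF f(1) k \<beta> \<gamma> \<beta>\<gamma>] by blast
  have f'E: "f' g = fun_af F (\<beta> * g * \<gamma>)" if "g \<in> E" for g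
    using that f'(2) f(2) E_iff[of g] GL_carrier_mat by auto
  have "(E, restrict f' E) \<in> AFs_over n k"
  proof (rule AFs_overI[OF k KE regular_fun_ureg[OF f'(1)]])
    fix u v assume uv: "u \<in> E" "v \<in> E"
    have "u * v \<in> E" using subgroupD_GL(2)[OF sg uv] .
    then show "f' (u * v) = f' u + f' v"
      using f'E uv E_iff[of u] E_iff[of v] \<gamma>\<beta>_mult(2)[of u v] AFs_overD(3)[OF k F', of "\<beta> * u * \<gamma>" "\<beta> * v * \<gamma>"]
      by (simp add: D_def)
  qed
  moreover have "conj_af n \<gamma> F = (E, restrict f' E)"
    unfolding conj_af_def Let_def G(3) D_def[symmetric] E_def[symmetric] using f'E by (auto intro!: restrict_ext)
  ultimately show ?thesis using EU by (simp add: af_in_def)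
qed

text \<open>On \<open>V\<close> an additive function is additive in the row and homogeneous along
  each one-parameter group, hence linear; the proof adds one column at a time.\<close>

lemma sum_rowv_value:
  fixes h :: "'a::field_char_0 mat \<Rightarrow> 'a"
  assumes sg: "subgroup D (GL n)" and cl: "zariski_closed n D" and D: "D \<subseteq> unitriangular n"
    and tail: "row_tail n 1 \<subseteq> D" and h: "h \<in> ureg n k"
    and add: "\<And>u v. u \<in> D \<Longrightarrow> v \<in> D \<Longrightarrow> h (u * v) = h u + h v"
  shows "h (rowv n y) = (\<Sum>l\<in>{1..<n}. h (rowv n (\<lambda>b. if b = l then 1 else 0)) * y l)"
proof -
  have mem: "rowv n x \<in> D" for x
  proof -
    have "rowv n x = rowv n (x(0 := 0))" by (rule rowv_cong) simp
    also have "\<dots> \<in> row_tail n 1" unfolding row_tail_def by auto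
    finally show ?thesis using tail by blast
  qed
  let ?e = "\<lambda>l. rowv n (\<lambda>b. if b = l then 1 else 0)"
  have "h (rowv n (\<lambda>b. if b < j then y b else 0)) = (\<Sum>l\<in>{1..<j}. h (?e l) * y l)" for j
  proof (induction j)
    case 0
    show ?case using add[OF subgroupD_GL(1)[OF sg] subgroupD_GL(1)[OF sg]] by (simp add: rowv_zero)
  next
    case (Suc j)
    show ?case
    proof (cases "j = 0")
      case True
      have "rowv n (\<lambda>b. if b < Suc 0 then y b else 0) = 1\<^sub>m n"
        unfolding rowv_zero[symmetric] by (rule rowv_cong) simp
      then show ?thesis using True add[OF subgroupD_GL(1)[OF sg] subgroupD_GL(1)[OF sg]] by simp
    next
      case False
      have "rowv n (\<lambda>b. if b < Suc j then y b else 0) =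
          rowv n (\<lambda>b. if b < j then y b else 0) * upow n (?e j) (y j)"
        unfolding upow_rowv rowv_mult by (rule rowv_cong) (auto simp: less_Suc_eq)
      then have "h (rowv n (\<lambda>b. if b < Suc j then y b else 0)) = (\<Sum>l\<in>{1..<j}. h (?e l) * y l) + h (upow n (?e j) (y j))"
        using add[OF mem mem] by (simp add: upow_rowv Suc)
      also have "h (upow n (?e j) (y j)) = h (?e j) * y j"
        using additive_upow[OF sg cl D h add mem] by (simp add: mult.commute)
      finally show ?thesis using False by (simp add: sum.atLeastLessThan_Suc)
    qed
  qed
  from this[of n] show ?thesis
    using rowv_cong[of n "\<lambda>b. if b < n then y b else 0" y] by simp
qed

subsection \<open>The mirabolic group and the normalizing co-step\<close>

definition block :: "nat \<Rightarrow> 'a mat \<Rightarrow> 'a mat" where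
  "block m g = mat m m (\<lambda>(a, b). g $$ (Suc a, Suc b))"

lemma block_entry: "a < m \<Longrightarrow> b < m \<Longrightarrow> block m g $$ (a, b) = g $$ (Suc a, Suc b)"
  by (simp add: block_def)

lemma block_carrier: "block m g \<in> carrier_mat m m"
  by (simp add: block_def)

lemma j_embed_carrier: "A \<in> carrier_mat m m \<Longrightarrow> j_embed m A \<in> carrier_mat (Suc m) (Suc m)"
  by (auto simp: j_embed_def four_block_mat_def)

lemma j_embed_entry:
  assumes "A \<in> carrier_mat m m" "a < Suc m" "b < Suc m"
  shows "j_embed m A $$ (a, b) =
    (if a = 0 then if b = 0 then 1 else 0 else if b = 0 then 0 else A $$ (a - 1, b - 1))"
  using assms by (auto simp: j_embed_def four_block_mat_def)

lemma block_j_embed: "A \<in> carrier_mat m m \<Longrightarrow> block m (j_embed m A) = A"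
  by (intro eq_matI) (auto simp: block_def j_embed_entry)

lemma det_j_embed:
  fixes A :: "'a::field mat"
  assumes "A \<in> carrier_mat m m"
  shows "det (j_embed m A) = det A"
  unfolding j_embed_def
  using det_four_block_mat_lower_left_zero[of "1\<^sub>m 1 :: 'a mat" 1 "0\<^sub>m 1 m" m "0\<^sub>m m 1" A] assms by simp

lemma U_P_unitriangular: "U_P n \<subseteq> (unitriangular n :: 'a::field mat set)"
proof
  fix u :: "'a mat" assume u: "u \<in> U_P n"
  then have e: "u $$ (i, j) = 1\<^sub>m n $$ (i, j)" if "i < n" "j < n" "\<not> (i = 0 \<and> j \<noteq> 0)" for i j
    using that by (auto simp: U_P_def)
  show "u \<in> unitriangular n"
  proof (rule unitriangularI)
    show "u \<in> carrier_mat n n" using u by (simp add: U_P_def)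
    show "u $$ (i, i) = 1" if "i < n" for i using e[of i i] that by auto
    show "u $$ (i, j) = 0" if "j < i" "i < n" for i j using e[of i j] that by simp
  qed
qed

lemma rowv_U_P: "rowv n x \<in> U_P n"
  by (auto simp: U_P_def rowv_def)

lemma MirI:
  assumes "A \<in> carrier_mat m m" "det A = (1 :: 'a::field)" "v \<in> U_P (Suc m)"
  shows "j_embed m A * v \<in> Mir (Suc m)"
  using assms by (auto simp: Mir_def set_mult_def SL_def)

lemma MirE:
  assumes "g \<in> Mir (Suc m)"
  obtains A :: "'a::field mat" and v where "A \<in> carrier_mat m m" "det A = 1" "v \<in> U_P (Suc m)" "g = j_embed m A * v"
  using assms by (auto simp: Mir_def set_mult_def SL_def)

lemma Mir_props:
  fixes g :: "'a::field mat"
  assumes "g \<in> Mir (Suc m)"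
  shows "g \<in> carrier_mat (Suc m) (Suc m)" "det g = 1"
    "a < Suc m \<Longrightarrow> g $$ (a, 0) = (if a = 0 then 1 else 0)"
proof -
  obtain A :: "'a mat" and v where A: "A \<in> carrier_mat m m" "det A = 1" and v: "v \<in> U_P (Suc m)"
    and g: "g = j_embed m A * v" using assms by (rule MirE)
  have vU: "v \<in> unitriangular (Suc m)" using v U_P_unitriangular by blast
  note J = j_embed_carrier[OF A(1)] and V = unitriangularD(1)[OF vU]
  show "g \<in> carrier_mat (Suc m) (Suc m)" unfolding g by (rule mult_carrier_mat[OF J V])
  show "det g = 1" unfolding g using det_mult[OF J V] det_j_embed[OF A(1)] A(2) unitriangular_det[OF vU] by simp
  show "g $$ (a, 0) = (if a = 0 then 1 else 0)" if a: "a < Suc m"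
  proof -
    have "g $$ (a, 0) = (\<Sum>l<Suc m. if l = 0 then j_embed m A $$ (a, 0) else 0)"
      unfolding g entry_mult[OF J V a zero_less_Suc]
      by (intro sum.cong) (use unitriangular_first_column[OF vU] in auto)
    then show ?thesis using j_embed_entry[OF A(1) a, of 0] by (simp add: sum.delta del: sum.lessThan_Suc)
  qed
qed

text \<open>The decomposition \<open>U_n = j(U_(n-1)) V\<close>. The first row of \<open>j\<close>
  is the first unit vector, so the row factor is just the first row of \<open>u\<close>.\<close>

lemma j_embed_rowv:
  assumes u: "u \<in> unitriangular (Suc m)"
  shows "u = j_embed m (block m u) * rowv (Suc m) (\<lambda>b. u $$ (0, b))"
proof (rule eq_matI)
  note U = unitriangularD[OF u]
  fix a b assume "a < dim_row (j_embed m (block m u) * rowv (Suc m) (\<lambda>b. u $$ (0, b)))"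
    "b < dim_col (j_embed m (block m u) * rowv (Suc m) (\<lambda>b. u $$ (0, b)))"
  then have ab: "a < Suc m" "b < Suc m"
    using j_embed_carrier[OF block_carrier, of m u] by (auto simp: rowv_def)
  show "u $$ (a, b) = (j_embed m (block m u) * rowv (Suc m) (\<lambda>b. u $$ (0, b))) $$ (a, b)"
    unfolding rowv_right_mult[OF j_embed_carrier[OF block_carrier] ab]
    using ab U(2)[of 0] U(3)[of 0 a] by (auto simp: j_embed_entry[OF block_carrier] block_entry)
qed (use unitriangularD[OF u] j_embed_carrier[OF block_carrier, of m u] in \<open>auto simp: rowv_def\<close>)

lemma block_unitriangular: "u \<in> unitriangular (Suc m) \<Longrightarrow> block m u \<in> unitriangular m"
  by (rule unitriangularI) (use unitriangularD[of u "Suc m"] in \<open>auto simp: block_def\<close>)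

lemma j_embed_unitriangular:
  assumes u: "u \<in> unitriangular m"
  shows "j_embed m u \<in> unitriangular (Suc m)"
proof (rule unitriangularI)
  note U = unitriangularD[OF u]
  show "j_embed m u \<in> carrier_mat (Suc m) (Suc m)" by (rule j_embed_carrier[OF U(1)])
  show "j_embed m u $$ (i, i) = 1" if "i < Suc m" for i
    using that U(2)[of "i - 1"] by (auto simp: j_embed_entry[OF U(1)])
  show "j_embed m u $$ (i, j) = 0" if "j < i" "i < Suc m" for i j
    using that U(3)[of "j - 1" "i - 1"] by (auto simp: j_embed_entry[OF U(1)])
qed

lemma unitriangular_Mir: "unitriangular (Suc m) \<subseteq> (Mir (Suc m) :: 'a::field mat set)"
proof
  fix u :: "'a mat" assume u: "u \<in> unitriangular (Suc m)"
  have "j_embed m (block m u) * rowv (Suc m) (\<lambda>b. u $$ (0, b)) \<in> Mir (Suc m)"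
    by (rule MirI[OF block_carrier unitriangular_det[OF block_unitriangular[OF u]] rowv_U_P])
  then show "u \<in> Mir (Suc m)" using j_embed_rowv[OF u] by simp
qed

lemma j_embed_Mir:
  fixes A :: "'a::field mat"
  assumes "A \<in> carrier_mat m m" "det A = 1"
  shows "j_embed m A \<in> Mir (Suc m)"
  using MirI[OF assms rowv_U_P[of "Suc m" "\<lambda>b. 0"]] j_embed_carrier[OF assms(1)] by (simp add: rowv_zero)

text \<open>With \<open>x\<close> a vector whose last nonzero entry has index \<open>p\<close>, the columns \<open>1, 2, \<dots>\<close> of \<open>flag_inv\<close>
  are the basis \<open>x / (s x\<^sub>p), e\<^sub>1, \<dots>, e\<^sub>p\<^sub>-\<^sub>1, e\<^sub>p\<^sub>+\<^sub>1, \<dots>\<close>, whose flag is stable under every upper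
  unitriangular matrix that fixes \<open>x\<close>; \<open>flag_mat\<close> is its inverse, and \<open>s\<close> serves to make the
  determinant 1.\<close>

definition flag_mat :: "nat \<Rightarrow> nat \<Rightarrow> (nat \<Rightarrow> 'a::field) \<Rightarrow> 'a \<Rightarrow> 'a mat" where
  "flag_mat n p x s = mat n n (\<lambda>(a, b).
     if a = 0 then (if b = 0 then 1 else 0)
     else if a = 1 then (if b = p then s else 0)
     else if a \<le> p then (if b = a - 1 then 1 else if b = p then - (x (a - 1) / x p) else 0)
     else (if b = a then 1 else 0))"

definition flag_inv :: "nat \<Rightarrow> nat \<Rightarrow> (nat \<Rightarrow> 'a::field) \<Rightarrow> 'a \<Rightarrow> 'a mat" where
  "flag_inv n p x s = mat n n (\<lambda>(a, b).
     if b = 0 then (if a = 0 then 1 else 0)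
     else if b = 1 then (if a = 0 then 0 else x a / (s * x p))
     else if b \<le> p then (if a = b - 1 then 1 else 0)
     else (if a = b then 1 else 0))"

lemma flag_carrier: "flag_mat n p x s \<in> carrier_mat n n" "flag_inv n p x s \<in> carrier_mat n n"
  by (simp_all add: flag_mat_def flag_inv_def)

text \<open>The matrix as a row operation: row \<open>p\<close> is scaled and moved to the top of
  the block, and the rows \<open>1, ..., p - 1\<close> move down by one after losing the multiple of
  row \<open>p\<close> that kills \<open>x\<close>.\<close>

lemma flag_mult_entry:
  assumes p: "0 < p" "p < n" and g: "g \<in> carrier_mat n n" and ab: "a < n" "b < n"
  shows "(flag_mat n p x s * g) $$ (a, b) =
    (if a = 0 then g $$ (0, b) else if a = 1 then s * g $$ (p, b)
     else if a \<le> p then g $$ (a - 1, b) - x (a - 1) / x p * g $$ (p, b) else g $$ (a, b))"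
proof -
  have *: "(flag_mat n p x s * g) $$ (a, b) = (\<Sum>l<n. flag_mat n p x s $$ (a, l) * g $$ (l, b))"
    by (rule entry_mult[OF flag_carrier(1) g ab])
  consider "a = 0" | "a = 1" | "1 < a" "a \<le> p" | "p < a" "1 < a" using p by linarith
  then show ?thesis
  proof cases
    case 1
    have "(\<Sum>l<n. flag_mat n p x s $$ (a, l) * g $$ (l, b)) = (\<Sum>l<n. if l = 0 then g $$ (0, b) else 0)"
      using 1 ab by (intro sum.cong) (auto simp: flag_mat_def)
    then show ?thesis using * 1 ab by simp
  next
    case 2
    have "(\<Sum>l<n. flag_mat n p x s $$ (a, l) * g $$ (l, b)) = (\<Sum>l<n. if l = p then s * g $$ (p, b) else 0)"
      using 2 ab by (intro sum.cong) (auto simp: flag_mat_def)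
    then show ?thesis using * 2 p by simp
  next
    case 3
    have "(\<Sum>l<n. flag_mat n p x s $$ (a, l) * g $$ (l, b)) =
       (\<Sum>l<n. (if l = a - 1 then g $$ (a - 1, b) else 0) + (if l = p then - (x (a - 1) / x p) * g $$ (p, b) else 0))"
      using 3 ab by (intro sum.cong) (auto simp: flag_mat_def)
    also have "\<dots> = g $$ (a - 1, b) + - (x (a - 1) / x p) * g $$ (p, b)"
      using p ab 3 unfolding sum.distrib by simp
    finally show ?thesis using * 3 by simp
  next
    case 4
    have "(\<Sum>l<n. flag_mat n p x s $$ (a, l) * g $$ (l, b)) = (\<Sum>l<n. if l = a then g $$ (a, b) else 0)"
      using 4 ab by (intro sum.cong) (auto simp: flag_mat_def)
    then show ?thesis using * 4 ab by simp
  qed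
qed

lemma flag_inverse:
  assumes p: "0 < p" "p < n" and xp: "x p \<noteq> 0" "\<And>l. p < l \<Longrightarrow> l < n \<Longrightarrow> x l = 0" and s: "s \<noteq> (0 :: 'a::field)"
  shows "flag_mat n p x s * flag_inv n p x s = 1\<^sub>m n"
proof (rule eq_matI)
  fix a b assume "a < dim_row (1\<^sub>m n :: 'a mat)" "b < dim_col (1\<^sub>m n :: 'a mat)"
  then have ab: "a < n" "b < n" by auto
  consider "b = 0" | "b = 1" | "1 < b" "b \<le> p" | "p < b" "1 < b" using p by linarith
  then show "(flag_mat n p x s * flag_inv n p x s) $$ (a, b) = 1\<^sub>m n $$ (a, b)"
    unfolding flag_mult_entry[OF p flag_carrier(2) ab]
  proof cases
    case 2
    then show "(if a = 0 then flag_inv n p x s $$ (0, b) else if a = 1 then s * flag_inv n p x s $$ (p, b)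
      else if a \<le> p then flag_inv n p x s $$ (a - 1, b) - x (a - 1) / x p * flag_inv n p x s $$ (p, b)
      else flag_inv n p x s $$ (a, b)) = 1\<^sub>m n $$ (a, b)"
      using ab p xp s by (auto simp: flag_inv_def)
  qed (use ab p in \<open>auto simp: flag_inv_def\<close>)
qed (simp_all add: flag_mat_def flag_inv_def)

lemma flag_rational:
  assumes k: "is_subfield k" and "\<And>l. 0 < l \<Longrightarrow> l < n \<Longrightarrow> x l \<in> k" "s \<in> k" "0 < p" "p < n" "a < n" "b < n"
  shows "flag_mat n p x s $$ (a, b) \<in> k" "flag_inv n p x s $$ (a, b) \<in> k"
  using assms(2-) subfield_zero[OF k] subfield_one[OF k]
  by (auto simp: flag_mat_def flag_inv_def
      intro!: subfield_uminus[OF k] subfield_divide[OF k] subfield_mult[OF k])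

text \<open>The determinant is linear in row 1, the only one that involves \<open>s\<close>; so a
  suitable \<open>s\<close> makes it 1.\<close>

lemma flag_det:
  fixes x :: "nat \<Rightarrow> 'a::field"
  assumes p: "0 < p" "p < n"
  shows "det (flag_mat n p x s) = s * det (flag_mat n p x 1)"
proof -
  have "flag_mat n p x s = multrow 1 s (flag_mat n p x 1)"
    by (rule eq_matI) (auto simp: flag_mat_def)
  then show ?thesis using det_multrow[of 1 n "flag_mat n p x 1" s] flag_carrier(1)[of n p x 1] p by simp
qed

lemma flag_conj_unitriangular:
  fixes x :: "nat \<Rightarrow> 'a::field"
  assumes p: "0 < p" "p < n" and xp: "x p \<noteq> 0" "\<And>l. p < l \<Longrightarrow> l < n \<Longrightarrow> x l = 0" and s: "s \<noteq> 0"
    and d: "d \<in> unitriangular n"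
    and fix_x: "\<And>a. 0 < a \<Longrightarrow> a < n \<Longrightarrow> (\<Sum>l\<in>{1..<n}. d $$ (a, l) * x l) = x a"
  shows "flag_mat n p x s * d * flag_inv n p x s \<in> unitriangular n"
proof -
  note U = unitriangularD[OF d]
  define M where "M = d * flag_inv n p x s"
  have M: "M \<in> carrier_mat n n" unfolding M_def by (rule mult_carrier_mat[OF U(1) flag_carrier(2)])
  have Me: "M $$ (a, b) = (\<Sum>l<n. d $$ (a, l) * flag_inv n p x s $$ (l, b))" if "a < n" "b < n" for a b
    unfolding M_def by (rule entry_mult[OF U(1) flag_carrier(2) that])
  have M0: "M $$ (a, 0) = (if a = 0 then 1 else 0)" if a: "a < n" for a
  proof -
    have "M $$ (a, 0) = (\<Sum>l<n. if l = 0 then d $$ (a, 0) else 0)"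
      using a p unfolding Me[OF a less_trans[OF p]] by (intro sum.cong) (auto simp: flag_inv_def)
    then show ?thesis using a p unitriangular_first_column[OF d a] by simp
  qed
  \<comment> \<open>Column 1 of \<open>flag_inv\<close> is a multiple of \<open>x\<close>, which
    \<open>d\<close> fixes. Row 0 is left out, since it only matters above the diagonal.\<close>
  have M1: "M $$ (a, 1) = x a / (s * x p)" if a: "0 < a" "a < n" for a
  proof -
    have n1: "1 < n" using p by simp
    have "M $$ (a, 1) = (\<Sum>l<n. if l \<in> {1..<n} then d $$ (a, l) * x l / (s * x p) else 0)"
      using a n1 unfolding Me[OF a(2) n1] by (intro sum.cong) (auto simp: flag_inv_def)
    also have "\<dots> = (\<Sum>l\<in>{..<n} \<inter> {1..<n}. d $$ (a, l) * x l / (s * x p))"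
      by (rule sum.inter_restrict[symmetric]) simp
    also have "{..<n} \<inter> {1..<n} = {1..<n}" by auto
    finally show ?thesis unfolding sum_divide_distrib[symmetric] fix_x[OF a] .
  qed
  have M2: "M $$ (a, b) = d $$ (a, b - 1)" if "a < n" "1 < b" "b \<le> p" for a b
  proof -
    have bn: "b < n" using that p by simp
    have "M $$ (a, b) = (\<Sum>l<n. if l = b - 1 then d $$ (a, b - 1) else 0)"
      using that bn unfolding Me[OF that(1) bn] by (intro sum.cong) (auto simp: flag_inv_def)
    then show ?thesis using bn by simp
  qed
  have M3: "M $$ (a, b) = d $$ (a, b)" if "a < n" "p < b" "b < n" "1 < b" for a b
  proof -
    have "M $$ (a, b) = (\<Sum>l<n. if l = b then d $$ (a, b) else 0)"
      using that unfolding Me[OF that(1) that(3)] by (intro sum.cong) (auto simp: flag_inv_def)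
    then show ?thesis using that by simp
  qed
  have E: "(flag_mat n p x s * M) $$ (a, b) = (if a = b then 1 else 0)" if ab: "a < n" "b \<le> a" for a b
  proof -
    have bn: "b < n" using ab by simp
    note F = flag_mult_entry[OF p M ab(1) bn]
    consider "b = 0" | "b = 1" | "1 < b" "b \<le> p" | "p < b" "1 < b" using p by linarith
    then show ?thesis
    proof cases
      case 1
      then show ?thesis unfolding F using M0 ab p by auto
    next
      case 2
      then have a: "0 < a" using ab by simp
      show ?thesis
      proof (cases "a = 1")
        case True
        then show ?thesis unfolding F using 2 M1[OF p] xp(1) s by simp
      next
        case False
        then show ?thesis unfolding F using 2 a M1[of "a - 1"] M1[of p] M1[of a] xp s p ab by auto
      qed
    next
      \<comment> \<open>Here column \<open>b\<close> of \<open>M\<close> is column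
        \<open>b - 1\<close> of \<open>d\<close>. The row operation shifts rows down by one as well,
        so the diagonal of \<open>d\<close> lands on the diagonal; the entry in row \<open>p\<close>
        vanishes as \<open>b - 1 < p\<close>.\<close>
      case 3
      show ?thesis
      proof (cases "a \<le> p")
        case True
        then have "M $$ (a - 1, b) = (if a = b then 1 else 0)" "M $$ (p, b) = 0"
          using M2[of "a - 1" b] M2[of p b] U(2)[of "b - 1"] U(3)[of "b - 1" "a - 1"] U(3)[of "b - 1" p] 3 ab p by auto
        then show ?thesis unfolding F using True 3 ab by auto
      next
        case False
        then show ?thesis unfolding F using M2[OF ab(1) 3] U(3)[of "b - 1" a] 3 ab by auto
      qed
    next
      case 4
      then show ?thesis unfolding F using M3[OF ab(1) 4(1) bn 4(2)] U(2)[of a] U(3)[of b a] ab by auto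
    qed
  qed
  have "flag_mat n p x s * M \<in> unitriangular n"
    by (rule unitriangularI) (use E M flag_carrier(1)[of n p x s] in auto)
  then show ?thesis unfolding M_def using assoc_mult_mat[OF flag_carrier(1) U(1) flag_carrier(2), of p x s p x s] by simp
qed

lemma flag_Mir:
  fixes x :: "nat \<Rightarrow> 'a::field"
  assumes p: "0 < p" "p < Suc m" and det: "det (flag_mat (Suc m) p x s) = 1"
  shows "flag_mat (Suc m) p x s \<in> Mir (Suc m)"
proof -
  have eq: "flag_mat (Suc m) p x s = j_embed m (block m (flag_mat (Suc m) p x s))"
  proof (rule eq_matI)
    fix a b assume "a < dim_row (j_embed m (block m (flag_mat (Suc m) p x s)))"
      "b < dim_col (j_embed m (block m (flag_mat (Suc m) p x s)))"
    then have ab: "a < Suc m" "b < Suc m" using j_embed_carrier[OF block_carrier, of m "flag_mat (Suc m) p x s"] by auto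
    then show "flag_mat (Suc m) p x s $$ (a, b) = j_embed m (block m (flag_mat (Suc m) p x s)) $$ (a, b)"
      unfolding j_embed_entry[OF block_carrier ab]
      by (cases a; cases b) (use p in \<open>auto simp: block_entry flag_mat_def\<close>)
  qed (use j_embed_carrier[OF block_carrier, of m "flag_mat (Suc m) p x s"] in \<open>auto simp: flag_mat_def\<close>)
  show ?thesis
    by (subst eq) (intro j_embed_Mir block_carrier, use det eq det_j_embed[OF block_carrier] in metis)
qed

text \<open>The row vector \<open>x\<close> that describes \<open>F\<close> on \<open>V\<close> is
  fixed by the whole domain, so the flag matrix built from \<open>x\<close> is an admissible
  co-step. If \<open>x = 0\<close>, the hypothesis \<open>base\<close> already applies with
  \<open>c = 0\<close>.\<close>

lemma reach_flag:
  fixes k :: "'a::field_char_0 set"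
  assumes k: "is_subfield k" and F: "af_in (Suc m) k F" and tail: "row_tail (Suc m) 1 \<subseteq> dom_af F"
    and base: "\<And>G c. af_in (Suc m) k G \<Longrightarrow> row_tail (Suc m) 1 \<subseteq> dom_af G \<Longrightarrow> c \<in> k \<Longrightarrow>
      (\<And>y. fun_af G (rowv (Suc m) y) = c * y 1) \<Longrightarrow> reach (Suc m) k d G"
    and m: "0 < m"
  shows "reach (Suc m) k (Suc d) F"
proof -
  define n where "n = Suc m"
  have F': "F \<in> AFs_over n k" "dom_af F \<subseteq> unitriangular n" using F by (auto simp: af_in_def n_def)
  define D where "D = dom_af F"
  have KD: "k_group n k D" unfolding D_def by (rule AFs_overD(1)[OF k F'])
  note K = k_groupD[OF KD] and Dsub = subgroupD_GL[OF k_groupD(1)[OF KD]]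
  obtain h where h: "h \<in> ureg n k" "\<And>u. u \<in> D \<Longrightarrow> fun_af F u = h u"
    using AFs_overD(4)[OF k F'] by (auto simp: D_def)
  have add: "h (u * v) = h u + h v" if "u \<in> D" "v \<in> D" for u v
    using AFs_overD(3)[OF k F', of u v] h(2) that Dsub(2)[OF that] by (simp add: D_def)
  have rowD: "rowv n y \<in> D" for y
  proof -
    have "rowv n y = rowv n (y(0 := 0))" by (rule rowv_cong) simp
    moreover have "rowv n (y(0 := 0)) \<in> row_tail n 1" unfolding row_tail_def by auto
    ultimately show ?thesis using tail by (auto simp: D_def n_def)
  qed
  define x where "x l = h (rowv n (\<lambda>b. if b = l then 1 else 0))" for l
  have tail': "row_tail n 1 \<subseteq> D" using tail by (simp add: D_def n_def)
  have val: "h (rowv n y) = (\<Sum>l\<in>{1..<n}. x l * y l)" for y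
    unfolding x_def by (rule sum_rowv_value[OF K(1,3,2) tail' h(1) add])
  have xk: "x l \<in> k" for l unfolding x_def
    by (rule ureg_rational[OF k h(1) rowv_unitriangular])
       (simp add: rowv_entry subfield_zero[OF k] subfield_one[OF k])
  show ?thesis
  proof (cases "\<forall>l\<in>{1..<n}. x l = 0")
    case True
    then have "fun_af F (rowv n y) = 0 * y 1" for y using h(2)[OF rowD] val by simp
    then have "reach (Suc m) k d F"
      using base[OF F tail subfield_zero[OF k]] by (simp add: n_def)
    then show ?thesis by (rule reach_Suc)
  next
    case False
    define p where "p = Max {l \<in> {1..<n}. x l \<noteq> 0}"
    have "p \<in> {l \<in> {1..<n}. x l \<noteq> 0}" unfolding p_def by (rule Max_in) (use False in auto)
    then have p: "0 < p" "p < n" and xp: "x p \<noteq> 0" by auto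
    have xl: "x l = 0" if "p < l" "l < n" for l
    proof (rule ccontr)
      assume "x l \<noteq> 0"
      then have "l \<le> p" unfolding p_def using that p by (intro Max_ge) auto
      then show False using that by simp
    qed
    \<comment> \<open>\<open>F\<close> takes equal values at the row of the unit vector
      \<open>a\<close> and at its conjugate by \<open>u^-1\<close>. The conjugate has row
      \<open>a\<close> of \<open>u\<close> as its row, and evaluating \<open>F\<close> on it gives
      the sum.\<close>
    have fix_x: "(\<Sum>l\<in>{1..<n}. u $$ (a, l) * x l) = x a" if u: "u \<in> D" and a: "0 < a" "a < n" for u a
    proof -
      have e: "ginv n u \<in> D" by (rule Dsub(3)[OF u])
      have eu: "ginv n (ginv n u) = u" using GL_one_mult(3)[OF K(6)[OF u]] .
      have "ginv n u * rowv n (\<lambda>b. if b = a then 1 else 0) * ginv n (ginv n u) =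
         rowv n (\<lambda>b. \<Sum>l\<in>{1..<n}. (if l = a then 1 else 0) * u $$ (l, b))"
        using rowv_conj[OF K(6)[OF e] unitriangular_first_column[OF K(5)[OF e]]] eu by simp
      also have "\<dots> = rowv n (\<lambda>b. u $$ (a, b))"
      proof (rule rowv_cong)
        fix b
        have "(\<Sum>l\<in>{1..<n}. (if l = a then 1 else 0) * u $$ (l, b)) = (\<Sum>l\<in>{1..<n}. if l = a then u $$ (a, b) else 0)"
          by (intro sum.cong) auto
        then show "(\<Sum>l\<in>{1..<n}. (if l = a then 1 else 0) * u $$ (l, b)) = u $$ (a, b)" using a by simp
      qed
      finally have "h (rowv n (\<lambda>b. u $$ (a, b))) = h (ginv n u * rowv n (\<lambda>b. if b = a then 1 else 0) * u)"
        using eu by simp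
      also have "\<dots> = x a"
        using add Dsub(2) e u rowD additive_one_inv(2)[OF K(1) add u] by (simp add: x_def)
      finally show ?thesis using val by (simp add: mult.commute)
    qed
    have flag_inv: "flag_mat n p x s * flag_inv n p x s = 1\<^sub>m n" if "s \<noteq> 0" for s
      by (rule flag_inverse[where x = x, OF p xp _ that]) (rule xl)
    define s where "s = inverse (det (flag_mat n p x 1))"
    have "det (flag_mat n p x 1) \<noteq> 0"
      using GL_inv_eqI(1)[OF flag_inv[of 1] flag_carrier] by (simp add: carrier_GL)
    then have s0: "s \<noteq> 0" and det: "det (flag_mat n p x s) = 1" using flag_det[OF p, of x s] by (simp_all add: s_def)
    have sk: "s \<in> k" unfolding s_def
      by (intro subfield_inverse[OF k] subfield_det[OF k flag_carrier(1)] flag_rational[OF k] xk subfield_one[OF k] p)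
    define \<gamma> where "\<gamma> = flag_mat n p x s"
    define \<beta> where "\<beta> = flag_inv n p x s"
    have \<gamma>\<beta>: "\<gamma> * \<beta> = 1\<^sub>m n" unfolding \<gamma>_def \<beta>_def by (rule flag_inv[OF s0])
    have c\<gamma>: "\<gamma> \<in> carrier_mat n n" "\<beta> \<in> carrier_mat n n" by (simp_all add: \<gamma>_def \<beta>_def flag_carrier)
    note G = GL_inv_eqI[OF \<gamma>\<beta> c\<gamma>]
    have \<gamma>k: "\<gamma> $$ (i, j) \<in> k" "\<beta> $$ (i, j) \<in> k" if "i < n" "j < n" for i j
      unfolding \<gamma>_def \<beta>_def by (intro flag_rational[OF k] xk sk p that)+
    have conjU: "\<gamma> * u * \<beta> \<in> unitriangular n" if "u \<in> D" for u
      unfolding \<gamma>_def \<beta>_def by (rule flag_conj_unitriangular[where x = x, OF p xp _ s0 K(5)[OF that]])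
         (use xl fix_x[OF that] in auto)
    define F1 where "F1 = conj_af n \<gamma> F"
    have F1: "af_in n k F1" unfolding F1_def
      by (rule conj_af_AFs_over[OF k _ c\<gamma>(1) \<gamma>k(1) c\<gamma>(2) \<gamma>k(2) \<gamma>\<beta>]) (use F conjU in \<open>auto simp: n_def D_def\<close>)
    have \<gamma>0: "\<gamma> $$ (a, 0) = (if a = 0 then 1 else 0)" if "a < n" for a
      using that p by (auto simp: \<gamma>_def flag_mat_def)
    have \<beta>0: "\<beta> $$ (a, 0) = (if a = 0 then 1 else 0)" if "a < n" for a
      using inv_fixes_first_column[OF G(1) \<gamma>0 that] G(3) by simp
    have \<beta>\<gamma>inv: "ginv n \<beta> = \<gamma>" using G(1,3) GL_one_mult(3)[OF G(1)] by simp
    have conj_row: "\<beta> * rowv n y * \<gamma> = rowv n (\<lambda>b. \<Sum>l\<in>{1..<n}. y l * \<gamma> $$ (l, b))" for y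
      using rowv_conj[OF G(2) \<beta>0, of y] \<beta>\<gamma>inv by simp
    have dom1: "u \<in> dom_af F1 \<longleftrightarrow> \<beta> * u * \<gamma> \<in> D" if "u \<in> carrier (GL n)" for u
    proof -
      have 1: "u = \<gamma> * (\<beta> * u * \<gamma>) * \<beta>" using that G(1,2) unfolding G(3)[symmetric] by (simp add: GL_simps[where n = n])
      have 2: "\<beta> * (\<gamma> * v * \<beta>) * \<gamma> = v" if "v \<in> D" for v
        using K(6)[OF that] G(1,2) unfolding G(3)[symmetric] by (simp add: GL_simps[where n = n])
      have 3: "dom_af F1 = (\<lambda>u. \<gamma> * u * \<beta>) ` D" by (simp add: F1_def conj_af_def Let_def G(3) D_def)
      show ?thesis unfolding 3
      proof
        assume "u \<in> (\<lambda>u. \<gamma> * u * \<beta>) ` D"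
        then obtain v where v: "v \<in> D" "u = \<gamma> * v * \<beta>" by (rule imageE)
        then show "\<beta> * u * \<gamma> \<in> D" using 2[OF v(1)] by simp
      next
        assume "\<beta> * u * \<gamma> \<in> D"
        then show "u \<in> (\<lambda>u. \<gamma> * u * \<beta>) ` D" using 1 by (rule image_eqI[rotated])
      qed
    qed
    have row1: "rowv n y \<in> dom_af F1" for y
      using dom1[OF unitriangular_GL[OF rowv_unitriangular]] conj_row rowD by simp
    \<comment> \<open>After the co-step the describing vector is \<open>\<gamma> x\<close>, which is
      \<open>s x_p\<close> times the first unit vector.\<close>
    have F1_row: "fun_af F1 (rowv n y) = (s * x p) * y 1" for y
    proof -
      have "fun_af F1 (rowv n y) = fun_af F (\<beta> * rowv n y * \<gamma>)"
        using row1[of y] by (simp add: F1_def conj_af_def Let_def G(3))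
      also have "\<dots> = (\<Sum>b\<in>{1..<n}. x b * (\<Sum>l\<in>{1..<n}. y l * \<gamma> $$ (l, b)))"
        unfolding conj_row using h(2)[OF rowD] val by simp
      also have "\<dots> = (\<Sum>l\<in>{1..<n}. y l * (\<Sum>b\<in>{1..<n}. \<gamma> $$ (l, b) * x b))"
        by (simp add: sum_distrib_left mult_ac) (rule sum.swap)
      also have "\<dots> = (\<Sum>l\<in>{1..<n}. if l = 1 then (s * x p) * y 1 else 0)"
      proof (rule sum.cong)
        fix l assume l: "l \<in> {1..<n}"
        \<comment> \<open>All columns of this square matrix are equal to \<open>x\<close>, so that
          \<open>flag_mult_entry\<close> can compute \<open>\<gamma> x\<close>.\<close>
        define X1 where "X1 = mat n n (\<lambda>(a, b). if a = 0 then 0 else x a)"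
        have "(\<Sum>b\<in>{1..<n}. \<gamma> $$ (l, b) * x b) = (\<Sum>b<n. \<gamma> $$ (l, b) * X1 $$ (b, 0))"
          by (rule sum.mono_neutral_cong_left) (use l in \<open>auto simp: X1_def\<close>)
        also have "\<dots> = (\<gamma> * X1) $$ (l, 0)"
          by (rule entry_mult[OF c\<gamma>(1), symmetric]) (use l in \<open>auto simp: X1_def\<close>)
        also have "\<dots> = (if l = 1 then s * x p else 0)"
          unfolding \<gamma>_def using l p xp xl[of l]
          by (subst flag_mult_entry[OF p]) (auto simp: X1_def)
        finally show "y l * (\<Sum>b\<in>{1..<n}. \<gamma> $$ (l, b) * x b) = (if l = 1 then (s * x p) * y 1 else 0)" by simp
      qed simp
      also have "\<dots> = (s * x p) * y 1" using m by (simp add: n_def)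
      finally show ?thesis .
    qed
    have "reach (Suc m) k d F1"
    proof (rule base)
      show "af_in (Suc m) k F1" using F1 by (simp add: n_def)
      show "row_tail (Suc m) 1 \<subseteq> dom_af F1" using row1 by (auto simp: row_tail_def n_def)
      show "s * x p \<in> k" by (rule subfield_mult[OF k sk xk])
      show "fun_af F1 (rowv (Suc m) y) = s * x p * y 1" for y using F1_row by (simp add: n_def)
    qed
    moreover have "step_to (Suc m) k F {F1}"
    proof -
      have "\<gamma> \<in> Mir n" unfolding \<gamma>_def n_def using flag_Mir[of p m x s] p det by (simp add: n_def)
      then have "\<gamma> \<in> rat_points n k (Mir n)" using G(1) \<gamma>k(1) by (auto simp: rat_points_def)
      then show ?thesis unfolding step_to_def F1_def n_def by blast
    qed
    ultimately show ?thesis using F by (auto intro!: exI[of _ "{F1}"])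
  qed
qed

subsection \<open>Lifting from dimension \<open>n - 1\<close>\<close>

text \<open>On this group, which contains \<open>U\<^sub>n\<close> and \<open>j(Mir\<^sub>n\<^sub>-\<^sub>1)\<close>, the entry \<open>(0, 1)\<close> is a homomorphism.\<close>

definition flag_stab :: "nat \<Rightarrow> 'a::field mat set" where
  "flag_stab n = {g \<in> carrier (GL n). (\<forall>a<n. g $$ (a, 0) = (if a = 0 then 1 else 0)) \<and>
     (\<forall>a<n. 0 < a \<longrightarrow> g $$ (a, 1) = (if a = 1 then 1 else 0))}"

lemma flag_stabD:
  assumes "g \<in> flag_stab n"
  shows "g \<in> carrier (GL n)" "g \<in> carrier_mat n n"
    "a < n \<Longrightarrow> g $$ (a, 0) = (if a = 0 then 1 else 0)"
    "a < n \<Longrightarrow> 0 < a \<Longrightarrow> g $$ (a, 1) = (if a = 1 then 1 else 0)"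
  using assms GL_carrier_mat by (auto simp: flag_stab_def)

lemma unitriangular_flag_stab: "1 < n \<Longrightarrow> u \<in> unitriangular n \<Longrightarrow> u \<in> flag_stab n"
  using unitriangularD[of u n] unitriangular_GL[of u n] by (auto simp: flag_stab_def)

lemma flag_stab_columns:
  assumes n: "1 < n" and g: "g \<in> carrier_mat n n" and h: "h \<in> flag_stab n" and a: "a < n"
  shows "(g * h) $$ (a, 0) = g $$ (a, 0)" "(g * h) $$ (a, 1) = g $$ (a, 0) * h $$ (0, 1) + g $$ (a, 1)"
proof -
  note H = flag_stabD[OF h]
  have n0: "0 < n" using n by simp
  have "(g * h) $$ (a, 0) = (\<Sum>l<n. if l = 0 then g $$ (a, 0) else 0)"
    unfolding entry_mult[OF g H(2) a n0] by (intro sum.cong) (auto simp: H(3))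
  then show "(g * h) $$ (a, 0) = g $$ (a, 0)" using n by simp
  have "(g * h) $$ (a, 1) = (\<Sum>l<n. (if l = 0 then g $$ (a, 0) * h $$ (0, 1) else 0) + (if l = 1 then g $$ (a, 1) else 0))"
    unfolding entry_mult[OF g H(2) a n]
  proof (rule sum.cong)
    fix l assume "l \<in> {..<n}"
    then show "g $$ (a, l) * h $$ (l, 1) =
        (if l = 0 then g $$ (a, 0) * h $$ (0, 1) else 0) + (if l = 1 then g $$ (a, 1) else 0)"
      using H(4)[of l] by (cases "l = 0") auto
  qed simp
  then show "(g * h) $$ (a, 1) = g $$ (a, 0) * h $$ (0, 1) + g $$ (a, 1)"
    using n n0 unfolding sum.distrib by simp
qed

lemma flag_stab_mult:
  assumes n: "1 < n" and g: "g \<in> flag_stab n" and h: "h \<in> flag_stab n"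
  shows "g * h \<in> flag_stab n" "(g * h) $$ (0, 1) = g $$ (0, 1) + h $$ (0, 1)"
proof -
  note G = flag_stabD[OF g] and H = flag_stabD[OF h]
  note C = flag_stab_columns[OF n G(2) h]
  show "g * h \<in> flag_stab n"
    unfolding flag_stab_def using GL_mult_closed[OF G(1) H(1)] C G(3,4) by simp
  show "(g * h) $$ (0, 1) = g $$ (0, 1) + h $$ (0, 1)" using C(2)[of 0] G(3)[of 0] n by simp
qed

lemma flag_stab_inv:
  assumes n: "1 < n" and g: "g \<in> flag_stab n"
  shows "ginv n g \<in> flag_stab n"
proof -
  note G = flag_stabD[OF g]
  have iG: "ginv n g \<in> carrier (GL n)" by (rule GL_inv_closed[OF G(1)])
  note C = flag_stab_columns[OF n GL_carrier_mat[OF iG] g]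
  have 0: "ginv n g $$ (a, 0) = (if a = 0 then 1 else 0)" if "a < n" for a
    using C(1)[OF that] GL_l_inv[OF G(1)] that n by simp
  have "ginv n g $$ (a, 1) = (if a = 1 then 1 else 0)" if "a < n" "0 < a" for a
    using C(2)[OF that(1)] GL_l_inv[OF G(1)] 0[OF that(1)] that n by simp
  then show ?thesis using 0 iG by (simp add: flag_stab_def)
qed

text \<open>A homomorphism to a commutative group is invariant under conjugation.\<close>

lemma flag_stab_conj_entry:
  assumes n: "1 < n" and d: "d \<in> flag_stab n" and g: "g \<in> flag_stab n"
  shows "(ginv n d * g * d) $$ (0, 1) = g $$ (0, 1)"
proof -
  note i = flag_stab_inv[OF n d]
  have "(ginv n d * d) $$ (0, 1) = ginv n d $$ (0, 1) + d $$ (0, 1)" by (rule flag_stab_mult(2)[OF n i d])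
  then have "ginv n d $$ (0, 1) + d $$ (0, 1) = 0" using GL_l_inv[OF flag_stabD(1)[OF d]] n by simp
  then show ?thesis
    using flag_stab_mult(2)[OF n flag_stab_mult(1)[OF n i g] d] flag_stab_mult(2)[OF n i g] by (simp add: algebra_simps)
qed

text \<open>The first columns are the first unit vector, so the first row of \<open>h\<close> does
  not enter the lower right block.\<close>

lemma block_mult:
  assumes g: "g \<in> flag_stab (Suc m)" and h: "h \<in> flag_stab (Suc m)"
  shows "block m (g * h) = block m g * block m h"
proof (rule eq_matI)
  note G = flag_stabD[OF g] and H = flag_stabD[OF h]
  fix a b assume "a < dim_row (block m g * block m h)" "b < dim_col (block m g * block m h)"
  then have ab: "a < m" "b < m" by (simp_all add: block_def)
  have "(g * h) $$ (Suc a, Suc b) = (\<Sum>l<Suc m. g $$ (Suc a, l) * h $$ (l, Suc b))"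
    by (rule entry_mult[OF G(2) H(2)]) (use ab in auto)
  also have "\<dots> = (\<Sum>l<m. g $$ (Suc a, Suc l) * h $$ (Suc l, Suc b))"
    unfolding sum.lessThan_Suc_shift using G(3)[of "Suc a"] ab by simp
  finally show "block m (g * h) $$ (a, b) = (block m g * block m h) $$ (a, b)"
    using ab by (simp add: block_entry entry_mult[OF block_carrier block_carrier])
qed (simp_all add: block_def)

lemma block_one: "block m (1\<^sub>m (Suc m)) = 1\<^sub>m m"
  by (rule eq_matI) (auto simp: block_def)

lemma block_inv:
  assumes m: "0 < m" and g: "g \<in> flag_stab (Suc m)"
  shows "block m g \<in> carrier (GL m)" "block m (ginv (Suc m) g) = ginv m (block m g)"
proof -
  have n: "1 < Suc m" using m by simp
  have "block m g * block m (ginv (Suc m) g) = 1\<^sub>m m"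
    using block_mult[OF g flag_stab_inv[OF n g]] GL_r_inv[OF flag_stabD(1)[OF g]] block_one by metis
  from GL_inv_eqI[OF this block_carrier block_carrier]
  show "block m g \<in> carrier (GL m)" "block m (ginv (Suc m) g) = ginv m (block m g)" by auto
qed

lemma unitriangular_blockI:
  assumes g: "g \<in> carrier_mat (Suc m) (Suc m)" and col: "\<And>a. a < Suc m \<Longrightarrow> g $$ (a, 0) = (if a = 0 then 1 else 0)"
    and b: "block m g \<in> unitriangular m"
  shows "g \<in> unitriangular (Suc m)"
proof (rule unitriangularI[OF g])
  note B = unitriangularD[OF b]
  show "g $$ (i, i) = 1" if "i < Suc m" for i
    using that col[of 0] B(2)[of "i - 1"] by (cases i) (auto simp: block_entry)
  show "g $$ (i, j) = 0" if "j < i" "i < Suc m" for i j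
    using that col[of i] B(3)[of "j - 1" "i - 1"] by (cases i; cases j) (auto simp: block_entry)
qed

text \<open>For \<open>E\<close> inside \<open>U_m\<close> this is the group
  \<open>j(E) V\<close>.\<close>

definition pre :: "nat \<Rightarrow> 'a::field mat set \<Rightarrow> 'a mat set" where
  "pre m E = {g \<in> unitriangular (Suc m). block m g \<in> E}"

definition lift_af :: "nat \<Rightarrow> 'a \<Rightarrow> 'a::field af \<Rightarrow> 'a af" where
  "lift_af m c F = (pre m (dom_af F), restrict (\<lambda>g. fun_af F (block m g) + c * g $$ (0, 1)) (pre m (dom_af F)))"

lemma lift_af_dom: "dom_af (lift_af m c F) = pre m (dom_af F)"
  by (simp add: lift_af_def)

lemma lift_af_fun:
  "g \<in> pre m (dom_af F) \<Longrightarrow> fun_af (lift_af m c F) g = fun_af F (block m g) + c * g $$ (0, 1)"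
  by (simp add: lift_af_def)

lemma j_embed_pre: "E \<subseteq> unitriangular m \<Longrightarrow> e \<in> E \<Longrightarrow> j_embed m e \<in> pre m E"
  using unitriangularD(1)[of e m] by (auto simp: pre_def block_j_embed intro: j_embed_unitriangular)

lemma pre_mono_iff:
  assumes "E \<subseteq> unitriangular m"
  shows "pre m E \<subseteq> pre m E' \<longleftrightarrow> E \<subseteq> E'"
proof
  assume *: "pre m E \<subseteq> pre m E'"
  show "E \<subseteq> E'"
  proof
    fix e assume e: "e \<in> E"
    have "e \<in> carrier_mat m m" using e assms unitriangularD(1) by blast
    then show "e \<in> E'" using j_embed_pre[OF assms e] * block_j_embed[of e m] by (auto simp: pre_def)
  qed
qed (auto simp: pre_def)

lemma pre_inj: "E \<subseteq> unitriangular m \<Longrightarrow> E' \<subseteq> unitriangular m \<Longrightarrow> pre m E = pre m E' \<longleftrightarrow> E = E'"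
  using pre_mono_iff by blast

lemma block_rowv: "block m (rowv (Suc m) y) = 1\<^sub>m m"
  by (rule eq_matI) (auto simp: block_def rowv_def)

section \<open>Inflation of groups, additive functions and steps from dimension \<open>m\<close> to
  \<open>Suc m\<close>\<close>

locale mirabolic_lift =
  fixes k :: "'a::field_char_0 set" and m :: nat and c :: 'a
  assumes k: "is_subfield k" and m: "0 < m" and c: "c \<in> k"
begin

abbreviation "n \<equiv> Suc m"

lemma n1: "1 < n" using m by simp

lemma U_stab: "u \<in> unitriangular n \<Longrightarrow> u \<in> flag_stab n"
  by (rule unitriangular_flag_stab[OF n1])

lemma preD: "g \<in> pre m E \<Longrightarrow> g \<in> unitriangular n" "g \<in> pre m E \<Longrightarrow> block m g \<in> E"
  by (auto simp: pre_def)

lemma rowv_pre: "1\<^sub>m m \<in> E \<Longrightarrow> rowv n y \<in> pre m E"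
  using rowv_unitriangular by (simp add: pre_def block_rowv)

lemma block_regular: "regular_map n k' m (block m)"
  by (auto simp: regular_map_def block_entry intro: block_unitriangular ureg_coord)

lemma j_embed_regular: "is_subfield (k' :: 'a set) \<Longrightarrow> regular_map m k' n (j_embed m)"
  unfolding regular_map_def
proof (intro conjI ballI allI impI j_embed_unitriangular)
  fix i j assume k': "is_subfield k'" and ij: "i < n" "j < n"
  have coord: "(\<lambda>u. u $$ (i - 1, j - 1)) \<in> ureg m k'" if "i \<noteq> 0" "j \<noteq> 0"
    using that ij by (intro ureg_coord) auto
  have const: "(\<lambda>u. 1) \<in> ureg m k'" "(\<lambda>u. 0) \<in> ureg m k'"
    by (intro ureg_const subfield_one[OF k'] subfield_zero[OF k'])+
  show "(\<lambda>u. j_embed m u $$ (i, j)) \<in> ureg m k'"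
  proof (rule ureg_cong)
    show "(\<lambda>u. if i = 0 then if j = 0 then 1 else 0 else if j = 0 then 0 else u $$ (i - 1, j - 1)) \<in> ureg m k'"
      using coord const by (cases "i = 0"; cases "j = 0") simp_all
    fix u :: "'a mat" assume "u \<in> unitriangular m"
    then show "j_embed m u $$ (i, j) = (if i = 0 then if j = 0 then 1 else 0 else if j = 0 then 0 else u $$ (i - 1, j - 1))"
      by (rule j_embed_entry[OF unitriangularD(1) ij])
  qed
qed

lemma pre_subgroup:
  assumes E: "subgroup E (GL m)"
  shows "subgroup (pre m E) (GL n)"
proof (rule subgroupI_GL)
  note S = subgroupD_GL[OF E]
  show "pre m E \<subseteq> carrier (GL n)" using unitriangular_GL by (auto simp: pre_def)
  show "1\<^sub>m n \<in> pre m E" using S(1) unitriangular_one by (simp add: pre_def block_one)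
  show "g * h \<in> pre m E" if "g \<in> pre m E" "h \<in> pre m E" for g h
    using S(2)[OF preD(2)[OF that(1)] preD(2)[OF that(2)]] unitriangular_mult[OF preD(1)[OF that(1)] preD(1)[OF that(2)]]
      block_mult[OF U_stab[OF preD(1)[OF that(1)]] U_stab[OF preD(1)[OF that(2)]]] by (simp add: pre_def)
  show "ginv n g \<in> pre m E" if "g \<in> pre m E" for g
    using S(3)[OF preD(2)[OF that]] unitriangular_inv[OF preD(1)[OF that]]
      block_inv(2)[OF m U_stab[OF preD(1)[OF that]]] by (simp add: pre_def)
qed

text \<open>The group is parametrized over \<open>k\<close> by \<open>E\<close> and the first row,
  so density is obtained in two stages: for a rational row on all of \<open>E\<close>, then for all
  rows.\<close>

lemma pre_k_group:
  assumes E: "k_group m k E"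
  shows "k_group n k (pre m E)"
proof -
  note K = k_groupD[OF E]
  have cl: "zariski_closed n (pre m E)" unfolding pre_def by (rule closed_preimage[OF K(3) block_regular])
  have dense: "k_dense n k (pre m E)" unfolding k_dense_def
  proof (intro ballI impI)
    fix f g assume f: "f \<in> ureg n UNIV" and f0: "\<forall>g\<in>rat_points n k (pre m E). f g = 0" and g: "g \<in> pre m E"
    \<comment> \<open>The row factor as a regular map on \<open>U_n\<close>, so that the second
      stage can use density of the rational points of \<open>U_n\<close>; it is not a
      homomorphism.\<close>
    define R where "R u = rowv n (\<lambda>b. u $$ (0, b))" for u :: "'a mat"
    have R: "regular_map n k n R" unfolding regular_map_def
    proof (intro conjI ballI allI impI)
      show "R u \<in> unitriangular n" for u unfolding R_def by (rule rowv_unitriangular)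
      have const: "(\<lambda>u. 1) \<in> ureg n k" "(\<lambda>u. 0) \<in> ureg n k"
        by (intro ureg_const subfield_one[OF k] subfield_zero[OF k])+
      show "(\<lambda>u. R u $$ (i, j)) \<in> ureg n k" if "i < n" "j < n" for i j
        using that const ureg_coord[of 0 n j k] by (cases "i = j"; cases "i = 0") (simp_all add: R_def rowv_entry)
    qed
    have RU: "R u \<in> unitriangular n" for u unfolding R_def by (rule rowv_unitriangular)
    have memb: "j_embed m e * R u \<in> pre m E" if e: "e \<in> E" for e u
    proof -
      have j: "j_embed m e \<in> unitriangular n" by (rule j_embed_unitriangular[OF K(5)[OF e]])
      have "block m (j_embed m e * R u) = e * 1\<^sub>m m"
        using block_mult[OF U_stab[OF j] U_stab[OF RU]] block_j_embed[OF unitriangularD(1)[OF K(5)[OF e]]]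
        by (simp add: R_def block_rowv)
      also have "\<dots> = e" using unitriangular_mult_one(1)[OF K(5)[OF e]] .
      finally show ?thesis using e unitriangular_mult[OF j RU] by (simp add: pre_def)
    qed
    have f1: "f (j_embed m e * R u) = 0" if e: "e \<in> E" and u: "u \<in> rat_points n k (unitriangular n)" for e u
    proof -
      have uR: "R u \<in> rat_points n k (unitriangular n)" by (rule regular_map_rational[OF k R u])
      have reg: "regular_map m UNIV n (\<lambda>e. j_embed m e * R u)"
        by (intro regular_map_mult[OF subfield_UNIV] j_embed_regular[OF subfield_UNIV] regular_map_const RU) auto
      have fe: "(\<lambda>e. f (j_embed m e * R u)) \<in> ureg m UNIV" by (rule ureg_comp[OF f reg]) simp
      have z: "f (j_embed m e * R u) = 0" if "e \<in> rat_points m k E" for e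
      proof -
        have e: "e \<in> E" "e \<in> rat_points m k (unitriangular m)" using that rat_points_unitriangular[OF K(2)] by blast+
        have "j_embed m e * R u \<in> rat_points n k (unitriangular n)"
          by (rule rat_mult[OF k regular_map_rational[OF k j_embed_regular[OF k] e(2)] uR])
        then have "j_embed m e * R u \<in> rat_points n k (pre m E)"
          using memb[OF e(1), of u] by (simp add: rat_points_def)
        then show ?thesis by (rule bspec[OF f0])
      qed
      show ?thesis by (rule k_denseD[OF K(4) fe z e])
    qed
    define e where "e = block m g"
    have e: "e \<in> E" using preD(2)[OF g] by (simp add: e_def)
    have gU: "g \<in> unitriangular n" by (rule preD(1)[OF g])
    have geq: "g = j_embed m e * R g" unfolding e_def R_def by (rule j_embed_rowv[OF gU])
    have "regular_map n UNIV n (\<lambda>u. j_embed m e * R u)"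
      by (intro regular_map_mult[OF subfield_UNIV] regular_map_const j_embed_unitriangular K(5) e regular_map_UNIV[OF R]) auto
    then have fu: "(\<lambda>u. f (j_embed m e * R u)) \<in> ureg n UNIV" by (rule ureg_comp[OF f]) simp
    have "f (j_embed m e * R g) = 0" by (rule ureg_vanish_rational[OF k fu f1[OF e] gU])
    then show "f g = 0" using geq by simp
  qed
  show ?thesis using pre_subgroup[OF K(1)] cl dense by (auto simp: k_group_def pre_def)
qed

lemma lift_af_in:
  assumes F: "af_in m k F"
  shows "af_in n k (lift_af m c F)"
proof -
  have F': "F \<in> AFs_over m k" "dom_af F \<subseteq> unitriangular m" using F by (auto simp: af_in_def)
  note KE = AFs_overD(1)[OF k F']
  obtain h where h: "h \<in> ureg m k" "\<And>u. u \<in> dom_af F \<Longrightarrow> fun_af F u = h u"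
    using AFs_overD(4)[OF k F'] by auto
  define q where "q g = h (block m g) + c * g $$ (0, 1)" for g
  have q: "q \<in> ureg n k" unfolding q_def
    by (intro ureg_add ureg_cmult[OF k c] ureg_coord ureg_comp[OF h(1) block_regular subfield_one[OF k]]) (use m in auto)
  have qF: "q g = fun_af F (block m g) + c * g $$ (0, 1)" if "g \<in> pre m (dom_af F)" for g
    using h(2) preD(2)[OF that] by (simp add: q_def)
  have "(pre m (dom_af F), restrict q (pre m (dom_af F))) \<in> AFs_over n k"
  proof (rule AFs_overI[OF k pre_k_group[OF KE] q])
    fix u v assume uv: "u \<in> pre m (dom_af F)" "v \<in> pre m (dom_af F)"
    note s = U_stab[OF preD(1)[OF uv(1)]] U_stab[OF preD(1)[OF uv(2)]]
    have "u * v \<in> pre m (dom_af F)"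
      using subgroupD_GL(2)[OF pre_subgroup[OF k_groupD(1)[OF KE]] uv] .
    then show "q (u * v) = q u + q v"
      using qF uv block_mult[OF s] flag_stab_mult(2)[OF n1 s] AFs_overD(3)[OF k F' preD(2)[OF uv(1)] preD(2)[OF uv(2)]]
      by (simp add: algebra_simps)
  qed
  moreover have "lift_af m c F = (pre m (dom_af F), restrict q (pre m (dom_af F)))"
    unfolding lift_af_def using qF by (auto intro!: restrict_ext)
  ultimately show ?thesis by (auto simp: af_in_def pre_def)
qed

text \<open>\<open>F\<close> is determined by its values on \<open>j(E)\<close> and on
  \<open>V\<close>. On \<open>V\<close> it is the prescribed multiple of the entry
  \<open>(0, 1)\<close>, so the additive function below is the pullback along
  \<open>j\<close>.\<close>

lemma lift_af_surj:
  assumes F: "af_in n k F" and dom: "dom_af F = pre m E" and E: "k_group m k E"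
    and row: "\<And>y. fun_af F (rowv n y) = c * y 1"
  obtains F1 where "af_in m k F1" "dom_af F1 = E" "F = lift_af m c F1"
proof -
  note K = k_groupD[OF E]
  have F': "F \<in> AFs_over n k" "dom_af F \<subseteq> unitriangular n" using F by (auto simp: af_in_def)
  obtain h where h: "h \<in> ureg n k" "\<And>u. u \<in> pre m E \<Longrightarrow> fun_af F u = h u"
    using AFs_overD(4)[OF k F'] dom by auto
  define q where "q e = h (j_embed m e)" for e
  have q: "q \<in> ureg m k" unfolding q_def by (rule ureg_comp[OF h(1) j_embed_regular[OF k] subfield_one[OF k]])
  have jp: "j_embed m e \<in> pre m E" if "e \<in> E" for e by (rule j_embed_pre[OF K(2) that])
  \<comment> \<open>Elements of \<open>U_n\<close> are determined by block and first row; the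
    product of two embedded matrices has the expected block and the first unit vector as its first
    row.\<close>
  have jmult: "j_embed m (u * v) = j_embed m u * j_embed m v" if uv: "u \<in> E" "v \<in> E" for u v
  proof -
    have u: "j_embed m u \<in> unitriangular n" "j_embed m v \<in> unitriangular n"
      using uv K(5) j_embed_unitriangular by blast+
    note cm = unitriangularD(1)[OF K(5)[OF uv(1)]] unitriangularD(1)[OF K(5)[OF uv(2)]]
    have b: "block m (j_embed m u * j_embed m v) = u * v"
      using block_mult[OF U_stab[OF u(1)] U_stab[OF u(2)]] block_j_embed[OF cm(1)] block_j_embed[OF cm(2)] by simp
    have r: "(j_embed m u * j_embed m v) $$ (0, b) = (if b = 0 then 1 else 0)" if "b < n" for b
    proof -
      have "(j_embed m u * j_embed m v) $$ (0, b) = (\<Sum>l<n. if l = 0 then j_embed m v $$ (0, b) else 0)"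
        unfolding entry_mult[OF j_embed_carrier[OF cm(1)] j_embed_carrier[OF cm(2)] zero_less_Suc that]
        by (intro sum.cong) (auto simp: j_embed_entry[OF cm(1)])
      then show ?thesis using that by (simp add: j_embed_entry[OF cm(2)] del: sum.lessThan_Suc)
    qed
    have "j_embed m u * j_embed m v = j_embed m (u * v) * rowv n (\<lambda>b. (j_embed m u * j_embed m v) $$ (0, b))"
      using j_embed_rowv[OF unitriangular_mult[OF u]] b by simp
    also have "rowv n (\<lambda>b. (j_embed m u * j_embed m v) $$ (0, b)) = rowv n (\<lambda>b. 0)"
      by (rule rowv_cong) (simp add: r)
    finally have "j_embed m u * j_embed m v = j_embed m (u * v) * 1\<^sub>m n" unfolding rowv_zero .
    then show ?thesis using right_mult_one_mat[OF j_embed_carrier[OF mult_carrier_mat[OF cm]]] by simp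
  qed
  define F1 where "F1 = (E, restrict q E)"
  have "F1 \<in> AFs_over m k" unfolding F1_def
  proof (rule AFs_overI[OF k E q])
    fix u v assume uv: "u \<in> E" "v \<in> E"
    have "h (j_embed m u * j_embed m v) = h (j_embed m u) + h (j_embed m v)"
      using AFs_overD(3)[OF k F', of "j_embed m u" "j_embed m v"] jp uv dom h(2)
        subgroupD_GL(2)[OF pre_subgroup[OF K(1)] jp[OF uv(1)] jp[OF uv(2)]] by simp
    then show "q (u * v) = q u + q v" by (simp add: q_def jmult[OF uv])
  qed
  then have F1: "af_in m k F1" using K(2) by (simp add: af_in_def F1_def)
  have "F = lift_af m c F1"
  proof (rule af_eqI)
    show d: "dom_af F = dom_af (lift_af m c F1)" by (simp add: dom lift_af_dom F1_def)
    show "fun_af F \<in> extensional (dom_af F)" by (rule AFs_overD(2)[OF k F'])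
    show "fun_af (lift_af m c F1) \<in> extensional (dom_af (lift_af m c F1))" by (simp add: lift_af_def)
    fix g assume g: "g \<in> dom_af F"
    then have gp: "g \<in> pre m E" using dom by simp
    note gE = preD(2)[OF gp]
    have "fun_af F g = fun_af F (j_embed m (block m g)) + fun_af F (rowv n (\<lambda>b. g $$ (0, b)))"
    proof -
      have "g = j_embed m (block m g) * rowv n (\<lambda>b. g $$ (0, b))" by (rule j_embed_rowv[OF preD(1)[OF gp]])
      then show ?thesis
        using AFs_overD(3)[OF k F', of "j_embed m (block m g)" "rowv n (\<lambda>b. g $$ (0, b))"]
          jp[OF gE] rowv_pre[OF subgroupD_GL(1)[OF K(1)]] dom by metis
    qed
    also have "\<dots> = q (block m g) + c * g $$ (0, 1)" using row h(2)[OF jp[OF gE]] by (simp add: q_def)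
    finally show "fun_af F g = fun_af (lift_af m c F1) g" using gp gE by (simp add: lift_af_fun F1_def)
  qed
  with F1 show ?thesis by (intro that) (auto simp: F1_def)
qed

lemma lift_fun_j_embed:
  assumes "dom_af F \<subseteq> unitriangular m" "e \<in> dom_af F"
  shows "fun_af (lift_af m c F) (j_embed m e) = fun_af F e"
proof -
  have "e \<in> carrier_mat m m" using assms unitriangularD(1) by blast
  then show ?thesis using j_embed_pre[OF assms] m by (simp add: lift_af_fun block_j_embed j_embed_entry)
qed

lemma lift_af_inj:
  assumes "af_in m k F" "af_in m k G" "lift_af m c F = lift_af m c G"
  shows "F = G"
proof (rule af_eqI)
  have F: "F \<in> AFs_over m k" "dom_af F \<subseteq> unitriangular m" "G \<in> AFs_over m k" "dom_af G \<subseteq> unitriangular m"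
    using assms by (auto simp: af_in_def)
  have "pre m (dom_af F) = pre m (dom_af G)" using assms(3) lift_af_dom by metis
  then show d: "dom_af F = dom_af G" using pre_inj F by blast
  show "fun_af F \<in> extensional (dom_af F)" by (rule AFs_overD(2)[OF k F(1,2)])
  show "fun_af G \<in> extensional (dom_af G)" by (rule AFs_overD(2)[OF k F(3,4)])
  show "fun_af F u = fun_af G u" if "u \<in> dom_af F" for u
    using lift_fun_j_embed[OF F(2) that] lift_fun_j_embed[OF F(4), of u] that d assms(3) by simp
qed

text \<open>The terms with \<open>c\<close> cancel, and every element of \<open>A\<close> is the
  block of an element of \<open>pre m A\<close>.\<close>

lemma restrict_lift_iff:
  assumes "dom_af F \<subseteq> unitriangular m" "dom_af G \<subseteq> unitriangular m" "A \<subseteq> dom_af F" "A \<subseteq> dom_af G"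
  shows "restrict (fun_af (lift_af m c F)) (pre m A) = restrict (fun_af (lift_af m c G)) (pre m A) \<longleftrightarrow>
    restrict (fun_af F) A = restrict (fun_af G) A"
proof -
  have sub: "pre m A \<subseteq> pre m (dom_af F)" "pre m A \<subseteq> pre m (dom_af G)" using assms(3,4) by (auto simp: pre_def)
  have "(\<forall>g\<in>pre m A. fun_af (lift_af m c F) g = fun_af (lift_af m c G) g) \<longleftrightarrow> (\<forall>e\<in>A. fun_af F e = fun_af G e)"
  proof
    assume *: "\<forall>g\<in>pre m A. fun_af (lift_af m c F) g = fun_af (lift_af m c G) g"
    show "\<forall>e\<in>A. fun_af F e = fun_af G e"
    proof
      fix e assume e: "e \<in> A"
      have "j_embed m e \<in> pre m A" using e assms by (intro j_embed_pre) auto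
      with * have "fun_af (lift_af m c F) (j_embed m e) = fun_af (lift_af m c G) (j_embed m e)" by blast
      then show "fun_af F e = fun_af G e"
        using lift_fun_j_embed[OF assms(1) subsetD[OF assms(3) e]]
          lift_fun_j_embed[OF assms(2) subsetD[OF assms(4) e]] by simp
    qed
  next
    assume *: "\<forall>e\<in>A. fun_af F e = fun_af G e"
    show "\<forall>g\<in>pre m A. fun_af (lift_af m c F) g = fun_af (lift_af m c G) g"
    proof
      fix g assume g: "g \<in> pre m A"
      then have "fun_af F (block m g) = fun_af G (block m g)" using * preD(2) by blast
      then show "fun_af (lift_af m c F) g = fun_af (lift_af m c G) g"
        using g sub by (simp add: lift_af_fun subsetD)
    qed
  qed
  then show ?thesis unfolding restrict_eq_iff .
qed

text \<open>Since \<open>A\<close> contains 1, the group \<open>pre m A\<close> contains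
  \<open>V\<close>. So any extension agrees with the lift of \<open>F\<close> on \<open>V\<close>,
  and by \<open>lift_af_surj\<close> comes from dimension \<open>m\<close>: lifting a step neither
  loses nor adds extensions.\<close>

lemma lift_extensions:
  assumes F: "af_in m k F" and N: "k_group m k N" and A: "A \<subseteq> dom_af F" "A \<subseteq> N" "1\<^sub>m m \<in> A"
  shows "{Z \<in> AFs_on n k (pre m N). restrict (fun_af Z) (pre m A) = restrict (fun_af (lift_af m c F)) (pre m A)} =
    lift_af m c ` {Z \<in> AFs_on m k N. restrict (fun_af Z) A = restrict (fun_af F) A}" (is "?L = ?R")
proof (intro equalityI subsetI)
  have FU: "dom_af F \<subseteq> unitriangular m" using F by (simp add: af_in_def)
  note K = k_groupD[OF N]
  fix Z assume "Z \<in> ?L"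
  then have Z: "Z \<in> AFs_over n k" "dom_af Z = pre m N"
    "\<And>g. g \<in> pre m A \<Longrightarrow> fun_af Z g = fun_af (lift_af m c F) g"
    by (auto simp: AFs_on_def restrict_eq_iff)
  have Zin: "af_in n k Z" using Z preD(1) by (auto simp: af_in_def)
  have F1: "fun_af F (1\<^sub>m m) = 0"
  proof -
    have F': "F \<in> AFs_over m k" using F by (simp add: af_in_def)
    show ?thesis using additive_one_inv(1)[OF k_groupD(1)[OF AFs_overD(1)[OF k F' FU]] AFs_overD(3)[OF k F' FU]] .
  qed
  have row: "fun_af Z (rowv n y) = c * y 1" for y
  proof -
    have "rowv n y \<in> pre m A" "rowv n y \<in> pre m (dom_af F)" using A by (auto intro!: rowv_pre)
    then show ?thesis using Z(3) F1 m by (simp add: lift_af_fun block_rowv rowv_entry)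
  qed
  obtain Z1 where Z1: "af_in m k Z1" "dom_af Z1 = N" "Z = lift_af m c Z1"
    using lift_af_surj[OF Zin Z(2) N row] by blast
  have "restrict (fun_af (lift_af m c Z1)) (pre m A) = restrict (fun_af (lift_af m c F)) (pre m A)"
    using Z(3) Z1(3) by (simp add: restrict_eq_iff)
  then have "restrict (fun_af Z1) A = restrict (fun_af F) A"
    using restrict_lift_iff[OF _ FU _ A(1), of Z1] Z1(2) K(2) A(2) by simp
  then show "Z \<in> ?R" using Z1 by (auto simp: AFs_on_def af_in_def)
next
  have FU: "dom_af F \<subseteq> unitriangular m" using F by (simp add: af_in_def)
  note K = k_groupD[OF N]
  fix Z assume "Z \<in> ?R"
  then obtain Z1 where Z1: "Z1 \<in> AFs_over m k" "dom_af Z1 = N" "Z = lift_af m c Z1"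
    "restrict (fun_af Z1) A = restrict (fun_af F) A" by (auto simp: AFs_on_def)
  have "af_in m k Z1" using Z1 K(2) by (simp add: af_in_def)
  from lift_af_in[OF this] show "Z \<in> ?L"
    using restrict_lift_iff[OF _ FU _ A(1), of Z1] Z1 K(2) A(2) by (simp add: AFs_on_def af_in_def lift_af_dom)
qed

lemma comm_pre:
  assumes C: "subgroup C (GL m)" and "A \<subseteq> unitriangular m" "B \<subseteq> unitriangular m" and sub: "comm_subgroup m A B \<subseteq> C"
  shows "comm_subgroup n (pre m A) (pre m B) \<subseteq> pre m C"
proof (rule comm_subgroup_subset[OF pre_subgroup[OF C]])
  fix a b assume a: "a \<in> pre m A" and b: "b \<in> pre m B"
  note aU = preD(1)[OF a] and bU = preD(1)[OF b]
  note aU' = unitriangular_inv[OF aU] and bU' = unitriangular_inv[OF bU]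
  note s = U_stab[OF aU] U_stab[OF bU] U_stab[OF aU'] U_stab[OF bU']
  note s2 = flag_stab_mult(1)[OF n1 s(1,2)]
  note s3 = flag_stab_mult(1)[OF n1 s2 s(3)]
  have "block m (a * b * ginv n a * ginv n b) = block m a * block m b * ginv m (block m a) * ginv m (block m b)"
    unfolding block_mult[OF s3 s(4)] block_mult[OF s2 s(3)] block_mult[OF s(1,2)]
      block_inv(2)[OF m s(1)] block_inv(2)[OF m s(2)] ..
  also have "\<dots> \<in> C" using sub comm_subgroup_mem[OF preD(2)[OF a] preD(2)[OF b]] by blast
  finally show "a * b * ginv n a * ginv n b \<in> pre m C"
    using aU bU aU' bU' by (simp add: pre_def unitriangular_mult)
qed

text \<open>Taking blocks is multiplicative on \<open>flag_stab\<close>, and the entry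
  \<open>(0, 1)\<close> is invariant under conjugation there.\<close>

lemma conj_lift:
  assumes \<delta>: "\<delta> \<in> flag_stab n" and Q: "dom_af Q \<subseteq> unitriangular m"
    and conj: "\<And>u. u \<in> dom_af Q \<Longrightarrow> block m \<delta> * u * ginv m (block m \<delta>) \<in> unitriangular m"
  shows "conj_af n \<delta> (lift_af m c Q) = lift_af m c (conj_af m (block m \<delta>) Q)"
proof -
  define \<epsilon> where "\<epsilon> = block m \<delta>"
  define E where "E = dom_af Q"
  have \<epsilon>G: "\<epsilon> \<in> carrier (GL m)" unfolding \<epsilon>_def by (rule block_inv(1)[OF m \<delta>])
  note \<delta>' = flag_stab_inv[OF n1 \<delta>]
  note \<delta>G = flag_stabD(1)[OF \<delta>]
  have stab3: "x * g * y \<in> flag_stab n" "block m (x * g * y) = block m x * block m g * block m y"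
    if "x \<in> flag_stab n" "g \<in> flag_stab n" "y \<in> flag_stab n" for x g y
    using flag_stab_mult(1)[OF n1 flag_stab_mult(1)[OF n1 that(1,2)] that(3)]
      block_mult[OF flag_stab_mult(1)[OF n1 that(1,2)] that(3)] block_mult[OF that(1,2)] by simp_all
  have bi: "block m (ginv n \<delta>) = ginv m \<epsilon>" unfolding \<epsilon>_def by (rule block_inv(2)[OF m \<delta>])
  have EG: "u \<in> carrier (GL m)" if "u \<in> E" for u using that Q unitriangular_GL by (auto simp: E_def)
  have dom: "(\<lambda>u. \<delta> * u * ginv n \<delta>) ` pre m E = pre m ((\<lambda>u. \<epsilon> * u * ginv m \<epsilon>) ` E)"
  proof (intro equalityI subsetI)
    fix g assume "g \<in> (\<lambda>u. \<delta> * u * ginv n \<delta>) ` pre m E"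
    then obtain u where u: "u \<in> pre m E" "g = \<delta> * u * ginv n \<delta>" by blast
    note s = stab3[OF \<delta> U_stab[OF preD(1)[OF u(1)]] \<delta>']
    have b: "block m g = \<epsilon> * block m u * ginv m \<epsilon>" using s(2) bi by (simp add: u(2) \<epsilon>_def)
    have gs: "g \<in> flag_stab n" using s(1) u(2) by simp
    have "g \<in> unitriangular n"
      by (rule unitriangular_blockI[OF flag_stabD(2)[OF gs] flag_stabD(3)[OF gs]])
         (use b conj preD(2)[OF u(1)] in \<open>simp_all add: \<epsilon>_def E_def\<close>)
    then show "g \<in> pre m ((\<lambda>u. \<epsilon> * u * ginv m \<epsilon>) ` E)" using b preD(2)[OF u(1)] by (auto simp: pre_def)
  next
    fix g assume g: "g \<in> pre m ((\<lambda>u. \<epsilon> * u * ginv m \<epsilon>) ` E)"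
    then obtain e where e: "e \<in> E" "block m g = \<epsilon> * e * ginv m \<epsilon>" by (auto simp: pre_def)
    note gs = U_stab[OF preD(1)[OF g]]
    define u where "u = ginv n \<delta> * g * \<delta>"
    note s = stab3[OF \<delta>' gs \<delta>, folded u_def]
    have "block m u = ginv m \<epsilon> * (\<epsilon> * e * ginv m \<epsilon>) * \<epsilon>" using s(2) bi e(2) by (simp add: \<epsilon>_def)
    then have b: "block m u = e" using \<epsilon>G EG[OF e(1)] by (simp add: GL_simps[where n = m])
    have "u \<in> unitriangular n"
      by (rule unitriangular_blockI[OF flag_stabD(2)[OF s(1)] flag_stabD(3)[OF s(1)]])
         (use b e(1) Q in \<open>auto simp: E_def\<close>)
    then have "u \<in> pre m E" using b e(1) by (simp add: pre_def)
    moreover have "g = \<delta> * u * ginv n \<delta>" unfolding u_def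
      using \<delta>G flag_stabD(1)[OF gs] by (simp add: GL_simps[where n = n])
    ultimately show "g \<in> (\<lambda>u. \<delta> * u * ginv n \<delta>) ` pre m E" by blast
  qed
  have "fun_af (lift_af m c Q) (ginv n \<delta> * g * \<delta>) = fun_af (conj_af m \<epsilon> Q) (block m g) + c * g $$ (0, 1)"
    if g: "g \<in> pre m ((\<lambda>u. \<epsilon> * u * ginv m \<epsilon>) ` E)" for g
  proof -
    note gs = U_stab[OF preD(1)[OF g]]
    obtain u where u: "u \<in> pre m E" "g = \<delta> * u * ginv n \<delta>" using g unfolding dom[symmetric] by blast
    have ueq: "ginv n \<delta> * g * \<delta> = u"
      using \<delta>G flag_stabD(1)[OF U_stab[OF preD(1)[OF u(1)]]] by (simp add: u(2) GL_simps[where n = n])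
    have "block m u = ginv m \<epsilon> * block m g * \<epsilon>" using stab3(2)[OF \<delta>' gs \<delta>] bi ueq by (simp add: \<epsilon>_def)
    moreover have "u $$ (0, 1) = g $$ (0, 1)" using flag_stab_conj_entry[OF n1 \<delta> gs] ueq by simp
    moreover have "fun_af (conj_af m \<epsilon> Q) (block m g) = fun_af Q (ginv m \<epsilon> * block m g * \<epsilon>)"
      using preD(2)[OF g] by (simp add: conj_af_def Let_def E_def)
    ultimately show ?thesis using u(1) by (simp add: ueq lift_af_fun E_def)
  qed
  then show ?thesis
    unfolding \<epsilon>_def[symmetric] lift_af_def[of m c "conj_af m \<epsilon> Q"]
    by (auto simp: conj_af_def Let_def lift_af_dom dom[unfolded E_def] E_def intro!: restrict_ext)
qed

lemma lift_e_step:
  assumes F: "af_in m k F" and N: "k_group m k N" and e: "e_step_subgroup m k F N"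
  shows "e_step_subgroup n k (lift_af m c F) (pre m N)"
    "e_outputs n k (lift_af m c F) (pre m N) = lift_af m c ` e_outputs m k F N"
proof -
  have F': "F \<in> AFs_over m k" "dom_af F \<subseteq> unitriangular m" using F by (auto simp: af_in_def)
  note KF = k_groupD[OF AFs_overD(1)[OF k F']] and K = k_groupD[OF N]
  have sub: "dom_af F \<subset> N" "comm_subgroup m N N \<subseteq> dom_af F" using e by (auto simp: e_step_subgroup_def)
  have "pre m (dom_af F) \<subset> pre m N"
    using sub(1) pre_mono_iff[OF F'(2), of N] pre_mono_iff[OF K(2), of "dom_af F"] by auto
  then show "e_step_subgroup n k (lift_af m c F) (pre m N)"
    unfolding e_step_subgroup_def lift_af_dom
    using comm_pre[OF KF(1) K(2) K(2) sub(2)] pre_k_group[OF N] k_group_iff[OF k] by blast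
  show "e_outputs n k (lift_af m c F) (pre m N) = lift_af m c ` e_outputs m k F N"
    unfolding e_outputs_def lift_af_dom
    by (rule lift_extensions[OF F N order_refl]) (use sub(1) subgroupD_GL(1)[OF KF(1)] in auto)
qed

text \<open>An element acts on lifted extensions through its block alone. Stabilizers are therefore
  preimages of stabilizers, and transitivity lifts along \<open>j\<close>.\<close>

lemma lift_eu_step:
  assumes F: "af_in m k F" and Z: "af_in m k Z" and eu: "eu_step m k F Z"
  shows "eu_step n k (lift_af m c F) (lift_af m c Z)"
proof -
  have F': "F \<in> AFs_over m k" "dom_af F \<subseteq> unitriangular m" and Z': "Z \<in> AFs_over m k" "dom_af Z \<subseteq> unitriangular m"
    using F Z by (auto simp: af_in_def)
  define DF where "DF = dom_af F"
  define DZ where "DZ = dom_af Z"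
  define C where "C = DF \<inter> DZ"
  have KF: "k_group m k DF" and KZ: "k_group m k DZ"
    unfolding DF_def DZ_def by (rule AFs_overD(1)[OF k F'] AFs_overD(1)[OF k Z'])+
  note KF' = k_groupD[OF KF] and KZ' = k_groupD[OF KZ]
  have C: "subgroup C (GL m)" unfolding C_def
    by (rule group.subgroups_Inter_pair[OF group_GL KF'(1) KZ'(1)])
  have CU: "C \<subseteq> unitriangular m" "C \<subseteq> DF" "C \<subseteq> DZ" using KF'(2) by (auto simp: C_def)
  have preC: "pre m DF \<inter> pre m DZ = pre m C" by (auto simp: pre_def C_def)
  define E where "E = {Q \<in> AFs_on m k DZ. restrict (fun_af Q) C = restrict (fun_af F) C}"
  have eu': "C \<noteq> DF" "comm_subgroup m DF DF \<subseteq> C" "comm_subgroup m DZ DZ \<subseteq> C" "comm_subgroup m DF DZ \<subseteq> C"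
    "restrict (fun_af F) C = restrict (fun_af Z) C"
    "\<And>Q. Q \<in> E \<Longrightarrow> {d \<in> rat_points m k DF. conj_af m d Q = Q} = rat_points m k C"
    "\<And>Q Q'. Q \<in> E \<Longrightarrow> Q' \<in> E \<Longrightarrow> \<exists>d\<in>rat_points m k DF. conj_af m d Q = Q'"
    using eu unfolding eu_step_def Let_def DF_def[symmetric] DZ_def[symmetric] C_def[symmetric] E_def[symmetric] by auto
  have Ein: "af_in m k Q" "dom_af Q = DZ" if "Q \<in> E" for Q
    using that KZ'(2) by (auto simp: E_def AFs_on_def af_in_def)
  have E_lift: "{Q \<in> AFs_on n k (pre m DZ). restrict (fun_af Q) (pre m C) = restrict (fun_af (lift_af m c F)) (pre m C)}
      = lift_af m c ` E"
    unfolding E_def by (rule lift_extensions[OF F KZ]) (use CU subgroupD_GL(1)[OF C] in \<open>auto simp: DF_def\<close>)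
  \<comment> \<open>From \<open>[DF, DZ] \<subseteq> C \<subseteq> DZ\<close> it follows that
    \<open>DF\<close> normalizes \<open>DZ\<close>.\<close>
  have conjZ: "d * u * ginv m d \<in> DZ" if d: "d \<in> DF" and u: "u \<in> DZ" for d u
  proof -
    have "d * u * ginv m d * ginv m u \<in> DZ"
      using eu'(4) comm_subgroup_mem[OF d u] CU(3) by blast
    then have "d * u * ginv m d * ginv m u * u \<in> DZ" using subgroupD_GL(2)[OF KZ'(1)] u by blast
    then show ?thesis using KF'(6)[OF d] KZ'(6)[OF u] by (simp add: GL_simps[where n = m])
  qed
  have conj_eq: "conj_af n d (lift_af m c Q) = lift_af m c (conj_af m (block m d) Q)"
    if "Q \<in> E" "d \<in> pre m DF" for Q d
    by (rule conj_lift[OF U_stab[OF preD(1)[OF that(2)]]])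
       (use Ein[OF that(1)] KZ' conjZ[OF preD(2)[OF that(2)]] in auto)
  \<comment> \<open>Needed for \<open>lift_af_inj\<close>, which compares additive functions over
    \<open>k\<close> only.\<close>
  have conj_in: "af_in m k (conj_af m d Q)" if "Q \<in> E" "d \<in> rat_points m k DF" for Q d
  proof -
    have d: "d \<in> DF" "d \<in> rat_points m k (unitriangular m)" using that(2) rat_points_unitriangular[OF KF'(2)] by blast+
    note d' = rat_inv[OF k d(2)]
    show ?thesis
      by (rule conj_af_AFs_over[OF k Ein(1)[OF that(1)] _ _ _ _ GL_r_inv[OF KF'(6)[OF d(1)]]])
         (use d d' GL_carrier_mat[OF KF'(6)[OF d(1)]] GL_carrier_mat[OF GL_inv_closed[OF KF'(6)[OF d(1)]]]
            Ein(2)[OF that(1)] KZ'(5)[OF conjZ[OF d(1)]] in \<open>auto simp: rat_points_def\<close>)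
  qed
  have block_rat: "block m d \<in> rat_points m k A" if "d \<in> rat_points n k (pre m A)" "A \<subseteq> unitriangular m" for d A
    using that unitriangular_GL by (auto simp: rat_points_def block_entry pre_def)
  have stab: "{d \<in> rat_points n k (pre m DF). conj_af n d (lift_af m c Q) = lift_af m c Q} = rat_points n k (pre m C)"
    if Q: "Q \<in> E" for Q
  proof (intro equalityI subsetI)
    fix d assume "d \<in> {d \<in> rat_points n k (pre m DF). conj_af n d (lift_af m c Q) = lift_af m c Q}"
    then have d: "d \<in> rat_points n k (pre m DF)" "conj_af n d (lift_af m c Q) = lift_af m c Q" by auto
    have dp: "d \<in> pre m DF" using d(1) by (simp add: rat_points_def)
    note bd = block_rat[OF d(1) KF'(2)]
    have "conj_af m (block m d) Q = Q"
      by (rule lift_af_inj[OF conj_in[OF Q bd] Ein(1)[OF Q]]) (use conj_eq[OF Q dp] d(2) in simp)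
    then have "block m d \<in> C" using eu'(6)[OF Q] bd by (auto simp: rat_points_def)
    then show "d \<in> rat_points n k (pre m C)" using d(1) by (simp add: rat_points_def pre_def)
  next
    fix d assume d: "d \<in> rat_points n k (pre m C)"
    have dF: "d \<in> rat_points n k (pre m DF)" using d CU(2) by (auto simp: rat_points_def pre_def)
    have dp: "d \<in> pre m DF" using dF by (simp add: rat_points_def)
    have "conj_af m (block m d) Q = Q" using eu'(6)[OF Q] block_rat[OF d CU(1)] by blast
    then show "d \<in> {d \<in> rat_points n k (pre m DF). conj_af n d (lift_af m c Q) = lift_af m c Q}"
      using dF conj_eq[OF Q dp] by simp
  qed
  have trans: "\<exists>d\<in>rat_points n k (pre m DF). conj_af n d (lift_af m c Q) = lift_af m c Q'"
    if Q: "Q \<in> E" and Q': "Q' \<in> E" for Q Q'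
  proof -
    obtain e where e: "e \<in> rat_points m k DF" "conj_af m e Q = Q'" using eu'(7)[OF Q Q'] by blast
    have e': "e \<in> DF" "e \<in> rat_points m k (unitriangular m)" using e(1) rat_points_unitriangular[OF KF'(2)] by blast+
    have jp: "j_embed m e \<in> pre m DF" by (rule j_embed_pre[OF KF'(2) e'(1)])
    have "j_embed m e \<in> rat_points n k (unitriangular n)"
      by (rule regular_map_rational[OF k j_embed_regular[OF k] e'(2)])
    then have "j_embed m e \<in> rat_points n k (pre m DF)" using jp by (simp add: rat_points_def)
    moreover have "block m (j_embed m e) = e" by (rule block_j_embed[OF unitriangularD(1)[OF KF'(5)[OF e'(1)]]])
    ultimately show ?thesis using conj_eq[OF Q jp] e(2) by (intro bexI[of _ "j_embed m e"]) simp_all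
  qed
  have "pre m C \<noteq> pre m DF" using pre_inj[OF CU(1) KF'(2)] eu'(1) by simp
  moreover have "comm_subgroup n (pre m DF) (pre m DF) \<union> comm_subgroup n (pre m DZ) (pre m DZ) \<union>
      comm_subgroup n (pre m DF) (pre m DZ) \<subseteq> pre m C"
    using comm_pre[OF C KF'(2) KF'(2) eu'(2)] comm_pre[OF C KZ'(2) KZ'(2) eu'(3)]
      comm_pre[OF C KF'(2) KZ'(2) eu'(4)] by blast
  moreover have "restrict (fun_af (lift_af m c F)) (pre m C) = restrict (fun_af (lift_af m c Z)) (pre m C)"
    using restrict_lift_iff[OF F'(2) Z'(2), of C] CU eu'(5) by (simp add: DF_def DZ_def)
  moreover have "lift_af m c Z \<in> AFs_over n k" using lift_af_in[OF Z] by (simp add: af_in_def)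
  ultimately show ?thesis
    unfolding eu_step_def Let_def lift_af_dom DF_def[symmetric] DZ_def[symmetric] preC E_lift
    using stab trans by simp
qed

text \<open>The first column of an element of \<open>Mir_m\<close> is the first unit vector, so its
  image under \<open>j\<close> has the required second column and lies in
  \<open>flag_stab\<close>.\<close>

lemma lift_co_step:
  assumes F: "af_in m k F" and \<gamma>: "\<gamma> \<in> rat_points m k (Mir m)" and conj: "af_in m k (conj_af m \<gamma> F)"
  shows "\<exists>\<delta>\<in>rat_points n k (Mir n). lift_af m c (conj_af m \<gamma> F) = conj_af n \<delta> (lift_af m c F)"
proof -
  obtain m' where m': "m = Suc m'" using m by (cases m) auto
  have M: "\<gamma> \<in> Mir (Suc m')" "\<gamma> \<in> carrier (GL m)" and \<gamma>k: "\<And>i j. i < m \<Longrightarrow> j < m \<Longrightarrow> \<gamma> $$ (i, j) \<in> k"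
    using \<gamma> m' by (auto simp: rat_points_def)
  have \<gamma>m: "\<gamma> \<in> carrier_mat m m" by (rule GL_carrier_mat[OF M(2)])
  have det: "det \<gamma> = 1" by (rule Mir_props(2)[OF M(1)])
  define \<delta> where "\<delta> = j_embed m \<gamma>"
  have \<delta>M: "\<delta> \<in> Mir n" unfolding \<delta>_def by (rule j_embed_Mir[OF \<gamma>m det])
  have \<delta>G: "\<delta> \<in> carrier (GL n)" using Mir_props(1,2)[OF \<delta>M] by (simp add: carrier_GL)
  have \<delta>k: "\<delta> $$ (i, j) \<in> k" if "i < n" "j < n" for i j
    unfolding \<delta>_def j_embed_entry[OF \<gamma>m that]
    using that \<gamma>k[of "i - 1" "j - 1"] subfield_zero[OF k] subfield_one[OF k] by auto
  have \<delta>1: "\<delta> $$ (a, 1) = (if a = 1 then 1 else 0)" if "a < n" "0 < a" for a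
    unfolding \<delta>_def j_embed_entry[OF \<gamma>m that(1) n1]
    using that Mir_props(3)[OF M(1), of "a - 1"] m' by auto
  have stab: "\<delta> \<in> flag_stab n" unfolding flag_stab_def using \<delta>G Mir_props(3)[OF \<delta>M] \<delta>1 by simp
  have b: "block m \<delta> = \<gamma>" unfolding \<delta>_def by (rule block_j_embed[OF \<gamma>m])
  have "conj_af n \<delta> (lift_af m c F) = lift_af m c (conj_af m (block m \<delta>) F)"
  proof (rule conj_lift[OF stab])
    show "dom_af F \<subseteq> unitriangular m" using F by (simp add: af_in_def)
    fix u assume "u \<in> dom_af F"
    then have "\<gamma> * u * ginv m \<gamma> \<in> dom_af (conj_af m \<gamma> F)" by (simp add: conj_af_def Let_def)
    then show "block m \<delta> * u * ginv m (block m \<delta>) \<in> unitriangular m"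
      using conj unfolding b af_in_def by blast
  qed
  then show ?thesis using \<delta>M \<delta>G \<delta>k b by (intro bexI[of _ \<delta>]) (auto simp: rat_points_def)
qed

lemma reach_lift: "reach m k d F \<Longrightarrow> reach n k d (lift_af m c F)"
proof (induction d arbitrary: F)
  case 0
  have "pre m (unitriangular m) = (unitriangular n :: 'a mat set)"
    using block_unitriangular by (auto simp: pre_def)
  then show ?case using 0 lift_af_in by (simp add: lift_af_dom)
next
  case (Suc d)
  have F: "af_in m k F" using Suc.prems by simp
  have pU: "pre m (unitriangular m) = (unitriangular n :: 'a mat set)"
    using block_unitriangular by (auto simp: pre_def)
  show ?case
  proof (cases "dom_af F = unitriangular m")
    case True
    then show ?thesis using lift_af_in[OF F] pU by (simp add: lift_af_dom)
  next
    case False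
    then obtain B where B: "B \<noteq> {}" "step_to m k F B" "\<And>Z. Z \<in> B \<Longrightarrow> reach m k d Z" using Suc.prems by auto
    have Bin: "af_in m k Z" if "Z \<in> B" for Z by (rule reach_af_in[OF B(3)[OF that]])
    have "step_to n k (lift_af m c F) (lift_af m c ` B)"
      using B(2) unfolding step_to_def[of m]
    proof (elim disjE exE conjE bexE)
      fix N assume e: "e_step_subgroup m k F N" and Be: "B = e_outputs m k F N"
      \<comment> \<open>An e-step by itself does not force \<open>N\<close> into \<open>U_m\<close>;
        an output does, because its domain is \<open>N\<close> and it is reachable.\<close>
      obtain Z where Z: "Z \<in> B" using B(1) by blast
      have "dom_af Z = N" using Z by (simp add: Be e_outputs_def AFs_on_def)
      then have N: "k_group m k N" using AFs_overD(1)[OF k, of Z m] Bin[OF Z] by (simp add: af_in_def)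
      show ?thesis unfolding step_to_def using lift_e_step[OF F N e] Be by blast
    next
      fix Z assume BZ: "B = {Z}" and eu: "eu_step m k F Z"
      show ?thesis unfolding step_to_def using lift_eu_step[OF F Bin eu] BZ by auto
    next
      fix \<gamma> assume \<gamma>: "\<gamma> \<in> rat_points m k (Mir m)" and Bc: "B = {conj_af m \<gamma> F}"
      show ?thesis unfolding step_to_def using lift_co_step[OF F \<gamma> Bin] Bc by auto
    qed
    moreover have "\<forall>Z\<in>lift_af m c ` B. reach n k d Z" using Suc.IH B(3) by blast
    moreover have "lift_af m c ` B \<noteq> {}" using B(1) by simp
    ultimately have "\<exists>B'. B' \<noteq> {} \<and> step_to n k (lift_af m c F) B' \<and> (\<forall>Z\<in>B'. reach n k d Z)"
      by (intro exI[of _ "lift_af m c ` B"] conjI)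
    then show ?thesis using lift_af_in[OF F] by simp
  qed
qed

text \<open>As \<open>D\<close> contains \<open>V\<close>, membership of \<open>g\<close> only
  depends on its block. The group below is the preimage of \<open>D\<close> under \<open>j\<close>,
  which makes it closed, and the image of \<open>D\<close> under \<open>block\<close>, which makes
  its rational points dense.\<close>

lemma pre_exists:
  assumes D: "k_group n k D" and tail: "row_tail n 1 \<subseteq> D"
  obtains E where "k_group m k E" "D = pre m E"
proof -
  note K = k_groupD[OF D] and S = subgroupD_GL[OF k_groupD(1)[OF D]]
  have rowD: "rowv n y \<in> D" for y
  proof -
    have "rowv n y = rowv n (y(0 := 0))" by (rule rowv_cong) simp
    moreover have "rowv n (y(0 := 0)) \<in> row_tail n 1" unfolding row_tail_def by auto
    ultimately show ?thesis using tail by auto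
  qed
  have jD: "j_embed m (block m g) \<in> D \<longleftrightarrow> g \<in> D" if g: "g \<in> unitriangular n" for g
  proof -
    define v where "v = rowv n (\<lambda>b. g $$ (0, b))"
    have v: "v \<in> D" unfolding v_def by (rule rowD)
    have eq: "g = j_embed m (block m g) * v" unfolding v_def by (rule j_embed_rowv[OF g])
    have jG: "j_embed m (block m g) \<in> carrier (GL n)"
      by (intro unitriangular_GL j_embed_unitriangular block_unitriangular g)
    show ?thesis
    proof
      assume "j_embed m (block m g) \<in> D"
      then have "j_embed m (block m g) * v \<in> D" using S(2) v by blast
      then show "g \<in> D" using eq by simp
    next
      assume "g \<in> D"
      then have "g * ginv n v \<in> D" using S(2,3) v by blast
      also have "g * ginv n v = j_embed m (block m g) * v * ginv n v" using eq by simp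
      also have "\<dots> = j_embed m (block m g)" using jG S(4)[OF v] by (simp add: GL_simps[where n = n])
      finally show "j_embed m (block m g) \<in> D" .
    qed
  qed
  define E where "E = {e \<in> unitriangular m. j_embed m e \<in> D}"
  have E_block: "block m g \<in> E" if "g \<in> D" for g
    using that jD[OF K(5)[OF that]] block_unitriangular[OF K(5)[OF that]] by (simp add: E_def)
  have Deq: "D = pre m E"
  proof (intro equalityI subsetI)
    fix g assume g: "g \<in> D"
    then show "g \<in> pre m E" using E_block K(5) by (simp add: pre_def)
  next
    fix g assume g: "g \<in> pre m E"
    then show "g \<in> D" using jD[OF preD(1)[OF g]] preD(2)[OF g] by (simp add: E_def)
  qed
  have E_iff: "e \<in> E" if "e \<in> unitriangular m" "g \<in> D" "block m g = e" for e g
    using E_block[OF that(2)] that(3) by simp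
  have bj: "block m (j_embed m e) = e" "j_embed m e \<in> D" "j_embed m e \<in> flag_stab n" "e \<in> unitriangular m" if "e \<in> E" for e
    using that block_j_embed[OF unitriangularD(1)] U_stab K(5) by (auto simp: E_def)
  have sg: "subgroup E (GL m)"
  proof (rule subgroupI_GL)
    show "E \<subseteq> carrier (GL m)" using unitriangular_GL by (auto simp: E_def)
    show "1\<^sub>m m \<in> E" by (rule E_iff[OF unitriangular_one S(1) block_one])
    show "g * h \<in> E" if gh: "g \<in> E" "h \<in> E" for g h
      by (rule E_iff[OF unitriangular_mult[OF bj(4)[OF gh(1)] bj(4)[OF gh(2)]] S(2)[OF bj(2)[OF gh(1)] bj(2)[OF gh(2)]]])
         (simp add: block_mult[OF bj(3)[OF gh(1)] bj(3)[OF gh(2)]] bj(1)[OF gh(1)] bj(1)[OF gh(2)])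
    show "ginv m g \<in> E" if g: "g \<in> E" for g
      by (rule E_iff[OF unitriangular_inv[OF bj(4)[OF g]] S(3)[OF bj(2)[OF g]]])
         (simp add: block_inv(2)[OF m bj(3)[OF g]] bj(1)[OF g])
  qed
  have cl: "zariski_closed m E" unfolding E_def by (rule closed_preimage[OF K(3) j_embed_regular[OF subfield_UNIV]])
  have EU: "E \<subseteq> unitriangular m" by (auto simp: E_def)
  have dense: "k_dense m k E" unfolding k_dense_def
  proof (intro ballI impI)
    fix f e assume f: "f \<in> ureg m UNIV" and f0: "\<forall>g\<in>rat_points m k E. f g = 0" and e: "e \<in> E"
    have fb: "(\<lambda>g. f (block m g)) \<in> ureg n UNIV" by (rule ureg_comp[OF f block_regular]) simp
    have z: "f (block m g) = 0" if "g \<in> rat_points n k D" for g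
    proof -
      have g: "g \<in> D" "g \<in> rat_points n k (unitriangular n)" using that rat_points_unitriangular[OF K(2)] by blast+
      have "block m g \<in> rat_points m k (unitriangular m)" by (rule regular_map_rational[OF k block_regular g(2)])
      then have "block m g \<in> rat_points m k E" using E_block[OF g(1)] by (simp add: rat_points_def)
      then show ?thesis by (rule bspec[OF f0])
    qed
    have "f (block m (j_embed m e)) = 0" by (rule k_denseD[OF K(4) fb z bj(2)[OF e]])
    then show "f e = 0" using bj(1)[OF e] by simp
  qed
  show ?thesis by (rule that[OF _ Deq]) (use sg EU cl dense in \<open>simp add: k_group_def\<close>)
qed

end

text \<open>The bound \<open>d\<close> has to be the same for all \<open>F\<close>: the infinitely
  many outputs of an e-step must share one bound on the remaining depth.\<close>

lemma exists_reach:
  fixes k :: "'a::field_char_0 set"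
  assumes k: "is_subfield k" and "0 < n"
  shows "\<exists>d. \<forall>F. af_in n k F \<longrightarrow> reach n k d F"
  using assms(2)
proof (induction n)
  case (Suc m)
  show ?case
  proof (cases "m = 0")
    case True
    have "dom_af F = unitriangular (Suc m)" if F: "af_in (Suc m) k F" for F
    proof -
      have F': "F \<in> AFs_over (Suc m) k" "dom_af F \<subseteq> unitriangular (Suc m)" using F by (auto simp: af_in_def)
      have "u = 1\<^sub>m (Suc m)" if "u \<in> unitriangular (Suc m)" for u :: "'a mat"
        by (rule eq_matI) (use unitriangularD[OF that] True in auto)
      then show ?thesis using F'(2) subgroupD_GL(1)[OF k_groupD(1)[OF AFs_overD(1)[OF k F']]] by blast
    qed
    then show ?thesis by (intro exI[of _ 0]) simp
  next
    case False
    then obtain d where d: "\<And>F. af_in m k F \<Longrightarrow> reach m k d F" using Suc.IH by auto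
    have base: "reach (Suc m) k d G" if G: "af_in (Suc m) k G" and tail: "row_tail (Suc m) 1 \<subseteq> dom_af G"
      and c: "c \<in> k" and row: "\<And>y. fun_af G (rowv (Suc m) y) = c * y 1" for G c
    proof -
      interpret mirabolic_lift k m c
        by (rule mirabolic_lift.intro[OF k _ c]) (use False in simp)
      have G': "G \<in> AFs_over (Suc m) k" "dom_af G \<subseteq> unitriangular (Suc m)" using G by (auto simp: af_in_def)
      obtain E where E: "k_group m k E" "dom_af G = pre m E"
        using pre_exists[OF AFs_overD(1)[OF k G'] tail] by blast
      obtain F1 where F1: "af_in m k F1" "G = lift_af m c F1"
        using lift_af_surj[OF G E(2,1) row] by blast
      show ?thesis using reach_lift[OF d[OF F1(1)]] F1(2) by simp
    qed
    have flag: "reach (Suc m) k (Suc d) F" if "af_in (Suc m) k F" "row_tail (Suc m) 1 \<subseteq> dom_af F" for F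
      by (rule reach_flag[OF k that base]) (use False in auto)
    \<comment> \<open>At most \<open>m\<close> steps for the columns of the first row, one co-step,
      and the \<open>d\<close> steps lifted from dimension \<open>m\<close>.\<close>
    have "reach (Suc m) k (Suc d + m) F" if F: "af_in (Suc m) k F" for F
    proof (rule reach_fill_row[OF k flag _ F])
      show "m < Suc m" by simp
      have F': "F \<in> AFs_over (Suc m) k" "dom_af F \<subseteq> unitriangular (Suc m)" using F by (auto simp: af_in_def)
      \<comment> \<open>The filling can start with any \<open>F\<close>, because this tail is
        trivial.\<close>
      show "row_tail (Suc m) (Suc m) \<subseteq> dom_af F"
      proof
        fix v :: "'a mat" assume "v \<in> row_tail (Suc m) (Suc m)"
        then obtain x where x: "v = rowv (Suc m) x" "\<forall>b<Suc m. x b = 0" by (auto simp: row_tail_def)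
        have "v = rowv (Suc m) (\<lambda>b. 0)" unfolding x(1) by (rule rowv_cong) (use x(2) in simp)
        then show "v \<in> dom_af F"
          using subgroupD_GL(1)[OF k_groupD(1)[OF AFs_overD(1)[OF k F']]] by (simp add: rowv_zero)
      qed
    qed
    then show ?thesis by blast
  qed
qed simp

subsection \<open>The tree\<close>

text \<open>The empty set at domain \<open>U_n\<close> turns such a vertex into a leaf even if depth
  is left over.\<close>

definition choose_outputs :: "nat \<Rightarrow> 'a set \<Rightarrow> nat \<Rightarrow> 'a::field af \<Rightarrow> 'a af set" where
  "choose_outputs n k d F = (if dom_af F = unitriangular n then {}
     else SOME B. B \<noteq> {} \<and> step_to n k F B \<and> (\<forall>Z\<in>B. reach n k (d - 1) Z))"

lemma choose_outputs:
  assumes "reach n k d F" "dom_af F \<noteq> unitriangular n"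
  shows "0 < d" "choose_outputs n k d F \<noteq> {}" "step_to n k F (choose_outputs n k d F)"
    "Z \<in> choose_outputs n k d F \<Longrightarrow> reach n k (d - 1) Z"
proof -
  obtain e where e: "d = Suc e" using assms by (cases d) auto
  then show "0 < d" by simp
  have "\<exists>B. B \<noteq> {} \<and> step_to n k F B \<and> (\<forall>Z\<in>B. reach n k (d - 1) Z)" using assms e by simp
  from someI_ex[OF this] assms(2)
  show "choose_outputs n k d F \<noteq> {}" "step_to n k F (choose_outputs n k d F)"
    "Z \<in> choose_outputs n k d F \<Longrightarrow> reach n k (d - 1) Z"
    unfolding choose_outputs_def by auto
qed

text \<open>A vertex is the list of labels on the path from it back to the root.\<close>

inductive_set tree_verts :: "nat \<Rightarrow> 'a set \<Rightarrow> nat \<Rightarrow> 'a::field af \<Rightarrow> 'a af list set" for n k d F where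
  root: "[F] \<in> tree_verts n k d F"
| child: "v \<in> tree_verts n k d F \<Longrightarrow> Z \<in> choose_outputs n k (Suc d - length v) (hd v) \<Longrightarrow>
    Z # v \<in> tree_verts n k d F"

definition tree_of :: "nat \<Rightarrow> 'a set \<Rightarrow> nat \<Rightarrow> 'a::field af \<Rightarrow> ('a af list, 'a af) ltree" where
  "tree_of n k d F = \<lparr>tverts = tree_verts n k d F,
     tedges = {(v, v'). v \<in> tree_verts n k d F \<and>
       v' \<in> (\<lambda>Z. Z # v) ` choose_outputs n k (Suc d - length v) (hd v)},
     troot = [F], tlabel = hd\<rparr>"

text \<open>The length of a vertex counts the root, so the vertex has depth
  \<open>length v - 1\<close>, and \<open>Suc d - length v\<close> is the depth still available
  below it.\<close>

lemma tree_verts_props: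
  assumes F: "reach n k d F"
  shows "v \<in> tree_verts n k d F \<Longrightarrow> v \<noteq> [] \<and> length v \<le> Suc d \<and> reach n k (Suc d - length v) (hd v)"
proof (induction rule: tree_verts.induct)
  case (child v Z)
  have nU: "dom_af (hd v) \<noteq> unitriangular n"
    using child.hyps(2) by (auto simp: choose_outputs_def)
  note R = conjunct2[OF conjunct2[OF child.IH]]
  have "0 < Suc d - length v" by (rule choose_outputs(1)[OF R nU])
  moreover have "reach n k (Suc d - length v - 1) Z" by (rule choose_outputs(4)[OF R nU child.hyps(2)])
  ultimately show ?case by simp
qed (use F in simp)

lemma tree_of_path:
  assumes "v \<in> tree_verts n k d F"
  shows "([F], v) \<in> tedges (tree_of n k d F) ^^ (length v - 1) \<and> v \<noteq> []"
  using assms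
proof (induction rule: tree_verts.induct)
  case (child v Z)
  have "(v, Z # v) \<in> tedges (tree_of n k d F)" using child.hyps by (simp add: tree_of_def)
  moreover obtain l where "length v = Suc l" using child.IH by (cases v) auto
  ultimately show ?case using child.IH by auto
qed simp

lemma tree_of_finite_rooted:
  assumes F: "reach n k d F"
  shows "finite_rooted_tree (tree_of n k d F)"
  unfolding finite_rooted_tree_def
proof (intro conjI ballI allI)
  let ?T = "tree_of n k d F"
  show "troot ?T \<in> tverts ?T" by (simp add: tree_of_def tree_verts.root)
  show "tedges ?T \<subseteq> tverts ?T \<times> tverts ?T" by (auto simp: tree_of_def intro: tree_verts.child)
  show "(u, troot ?T) \<notin> tedges ?T" for u
    using tree_verts_props[OF F, of u] by (auto simp: tree_of_def)
  show "\<exists>!u. (u, v) \<in> tedges ?T" if v: "v \<in> tverts ?T - {troot ?T}" for v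
  proof -
    have "v \<in> tree_verts n k d F" "v \<noteq> [F]" using v by (auto simp: tree_of_def)
    then obtain u Z where "v = Z # u" "u \<in> tree_verts n k d F" "Z \<in> choose_outputs n k (Suc d - length u) (hd u)"
      by (auto elim: tree_verts.cases)
    then show ?thesis by (intro ex1I[of _ u]) (auto simp: tree_of_def)
  qed
  show "(troot ?T, v) \<in> (tedges ?T)\<^sup>*" if v: "v \<in> tverts ?T" for v
    using tree_of_path[of v n k d F] v by (auto simp: tree_of_def relpow_imp_rtrancl)
  have "\<exists>m\<le>d. (troot ?T, v) \<in> tedges ?T ^^ m" if v: "v \<in> tverts ?T" for v
  proof -
    have v': "v \<in> tree_verts n k d F" using v by (simp add: tree_of_def)
    have "length v - 1 \<le> d" using tree_verts_props[OF F v'] by auto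
    moreover have "(troot ?T, v) \<in> tedges ?T ^^ (length v - 1)" using tree_of_path[OF v'] by (simp add: tree_of_def)
    ultimately show ?thesis by blast
  qed
  then show "\<exists>d. \<forall>v\<in>tverts ?T. \<exists>m\<le>d. (troot ?T, v) \<in> tedges ?T ^^ m" by blast
qed

lemma tree_of_children:
  "v \<in> tree_verts n k d F \<Longrightarrow>
     children (tree_of n k d F) v = (\<lambda>Z. Z # v) ` choose_outputs n k (Suc d - length v) (hd v)"
  by (auto simp: tree_of_def)

text \<open>Children of \<open>v\<close> differ only in their heads, so \<open>hd\<close> matches
  them with the outputs, each appearing once.\<close>

lemma step_to_forms_step:
  assumes "step_to n k F B"
  shows "forms_step n k (rat_points n k (Mir n)) F ((\<lambda>Z. Z # v) ` B) hd"
proof -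
  have "bij_betw hd ((\<lambda>Z. Z # v) ` B) B"
    by (rule bij_betw_byWitness[where f' = "\<lambda>Z. Z # v"]) auto
  then show ?thesis using assms unfolding step_to_def forms_step_def by (elim disjE exE conjE bexE) auto
qed

theorem theorem3p1:
  fixes n :: nat
    and k :: "'a::{alg_closed_field, field_char_0} set"
    and F :: "'a af"
  assumes "n > 0"
    and "subfield k ring_of_type_algebra"
    and "F \<in> AFs_over n k"
    and "dom_af F \<subseteq> unitriangular n"
  shows "\<exists>T :: ('a af list, 'a af) ltree.
           is_tree_to n F (AFs_on n k (unitriangular n)) (Mir n) k T"
proof -
  obtain d where "\<And>F. af_in n k F \<Longrightarrow> reach n k d F"
    using exists_reach[OF assms(2,1)] by blast
  then have F: "reach n k d F" using assms(3,4) by (simp add: af_in_def)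
  let ?T = "tree_of n k d F"
  have UM: "unitriangular n \<subseteq> (Mir n :: 'a mat set)"
    using unitriangular_Mir[of "n - 1", where 'a = 'a] assms(1) by simp
  have af: "af_in n k (hd v)" if "v \<in> tree_verts n k d F" for v
    using tree_verts_props[OF F that] reach_af_in by blast
  \<comment> \<open>Nonemptiness of the chosen outputs excludes leaves with a smaller
    domain.\<close>
  have leaf: "dom_af (hd v) = unitriangular n \<longleftrightarrow> children ?T v = {}" if v: "v \<in> tree_verts n k d F" for v
    using choose_outputs(2)[OF conjunct2[OF conjunct2[OF tree_verts_props[OF F v]]]]
    unfolding tree_of_children[OF v] by (auto simp: choose_outputs_def)
  have "is_tree_to n F (AFs_on n k (unitriangular n)) (Mir n) k ?T"
    unfolding is_tree_to_def tree_over_def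
  proof (intro conjI ballI)
    show "finite_rooted_tree ?T" by (rule tree_of_finite_rooted[OF F])
    show "tlabel ?T ` tverts ?T \<subseteq> AFs_over n k" using af by (auto simp: tree_of_def af_in_def)
    show "tlabel ?T (troot ?T) = F" by (simp add: tree_of_def)
    show "dom_af (tlabel ?T v) \<subseteq> Mir n" if "v \<in> tverts ?T" for v
      using that af[of v] UM by (auto simp: tree_of_def af_in_def)
    show "tlabel ?T ` leaves ?T \<subseteq> AFs_on n k (unitriangular n)"
    proof
      fix Z assume "Z \<in> tlabel ?T ` leaves ?T"
      then obtain v where v: "v \<in> tree_verts n k d F" "children ?T v = {}" "Z = hd v"
        by (auto simp: leaves_def tree_of_def)
      then show "Z \<in> AFs_on n k (unitriangular n)"
        using leaf[OF v(1)] af[OF v(1)] by (simp add: AFs_on_def af_in_def)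
    qed
    fix v assume "v \<in> tverts ?T - leaves ?T"
    then have v: "v \<in> tree_verts n k d F" "children ?T v \<noteq> {}" by (auto simp: leaves_def tree_of_def)
    have "step_to n k (hd v) (choose_outputs n k (Suc d - length v) (hd v))"
      by (rule choose_outputs(3)[OF conjunct2[OF conjunct2[OF tree_verts_props[OF F v(1)]]]])
         (use leaf[OF v(1)] v(2) in simp)
    from step_to_forms_step[OF this, of v]
    show "forms_step n k (rat_points n k (Mir n)) (tlabel ?T v) (children ?T v) (tlabel ?T)"
      unfolding tree_of_children[OF v(1)] by (simp add: tree_of_def)
  qed
  then show ?thesis by blast
qed

end
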